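(* Let $G$ be a compact Lie group and let $\mathcal{C}$ be a set of closed subgroups of $G$ which is closed under conjugacy. Every $G$-equivariant (that is, $G$-invariant) open subspace of a $\mathcal{C}$-cofibrant $G$-space is $\mathcal{C}$-cofibrant.
   Context: All spaces are compactly generated weak Hausdorff, and all maps of $G$-spaces are $G$-equivariant. The $\mathcal{C}$-model structure on $G$-spaces is the topological model structure cofibrantly generated by the generating cofibrations $G/H\times S^{n-1}\to G/H\times D^n$ ($n\ge 0$, $H\in\mathcal{C}$) and the generating acyclic cofibrations $G/H\times D^n\to G/H\times D^n\times [0,1]$ (inclusion at $0$; $n\ge 0$, $H\in\mathcal{C}$). Its fibrations (resp. weak equivalences) are the $G$-maps $p$ such that $p^H$ is a Serre fibration (resp. weak homotopy equivalence) for every $H\in\mathcal{C}$. Its cofibrations are called $\mathcal{C}$-cofibrations; equivalently, they are the retracts of relative $\mathcal{C}$-cell complexes (transfinite composites of pushouts of generating cofibrations). A $G$-space $X$ is $\mathcal{C}$-cofibrant if $\emptyset\to X$ is a $\mathcal{C}$-cofibration. *)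

theory Defs
  imports "HOL-Analysis.Analysis" "HOL-Algebra.Left_Coset"
begin

section \<open>Compact Lie groups\<close>

record 'g top_group = "'g monoid" +
  grp_top :: "'g topology"

definition topological_group :: "('g, 'm) top_group_scheme \<Rightarrow> bool" where
  "topological_group G \<longleftrightarrow>
     group G \<and> topspace (grp_top G) = carrier G \<and>
     continuous_map (prod_topology (grp_top G) (grp_top G)) (grp_top G)
       (\<lambda>(g, h). g \<otimes>\<^bsub>G\<^esub> h) \<and>
     continuous_map (grp_top G) (grp_top G) (\<lambda>g. inv\<^bsub>G\<^esub> g)"

text \<open>
  Smoothness is set up on the library's abstract \<^const>\<open>Euclidean_space\<close>, whose dimension is an
  ordinary natural number; this admits dimension 0 (finite groups), which a type of class
  \<open>euclidean_space\<close> does not. \<open>C_diff k m W f\<close> says that the real function \<open>f\<close> is of class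
  \<open>C^k\<close> on the open set \<open>W\<close> of m-space: all iterated partial derivatives of order
  at most \<open>k\<close> exist and are continuous on \<open>W\<close>.
\<close>

primrec C_diff :: "nat \<Rightarrow> nat \<Rightarrow> (nat \<Rightarrow> real) set \<Rightarrow> ((nat \<Rightarrow> real) \<Rightarrow> real) \<Rightarrow> bool" where
  "C_diff 0 = (\<lambda>m W f. continuous_map (subtopology (Euclidean_space m) W) euclideanreal f)"
| "C_diff (Suc k) = (\<lambda>m W f.
     continuous_map (subtopology (Euclidean_space m) W) euclideanreal f \<and>
     (\<forall>i<m. \<exists>f'. (\<forall>x\<in>W. ((\<lambda>t. f (x(i := t))) has_real_derivative f' x) (at (x i))) \<and>
                C_diff k m W f'))"

definition smooth_map :: "nat \<Rightarrow> nat \<Rightarrow> (nat \<Rightarrow> real) set \<Rightarrow> ((nat \<Rightarrow> real) \<Rightarrow> nat \<Rightarrow> real) \<Rightarrow> bool" where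
  "smooth_map m n W f \<longleftrightarrow> (\<forall>j<n. \<forall>k. C_diff k m W (\<lambda>x. f x j))"

type_synonym 'g chart = "'g set \<times> ('g \<Rightarrow> nat \<Rightarrow> real)"

definition is_chart :: "nat \<Rightarrow> 'g topology \<Rightarrow> 'g chart \<Rightarrow> bool" where
  "is_chart n T = (\<lambda>(U, \<phi>).
     openin T U \<and> openin (Euclidean_space n) (\<phi> ` U) \<and>
     homeomorphic_map (subtopology T U) (subtopology (Euclidean_space n) (\<phi> ` U)) \<phi>)"

definition smooth_atlas :: "nat \<Rightarrow> 'g topology \<Rightarrow> 'g chart set \<Rightarrow> bool" where
  "smooth_atlas n T \<A> \<longleftrightarrow>
     (\<forall>c\<in>\<A>. is_chart n T c) \<and> (\<Union>c\<in>\<A>. fst c) = topspace T \<and>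
     (\<forall>(U, \<phi>)\<in>\<A>. \<forall>(V, \<psi>)\<in>\<A>. smooth_map n n (\<phi> ` (U \<inter> V)) (\<psi> \<circ> inv_into U \<phi>))"

text \<open>The two projections from 2n-space to n-space.\<close>

definition left_half :: "nat \<Rightarrow> (nat \<Rightarrow> real) \<Rightarrow> nat \<Rightarrow> real" where
  "left_half n z = (\<lambda>i. if i < n then z i else 0)"

definition right_half :: "nat \<Rightarrow> (nat \<Rightarrow> real) \<Rightarrow> nat \<Rightarrow> real" where
  "right_half n z = (\<lambda>i. if i < n then z (n + i) else 0)"

text \<open>Multiplication and inversion are smooth when expressed in any charts of the atlas.\<close>

definition Lie_group :: "('g, 'm) top_group_scheme \<Rightarrow> nat \<Rightarrow> 'g chart set \<Rightarrow> bool" where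
  "Lie_group G n \<A> \<longleftrightarrow>
     topological_group G \<and> Hausdorff_space (grp_top G) \<and> second_countable (grp_top G) \<and>
     smooth_atlas n (grp_top G) \<A> \<and>
     (\<forall>(U, \<phi>)\<in>\<A>. \<forall>(V, \<psi>)\<in>\<A>. \<forall>(W, \<xi>)\<in>\<A>.
        smooth_map (n + n) n
          {z \<in> topspace (Euclidean_space (n + n)).
             left_half n z \<in> \<phi> ` U \<and> right_half n z \<in> \<psi> ` V \<and>
             inv_into U \<phi> (left_half n z) \<otimes>\<^bsub>G\<^esub> inv_into V \<psi> (right_half n z) \<in> W}
          (\<lambda>z. \<xi> (inv_into U \<phi> (left_half n z) \<otimes>\<^bsub>G\<^esub> inv_into V \<psi> (right_half n z)))) \<and>
     (\<forall>(U, \<phi>)\<in>\<A>. \<forall>(W, \<xi>)\<in>\<A>.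
        smooth_map n n
          {x \<in> \<phi> ` U. inv\<^bsub>G\<^esub> (inv_into U \<phi> x) \<in> W}
          (\<lambda>x. \<xi> (inv\<^bsub>G\<^esub> (inv_into U \<phi> x))))"

definition compact_Lie_group :: "('g, 'm) top_group_scheme \<Rightarrow> bool" where
  "compact_Lie_group G \<longleftrightarrow> compact_space (grp_top G) \<and> (\<exists>n \<A>. Lie_group G n \<A>)"

definition closed_under_conjugacy :: "('g, 'm) monoid_scheme \<Rightarrow> 'g set set \<Rightarrow> bool" where
  "closed_under_conjugacy G \<C> \<longleftrightarrow>
     (\<forall>H\<in>\<C>. \<forall>g\<in>carrier G. (\<lambda>h. g \<otimes>\<^bsub>G\<^esub> h \<otimes>\<^bsub>G\<^esub> inv\<^bsub>G\<^esub> g) ` H \<in> \<C>)"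

section \<open>Compactly generated weak Hausdorff spaces\<close>

text \<open>
  The test maps below range over continuous maps from compact Hausdorff spaces. HOL cannot quantify
  over all types inside a definition, so the test spaces have carriers in \<open>'a set set\<close>; this
  is no restriction. Given \<open>u\<close> from a compact Hausdorff \<open>K\<close> to \<open>X\<close>, choose one point in each fibre
  over the image. The closure of the chosen points is compact, has the same image, and, being
  the closure of at most \<open>|X|\<close> points in a Hausdorff space, has at most \<open>2^2^|X|\<close> points. So the
  weak Hausdorff condition is the usual one. In a weak Hausdorff space every such image is a compact
  Hausdorff subspace, and so compact generation may be tested on inclusions of subspaces.

  The library's \<open>k_space\<close> is not used: it tests against all compact subspaces, also
  non-Hausdorff ones.
\<close>

definition weak_Hausdorff :: "'a topology \<Rightarrow> bool" where
  "weak_Hausdorff X \<longleftrightarrow>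
     (\<forall>(K :: 'a set set topology) u.
        compact_space K \<and> Hausdorff_space K \<and> continuous_map K X u \<longrightarrow> closedin X (u ` topspace K))"

definition compactly_generated :: "'a topology \<Rightarrow> bool" where
  "compactly_generated X \<longleftrightarrow>
     (\<forall>A \<subseteq> topspace X.
        (\<forall>(K :: 'a set set topology) u.
           compact_space K \<and> Hausdorff_space K \<and> continuous_map K X u \<longrightarrow>
             closedin K {k \<in> topspace K. u k \<in> A}) \<longrightarrow>
        closedin X A)"

definition CGWH :: "'a topology \<Rightarrow> bool" where
  "CGWH X \<longleftrightarrow> compactly_generated X \<and> weak_Hausdorff X"

section \<open>G-spaces\<close>

record ('g, 'a) gspace =
  gtop :: "'a topology"
  gact :: "'g \<Rightarrow> 'a \<Rightarrow> 'a"

abbreviation points :: "('g, 'a) gspace \<Rightarrow> 'a set" where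
  "points X \<equiv> topspace (gtop X)"

text \<open>
  The ordinary product topology on \<open>G \<times> X\<close> is the right one: \<open>G\<close> is compact Hausdorff, so the
  product with a compactly generated space is already compactly generated.
\<close>

definition G_space :: "('g, 'm) top_group_scheme \<Rightarrow> ('g, 'a) gspace \<Rightarrow> bool" where
  "G_space G X \<longleftrightarrow>
     CGWH (gtop X) \<and>
     continuous_map (prod_topology (grp_top G) (gtop X)) (gtop X) (\<lambda>(g, x). gact X g x) \<and>
     (\<forall>x\<in>points X. gact X \<one>\<^bsub>G\<^esub> x = x) \<and>
     (\<forall>g\<in>carrier G. \<forall>h\<in>carrier G. \<forall>x\<in>points X.
        gact X (g \<otimes>\<^bsub>G\<^esub> h) x = gact X g (gact X h x))"

definition G_map ::
  "('g, 'm) top_group_scheme \<Rightarrow> ('g, 'a) gspace \<Rightarrow> ('g, 'b) gspace \<Rightarrow> ('a \<Rightarrow> 'b) \<Rightarrow> bool" where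
  "G_map G X Y f \<longleftrightarrow>
     G_space G X \<and> G_space G Y \<and> continuous_map (gtop X) (gtop Y) f \<and>
     (\<forall>g\<in>carrier G. \<forall>x\<in>points X. f (gact X g x) = gact Y g (f x))"

definition G_invariant :: "('g, 'm) top_group_scheme \<Rightarrow> ('g, 'a) gspace \<Rightarrow> 'a set \<Rightarrow> bool" where
  "G_invariant G X U \<longleftrightarrow> (\<forall>g\<in>carrier G. \<forall>x\<in>U. gact X g x \<in> U)"

definition G_subspace :: "('g, 'a) gspace \<Rightarrow> 'a set \<Rightarrow> ('g, 'a) gspace" where
  "G_subspace X U = \<lparr>gtop = subtopology (gtop X) U, gact = gact X\<rparr>"

definition empty_G_space :: "('g, 'a) gspace" where
  "empty_G_space = \<lparr>gtop = discrete_topology {}, gact = (\<lambda>g x. x)\<rparr>"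

section \<open>Cells\<close>

definition orbit_topology :: "('g, 'm) top_group_scheme \<Rightarrow> 'g set \<Rightarrow> 'g set topology" where
  "orbit_topology G H =
     topology (\<lambda>V. V \<subseteq> lcosets\<^bsub>G\<^esub> H \<and> openin (grp_top G) {g \<in> carrier G. g <#\<^bsub>G\<^esub> H \<in> V})"

lemma openin_orbit_topology:
  assumes "topological_group G"
  shows "openin (orbit_topology G H) V \<longleftrightarrow>
           V \<subseteq> lcosets\<^bsub>G\<^esub> H \<and> openin (grp_top G) {g \<in> carrier G. g <#\<^bsub>G\<^esub> H \<in> V}"
proof -
  have "istopology (\<lambda>V. V \<subseteq> lcosets\<^bsub>G\<^esub> H \<and>
          openin (grp_top G) {g \<in> carrier G. g <#\<^bsub>G\<^esub> H \<in> V})"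
    unfolding istopology_def
  proof (intro conjI allI impI; (elim conjE)?)
    fix S T
    assume "openin (grp_top G) {g \<in> carrier G. g <#\<^bsub>G\<^esub> H \<in> S}"
      and "openin (grp_top G) {g \<in> carrier G. g <#\<^bsub>G\<^esub> H \<in> T}"
    from openin_Int[OF this]
    show "openin (grp_top G) {g \<in> carrier G. g <#\<^bsub>G\<^esub> H \<in> S \<inter> T}"
      by (rule back_subst[where P = "openin _"]) auto
  next
    fix \<K>
    assume *: "\<forall>K\<in>\<K>. K \<subseteq> lcosets\<^bsub>G\<^esub> H \<and> openin (grp_top G) {g \<in> carrier G. g <#\<^bsub>G\<^esub> H \<in> K}"
    then have "openin (grp_top G) (\<Union>K\<in>\<K>. {g \<in> carrier G. g <#\<^bsub>G\<^esub> H \<in> K})"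
      by (intro openin_Union) auto
    then show "openin (grp_top G) {g \<in> carrier G. g <#\<^bsub>G\<^esub> H \<in> \<Union> \<K>}"
      by (rule back_subst[where P = "openin _"]) auto
  qed auto
  then show ?thesis
    by (simp add: orbit_topology_def topology_inverse')
qed

lemma quotient_map_orbit_topology:
  assumes "topological_group G"
  shows "quotient_map (grp_top G) (orbit_topology G H) (\<lambda>g. g <#\<^bsub>G\<^esub> H)"
proof -
  have T: "topspace (grp_top G) = carrier G"
    using assms by (simp add: topological_group_def)
  have all: "{g \<in> carrier G. g <#\<^bsub>G\<^esub> H \<in> lcosets\<^bsub>G\<^esub> H} = carrier G"
    by (auto simp: LCOSETS_def)
  have "openin (orbit_topology G H) (lcosets\<^bsub>G\<^esub> H)"
    unfolding openin_orbit_topology[OF assms] all using T by (metis openin_topspace order_refl)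
  then have S: "topspace (orbit_topology G H) = lcosets\<^bsub>G\<^esub> H"
    by (metis assms openin_orbit_topology openin_subset openin_topspace subset_antisym)
  show ?thesis
    unfolding quotient_map_def S T by (auto simp: openin_orbit_topology[OF assms] LCOSETS_def)
qed

definition disc :: "nat \<Rightarrow> (nat \<Rightarrow> real) topology" where
  "disc n = subtopology (Euclidean_space n) {x. (\<Sum>i<n. (x i)\<^sup>2) \<le> 1}"

text \<open>The boundary sphere of the n-disc; it is empty for \<open>n = 0\<close>.\<close>

definition disc_boundary :: "nat \<Rightarrow> (nat \<Rightarrow> real) topology" where
  "disc_boundary n = subtopology (Euclidean_space n) {x. (\<Sum>i<n. (x i)\<^sup>2) = 1}"

definition orbit_times ::
  "('g, 'm) top_group_scheme \<Rightarrow> 'g set \<Rightarrow> 'b topology \<Rightarrow> ('g, 'g set \<times> 'b) gspace" where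
  "orbit_times G H K =
     \<lparr>gtop = prod_topology (orbit_topology G H) K, gact = (\<lambda>g (c, v). (g <#\<^bsub>G\<^esub> c, v))\<rparr>"

section \<open>Pushouts and transfinite composites\<close>

text \<open>
  \<open>pushout G A B X Y i f h j\<close> states that the square of G-maps
  \<open>i : A \<rightarrow> B\<close>, \<open>f : A \<rightarrow> X\<close>, \<open>h : B \<rightarrow> Y\<close>, \<open>j : X \<rightarrow> Y\<close> exhibits \<open>Y\<close> as the quotient of the disjoint
  union of \<open>X\<close> and \<open>B\<close> by the equivalence relation generated by \<open>f a \<sim> i a\<close>. For a closed
  inclusion \<open>i\<close>, the only case used, this quotient is again compactly generated
  weak Hausdorff, and hence it is the pushout in that category.
\<close>

definition glue :: "('g, 'p) gspace \<Rightarrow> ('p \<Rightarrow> 'b) \<Rightarrow> ('p \<Rightarrow> 'x) \<Rightarrow> ('x + 'b) rel" where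
  "glue A i f = (let R = {(Inl (f a), Inr (i a)) | a. a \<in> points A} in (R \<union> R\<inverse>)\<^sup>*)"

definition pushout ::
  "('g, 'm) top_group_scheme \<Rightarrow> ('g, 'p) gspace \<Rightarrow> ('g, 'b) gspace \<Rightarrow> ('g, 'x) gspace \<Rightarrow> ('g, 'y) gspace
     \<Rightarrow> ('p \<Rightarrow> 'b) \<Rightarrow> ('p \<Rightarrow> 'x) \<Rightarrow> ('b \<Rightarrow> 'y) \<Rightarrow> ('x \<Rightarrow> 'y) \<Rightarrow> bool" where
  "pushout G A B X Y i f h j \<longleftrightarrow>
     G_map G A B i \<and> G_map G A X f \<and> G_map G B Y h \<and> G_map G X Y j \<and>
     case_sum j h ` (points X <+> points B) = points Y \<and>
     (\<forall>p \<in> points X <+> points B. \<forall>q \<in> points X <+> points B.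
        case_sum j h p = case_sum j h q \<longleftrightarrow> (p, q) \<in> glue A i f) \<and>
     (\<forall>V \<subseteq> points Y. openin (gtop Y) V \<longleftrightarrow>
        openin (gtop X) {x \<in> points X. j x \<in> V} \<and> openin (gtop B) {b \<in> points B. h b \<in> V})"

definition pushout_of_generating_cofibration ::
  "('g, 'm) top_group_scheme \<Rightarrow> 'g set set \<Rightarrow> ('g, 'x) gspace \<Rightarrow> ('g, 'y) gspace \<Rightarrow> ('x \<Rightarrow> 'y) \<Rightarrow> bool" where
  "pushout_of_generating_cofibration G \<C> X Y j \<longleftrightarrow>
     (\<exists>n. \<exists>H\<in>\<C>. \<exists>f h.
        pushout G (orbit_times G H (disc_boundary n)) (orbit_times G H (disc n)) X Y id f h j)"

text \<open>
  \<open>directed_colimit G r I X t Y s\<close>: the maps \<open>s a : X a \<rightarrow> Y\<close> exhibit \<open>Y\<close> as the colimit of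
  the diagram \<open>X\<close> with transition maps \<open>t a b : X a \<rightarrow> X b\<close> over the index set \<open>I\<close>, directed by \<open>r\<close>.
  In a relative cell complex all transition maps are closed inclusions, and so the colimit
  of spaces formed here is also the colimit of compactly generated weak Hausdorff spaces.
\<close>

definition directed_colimit ::
  "('g, 'm) top_group_scheme \<Rightarrow> 'i rel \<Rightarrow> 'i set \<Rightarrow> ('i \<Rightarrow> ('g, 'a) gspace) \<Rightarrow> ('i \<Rightarrow> 'i \<Rightarrow> 'a \<Rightarrow> 'a)
     \<Rightarrow> ('g, 'b) gspace \<Rightarrow> ('i \<Rightarrow> 'a \<Rightarrow> 'b) \<Rightarrow> bool" where
  "directed_colimit G r I X t Y s \<longleftrightarrow>
     (\<forall>a\<in>I. G_map G (X a) Y (s a)) \<and>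
     (\<forall>a\<in>I. \<forall>b\<in>I. (a, b) \<in> r \<longrightarrow> (\<forall>x\<in>points (X a). s b (t a b x) = s a x)) \<and>
     (\<Union>a\<in>I. s a ` points (X a)) = points Y \<and>
     (\<forall>a\<in>I. \<forall>b\<in>I. \<forall>x\<in>points (X a). \<forall>y\<in>points (X b). s a x = s b y \<longrightarrow>
        (\<exists>c\<in>I. (a, c) \<in> r \<and> (b, c) \<in> r \<and> t a c x = t b c y)) \<and>
     (\<forall>V \<subseteq> points Y. openin (gtop Y) V \<longleftrightarrow>
        (\<forall>a\<in>I. openin (gtop (X a)) {x \<in> points (X a). s a x \<in> V}))"

definition immediate_succ :: "'i rel \<Rightarrow> 'i \<Rightarrow> 'i \<Rightarrow> bool" where
  "immediate_succ r a b \<longleftrightarrow> a \<in> Field r \<and> b \<in> Field r \<and> underS r b = under r a"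

definition limit_index :: "'i rel \<Rightarrow> 'i \<Rightarrow> bool" where
  "limit_index r b \<longleftrightarrow> b \<in> Field r \<and> underS r b \<noteq> {} \<and> (\<nexists>a. immediate_succ r a b)"

text \<open>
  A transfinite sequence indexed by the well-order \<open>r\<close> (an ordinal): a functor that is continuous at
  limit indices and whose successor steps are pushouts of generating cofibrations.
\<close>

definition cell_sequence ::
  "('g, 'm) top_group_scheme \<Rightarrow> 'g set set \<Rightarrow> 'i rel \<Rightarrow> ('i \<Rightarrow> ('g, 'a) gspace) \<Rightarrow> ('i \<Rightarrow> 'i \<Rightarrow> 'a \<Rightarrow> 'a)
     \<Rightarrow> bool" where
  "cell_sequence G \<C> r X t \<longleftrightarrow>
     Well_order r \<and>
     (\<forall>a b. (a, b) \<in> r \<longrightarrow> G_map G (X a) (X b) (t a b)) \<and>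
     (\<forall>a\<in>Field r. \<forall>x\<in>points (X a). t a a x = x) \<and>
     (\<forall>a b c. (a, b) \<in> r \<and> (b, c) \<in> r \<longrightarrow> (\<forall>x\<in>points (X a). t b c (t a b x) = t a c x)) \<and>
     (\<forall>a b. immediate_succ r a b \<longrightarrow> pushout_of_generating_cofibration G \<C> (X a) (X b) (t a b)) \<and>
     (\<forall>b. limit_index r b \<longrightarrow> directed_colimit G r (underS r b) X t (X b) (\<lambda>a. t a b))"

text \<open>
  A relative cell complex \<open>j : A \<rightarrow> B\<close> is the map from the first stage (index \<open>z\<close>) to the
  colimit of a transfinite sequence. All stages inject into \<open>B\<close> and each
  successor step adds at least one point, so stages can be taken in the type \<open>'u\<close> of \<open>B\<close>, and
  indices in \<open>'u \<times> nat\<close>, without loss of generality.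
\<close>

definition relative_cell_complex ::
  "('g, 'm) top_group_scheme \<Rightarrow> 'g set set \<Rightarrow> ('g, 'u) gspace \<Rightarrow> ('g, 'u) gspace \<Rightarrow> ('u \<Rightarrow> 'u) \<Rightarrow> bool" where
  "relative_cell_complex G \<C> A B j \<longleftrightarrow>
     (\<exists>(r :: ('u \<times> nat) rel) X t s z.
        cell_sequence G \<C> r X t \<and>
        z \<in> Field r \<and> (\<forall>a\<in>Field r. (z, a) \<in> r) \<and> A = X z \<and>
        directed_colimit G r (Field r) X t B s \<and>
        (\<forall>x\<in>points A. j x = s z x))"

section \<open>Cofibrations\<close>

definition retract_of_map ::
  "('g, 'm) top_group_scheme \<Rightarrow> ('g, 'a) gspace \<Rightarrow> ('g, 'b) gspace \<Rightarrow> ('a \<Rightarrow> 'b)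
     \<Rightarrow> ('g, 'c) gspace \<Rightarrow> ('g, 'd) gspace \<Rightarrow> ('c \<Rightarrow> 'd) \<Rightarrow> bool" where
  "retract_of_map G X Y f A B j \<longleftrightarrow>
     G_map G X Y f \<and> G_map G A B j \<and>
     (\<exists>i\<^sub>1 r\<^sub>1 i\<^sub>2 r\<^sub>2.
        G_map G X A i\<^sub>1 \<and> G_map G A X r\<^sub>1 \<and> G_map G Y B i\<^sub>2 \<and> G_map G B Y r\<^sub>2 \<and>
        (\<forall>x\<in>points X. r\<^sub>1 (i\<^sub>1 x) = x) \<and> (\<forall>y\<in>points Y. r\<^sub>2 (i\<^sub>2 y) = y) \<and>
        (\<forall>x\<in>points X. j (i\<^sub>1 x) = i\<^sub>2 (f x)) \<and> (\<forall>a\<in>points A. f (r\<^sub>1 a) = r\<^sub>2 (j a)))"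

text \<open>
  A definition in HOL cannot existentially quantify over types, so the type \<open>'u\<close>
  that carries the relative cell complex is an explicit parameter, in the role of a universe. A map is
  a cofibration in the unrestricted sense iff it is one for some \<open>'u\<close>.
\<close>

definition C_cofibration ::
  "'u itself \<Rightarrow> ('g, 'm) top_group_scheme \<Rightarrow> 'g set set \<Rightarrow> ('g, 'a) gspace \<Rightarrow> ('g, 'b) gspace
     \<Rightarrow> ('a \<Rightarrow> 'b) \<Rightarrow> bool" where
  "C_cofibration _ G \<C> X Y f \<longleftrightarrow>
     (\<exists>(A :: ('g, 'u) gspace) B j.
        relative_cell_complex G \<C> A B j \<and> retract_of_map G X Y f A B j)"

definition C_cofibrant ::
  "'u itself \<Rightarrow> ('g, 'm) top_group_scheme \<Rightarrow> 'g set set \<Rightarrow> ('g, 'a) gspace \<Rightarrow> bool" where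
  "C_cofibrant \<U> G \<C> X \<longleftrightarrow> C_cofibration \<U> G \<C> (empty_G_space :: ('g, 'a) gspace) X id"

end

theory Submission
  imports Defs
begin

text \<open>
  A cofibrant \<open>X\<close> is a retract, with retraction \<open>\<rho>\<close>, of a cell complex \<open>B\<close> built from the empty space.
  If \<open>U\<close> is open and invariant in \<open>X\<close>, then \<open>W = \<rho>\<^sup>-\<^sup>1(U)\<close> is open and invariant in \<open>B\<close>, and \<open>U\<close> is a
  retract of \<open>W\<close>. So everything comes down to showing that \<open>W\<close> is a cell complex.

  Intersect the stages of \<open>B\<close> with \<open>W\<close>. Stages embed in \<open>B\<close> as closed subspaces
  (\<open>cell_sequence_closed_embedding\<close>), so this is a filtration of \<open>W\<close> by closed invariant sets, and it is
  coherent at limits because \<open>W\<close> is open. A successor step no longer attaches one cell: from a cell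
  \<open>G/H \<times> D\<^sup>n\<close> it keeps only the part that is mapped to \<open>W\<close>. Since \<open>G\<close> acts transitively on \<open>G/H\<close>, this part
  has the form \<open>G/H \<times> W'\<close> with \<open>W'\<close> open in the disc. Identify the disc with a cube and let \<open>P\<^sub>N\<close> be the
  union of the closed cells of the grid of mesh \<open>2\<^sup>-\<^sup>N\<close> that lie in \<open>W'\<close>. The \<open>P\<^sub>N\<close> increase, every point of \<open>W'\<close>
  has a neighbourhood in one of them, and \<open>P\<^sub>N\<close> is a subcomplex of the grid of mesh \<open>2\<^sup>-\<^sup>N\<^sup>-\<^sup>1\<close>. So one
  obtains \<open>P\<^sub>N\<^sub>+\<^sub>1\<close> from \<open>P\<^sub>N\<close> by attaching finitely many grid cells in order of dimension, and \<open>W'\<close>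
  arises from \<open>W' \<inter> S\<^sup>n\<^sup>-\<^sup>1\<close> by attaching countably many cells
  (\<open>cellular_open_subset_of_cell\<close>). Splicing these sequences into the original one
  (\<open>cellular_transfinite\<close>) exhibits \<open>W\<close> as a cell complex.

  Two points keep the bookkeeping light. First, all stages are closed subsets of the one space \<open>W\<close>, so a
  transfinite sequence is simply a family of subsets that is well-ordered by inclusion; steps at which
  nothing is attached then disappear by themselves, and so does the question where the stages
  live. The indices fit into \<open>'u \<times> nat\<close> because each stage but the last can be named by a point that the next
  stage adds. Second, in a weak Hausdorff space the map of a cell is automatically closed, so the
  topology of a successor stage is the pushout topology as soon as the new cell is injective on
  its interior and sends its boundary into the previous stage.
\<close>

section \<open>Compactly generated weak Hausdorff spaces\<close>

text \<open>Moves a space to another carrier type, in particular to the type of the test spaces.\<close>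
lemma homeomorphic_copy:
  assumes "inj_on e (topspace K)"
  obtains K' where "homeomorphic_map K K' e"
proof
  let ?r = "inv_into (topspace K) e"
  let ?K' = "pullback_topology (e ` topspace K) ?r K"
  have t: "topspace ?K' = e ` topspace K"
    using assms by (auto simp: topspace_pullback_topology)
  have r: "continuous_map ?K' K ?r"
    using continuous_map_pullback[OF continuous_map_id, where f = ?r] by (simp add: o_def)
  have e: "continuous_map K ?K' e"
    by (rule continuous_map_pullback'[where g = e])
       (auto simp: assms intro: continuous_map_eq[OF continuous_map_id])
  show "homeomorphic_map K ?K' e"
    unfolding homeomorphic_map_maps homeomorphic_maps_def
    using r e t assms by (intro exI[of _ ?r]) auto
qed

text \<open>
  The weak Hausdorff condition speaks only of test spaces carried by \<open>'a set set\<close>, but the cells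
  are compact spaces of another type. Choose one point in each fibre of \<open>u\<close>. The closure \<open>L\<close> of the set \<open>D\<close>
  of chosen points has the same image as \<open>K\<close>. In a Hausdorff space a point of \<open>L\<close> is determined by
  the traces of its neighbourhoods on \<open>D\<close>, and \<open>u\<close> is injective on \<open>D\<close>, so \<open>L\<close> embeds in \<open>'a set set\<close>.
\<close>
lemma weak_Hausdorff_compact_image:
  fixes X :: "'a topology" and K :: "'k topology"
  assumes wH: "weak_Hausdorff X" and K: "compact_space K" "Hausdorff_space K"
    and u: "continuous_map K X u"
  shows "closedin X (u ` topspace K)"
proof -
  obtain D where D: "D \<subseteq> topspace K" "inj_on u D" "u ` topspace K = u ` D"
    using subset_image_inj[of "u ` topspace K" u "topspace K"] by auto
  define L where "L = K closure_of D"
  have LK: "L \<subseteq> topspace K" and DL: "D \<subseteq> L"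
    unfolding L_def using D(1) by (auto simp: closure_of_subset_topspace closure_of_subset)
  \<comment> \<open>the traces on \<open>D\<close> of the neighbourhoods of \<open>x\<close>, transported to \<open>X\<close>\<close>
  define e where "e = (\<lambda>x. {u ` (N \<inter> D) | N. openin K N \<and> x \<in> N})"
  have "inj_on e L"
  proof (rule inj_onI, rule ccontr)
    fix x y assume xy: "x \<in> L" "y \<in> L" "e x = e y" "x \<noteq> y"
    then obtain N M where NM: "openin K N" "openin K M" "x \<in> N" "y \<in> M" "disjnt N M"
      using K(2) LK unfolding Hausdorff_space_def by (metis subsetD)
    have "u ` (N \<inter> D) \<in> e y"
      using NM xy(3) unfolding e_def by blast
    then obtain N' where N': "openin K N'" "y \<in> N'" "u ` (N \<inter> D) = u ` (N' \<inter> D)"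
      unfolding e_def by blast
    have "N \<inter> D = N' \<inter> D"
      using inj_on_image_eq_iff[OF D(2), of "N \<inter> D" "N' \<inter> D"] N'(3) by simp
    moreover have "\<exists>d\<in>D. d \<in> N' \<inter> M"
      using xy(2) N' NM unfolding L_def in_closure_of by (meson IntI openin_Int)
    ultimately show False
      using NM(5) by (auto simp: disjnt_def)
  qed
  then have "inj_on e (topspace (subtopology K L))"
    using LK by (simp add: Int_absorb1)
  then obtain K' where K': "homeomorphic_map (subtopology K L) K' e"
    by (rule homeomorphic_copy)
  then obtain r where r: "homeomorphic_maps (subtopology K L) K' e r"
    by (auto simp: homeomorphic_map_maps)
  have cL: "compact_space (subtopology K L)" "Hausdorff_space (subtopology K L)"
    using K by (auto simp: L_def Hausdorff_space_subtopology closedin_compact_space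
        intro!: compact_space_subtopology)
  have "compact_space K'" "Hausdorff_space K'"
    using cL K' homeomorphic_compact_space homeomorphic_Hausdorff_space homeomorphic_map_imp_homeomorphic_space
    by blast+
  moreover have "continuous_map K' X (u \<circ> r)"
    using r u by (auto simp: homeomorphic_maps_def intro!: continuous_map_compose[of _ "subtopology K L"] continuous_map_from_subtopology)
  ultimately have "closedin X ((u \<circ> r) ` topspace K')"
    using wH unfolding weak_Hausdorff_def by blast
  moreover have "r ` topspace K' = L"
    using r LK by (metis homeomorphic_imp_surjective_map homeomorphic_maps_map topspace_subtopology_subset)
  ultimately show ?thesis
    using D(3) DL LK by (metis image_comp image_mono subset_antisym)
qed

lemma weak_Hausdorff_closed_map:
  assumes "weak_Hausdorff X" "compact_space K" "Hausdorff_space K" "continuous_map K X u"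
  shows "closed_map K X u"
  unfolding closed_map_def
proof (intro allI impI)
  fix S assume S: "closedin K S"
  have "compact_space (subtopology K S)" "Hausdorff_space (subtopology K S)"
    using S assms by (auto simp: Hausdorff_space_subtopology closedin_compact_space intro!: compact_space_subtopology)
  then show "closedin X (u ` S)"
    using weak_Hausdorff_compact_image[OF assms(1), of "subtopology K S" u] S
    by (simp add: assms(4) closedin_subset continuous_map_from_subtopology Int_absorb1)
qed

lemma CGWH_compact_Hausdorff:
  fixes X :: "'a topology"
  assumes X: "compact_space X" "Hausdorff_space X"
  shows "CGWH X"
  unfolding CGWH_def
proof
  show "weak_Hausdorff X"
    unfolding weak_Hausdorff_def using X(2) continuous_imp_closed_map
    by (metis closed_map_def closedin_topspace)
  obtain K :: "'a set set topology" where K: "homeomorphic_map X K (\<lambda>x. {{x}})"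
    by (rule homeomorphic_copy[of "\<lambda>x. {{x}}" X]) (auto simp: inj_on_def)
  then obtain u where u: "homeomorphic_maps X K (\<lambda>x. {{x}}) u"
    by (auto simp: homeomorphic_map_maps)
  have K': "compact_space K" "Hausdorff_space K"
    using X K homeomorphic_compact_space homeomorphic_Hausdorff_space homeomorphic_map_imp_homeomorphic_space
    by blast+
  show "compactly_generated X"
    unfolding compactly_generated_def
  proof (intro allI impI)
    fix A assume A: "A \<subseteq> topspace X" and
      *: "\<forall>(K :: 'a set set topology) u. compact_space K \<and> Hausdorff_space K \<and> continuous_map K X u \<longrightarrow>
             closedin K {k \<in> topspace K. u k \<in> A}"
    have "closedin K {k \<in> topspace K. u k \<in> A}"
      using * K' u by (auto simp: homeomorphic_maps_def)
    then have "closedin X {x \<in> topspace X. {{x}} \<in> {k \<in> topspace K. u k \<in> A}}"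
      by (rule closedin_continuous_map_preimage[rotated]) (use u in \<open>simp add: homeomorphic_maps_def\<close>)
    also have "{x \<in> topspace X. {{x}} \<in> {k \<in> topspace K. u k \<in> A}} = A"
      using u A by (auto simp: homeomorphic_maps_def continuous_map_def)
    finally show "closedin X A" .
  qed
qed

lemma weak_Hausdorff_subtopology:
  fixes X :: "'a topology"
  assumes "weak_Hausdorff X"
  shows "weak_Hausdorff (subtopology X S)"
  unfolding weak_Hausdorff_def
proof (intro allI impI)
  fix K :: "'a set set topology" and u
  assume K: "compact_space K \<and> Hausdorff_space K \<and> continuous_map K (subtopology X S) u"
  then have "closedin X (u ` topspace K)" "u ` topspace K \<subseteq> S"
    using assms unfolding weak_Hausdorff_def continuous_map_in_subtopology by blast+
  then show "closedin (subtopology X S) (u ` topspace K)"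
    by (simp add: closedin_subset_topspace)
qed

lemma CGWH_closed_subspace:
  fixes X :: "'a topology"
  assumes X: "CGWH X" and S: "closedin X S"
  shows "CGWH (subtopology X S)"
  unfolding CGWH_def
proof
  show "weak_Hausdorff (subtopology X S)"
    using X weak_Hausdorff_subtopology by (auto simp: CGWH_def)
  show "compactly_generated (subtopology X S)"
    unfolding compactly_generated_def
  proof (intro allI impI)
    fix A assume A: "A \<subseteq> topspace (subtopology X S)" and
      *: "\<forall>(K :: 'a set set topology) u. compact_space K \<and> Hausdorff_space K \<and>
             continuous_map K (subtopology X S) u \<longrightarrow> closedin K {k \<in> topspace K. u k \<in> A}"
    have "closedin K {k \<in> topspace K. u k \<in> A}"
      if K: "compact_space K" "Hausdorff_space K" "continuous_map K X u" for K :: "'a set set topology" and u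
    proof -
      define L where "L = {k \<in> topspace K. u k \<in> S}"
      have L: "closedin K L"
        unfolding L_def using K(3) S by (rule closedin_continuous_map_preimage)
      then have "compact_space (subtopology K L)" "Hausdorff_space (subtopology K L)"
        using K by (auto simp: Hausdorff_space_subtopology closedin_compact_space intro!: compact_space_subtopology)
      moreover have "continuous_map (subtopology K L) (subtopology X S) u"
        using K(3) by (auto simp: continuous_map_in_subtopology continuous_map_from_subtopology L_def)
      ultimately have "closedin (subtopology K L) {k \<in> topspace (subtopology K L). u k \<in> A}"
        using * by blast
      then have "closedin K {k \<in> topspace (subtopology K L). u k \<in> A}"
        using L closedin_trans_full by blast
      also have "{k \<in> topspace (subtopology K L). u k \<in> A} = {k \<in> topspace K. u k \<in> A}"
        using A by (auto simp: L_def)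
      finally show ?thesis .
    qed
    then have "closedin X A"
      using X A unfolding CGWH_def compactly_generated_def by auto
    then show "closedin (subtopology X S) A"
      using A by (simp add: closedin_subset_topspace)
  qed
qed

text \<open>
  To see that a preimage under a test map \<open>u\<close> on \<open>K\<close> is open at a point over \<open>S\<close>, shrink
  \<open>K\<close> to a closed neighbourhood of that point that \<open>u\<close> maps into \<open>S\<close>; such neighbourhoods exist since
  \<open>K\<close> is regular.
\<close>
lemma CGWH_open_subspace:
  fixes X :: "'a topology"
  assumes X: "CGWH X" and S: "openin X S"
  shows "CGWH (subtopology X S)"
  unfolding CGWH_def
proof
  show "weak_Hausdorff (subtopology X S)"
    using X weak_Hausdorff_subtopology by (auto simp: CGWH_def)
  show "compactly_generated (subtopology X S)"
    unfolding compactly_generated_def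
  proof (intro allI impI)
    fix A assume A: "A \<subseteq> topspace (subtopology X S)" and
      *: "\<forall>(K :: 'a set set topology) u. compact_space K \<and> Hausdorff_space K \<and>
             continuous_map K (subtopology X S) u \<longrightarrow> closedin K {k \<in> topspace K. u k \<in> A}"
    have SX: "S \<subseteq> topspace X"
      using S openin_subset by blast
    have "closedin K {k \<in> topspace K. u k \<in> topspace X - (S - A)}"
      if K: "compact_space K" "Hausdorff_space K" "continuous_map K X u" for K :: "'a set set topology" and u
    proof -
      define O' where "O' = {k \<in> topspace K. u k \<in> S - A}"
      have "openin K O'"
        unfolding openin_subopen[of K O']
      proof
        fix k assume k: "k \<in> O'"
        have "openin K {k \<in> topspace K. u k \<in> S}"
          using K(3) S by (rule openin_continuous_map_preimage)
        moreover have "neighbourhood_base_of (closedin K) K"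
          using K compact_Hausdorff_imp_regular_space neighbourhood_base_of_closedin by blast
        moreover have "k \<in> {k \<in> topspace K. u k \<in> S}"
          using k by (auto simp: O'_def)
        ultimately have "\<exists>N L. openin K N \<and> closedin K L \<and> k \<in> N \<and> N \<subseteq> L \<and> L \<subseteq> {k \<in> topspace K. u k \<in> S}"
          unfolding neighbourhood_base_of by presburger
        then obtain N L where NL: "openin K N" "closedin K L" "k \<in> N" "N \<subseteq> L" "L \<subseteq> {k \<in> topspace K. u k \<in> S}"
          by blast
        then have "compact_space (subtopology K L)" "Hausdorff_space (subtopology K L)"
          using K by (auto simp: Hausdorff_space_subtopology closedin_compact_space intro!: compact_space_subtopology)
        moreover have "continuous_map (subtopology K L) (subtopology X S) u"
          using K(3) NL(5) by (auto simp: continuous_map_in_subtopology continuous_map_from_subtopology)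
        ultimately have "closedin (subtopology K L) {k \<in> topspace (subtopology K L). u k \<in> A}"
          using * by blast
        then have "closedin K {k \<in> topspace (subtopology K L). u k \<in> A}"
          using NL(2) closedin_trans_full by blast
        then have "openin K (N - {k \<in> topspace (subtopology K L). u k \<in> A})"
          using NL(1) by (rule openin_diff[rotated])
        moreover have "k \<in> N - {k \<in> topspace (subtopology K L). u k \<in> A}"
          using k NL by (auto simp: O'_def)
        moreover have "N - {k \<in> topspace (subtopology K L). u k \<in> A} \<subseteq> O'"
          using NL by (auto simp: O'_def)
        ultimately show "\<exists>T. openin K T \<and> k \<in> T \<and> T \<subseteq> O'"
          by blast
      qed
      moreover have "topspace K - {k \<in> topspace K. u k \<in> topspace X - (S - A)} = O'"
        using K(3) SX by (auto simp: O'_def continuous_map_def)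
      ultimately show ?thesis
        by (simp add: closedin_def)
    qed
    then have "closedin X (topspace X - (S - A))"
      using X unfolding CGWH_def compactly_generated_def by auto
    then have "openin X (S - A)"
      using SX by (auto simp: openin_closedin_eq[of X])
    then have "openin (subtopology X S) (S - A)"
      by (simp add: openin_open_subtopology[OF S])
    moreover have "topspace (subtopology X S) - A = S - A"
      using SX by auto
    ultimately show "closedin (subtopology X S) A"
      using A unfolding closedin_def by simp
  qed
qed

section \<open>Orbits of a compact group\<close>
lemma openin_prod_topology_box:
  assumes "openin (prod_topology X Y) S" "(x, y) \<in> S"
  obtains U V where "openin X U" "openin Y V" "x \<in> U" "y \<in> V" "U \<times> V \<subseteq> S"
proof -
  show ?thesis
    using assms(1)[unfolded openin_prod_topology_alt, rule_format, OF assms(2)] that by blast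
qed

locale compact_top_group = group G for G :: "('g, 'm) top_group_scheme" (structure) +
  assumes topological: "topological_group G"
    and compact: "compact_space (grp_top G)"
    and Hausdorff: "Hausdorff_space (grp_top G)"
begin

lemma topspace_grp_top [simp]: "topspace (grp_top G) = carrier G"
  using topological by (simp add: topological_group_def)

lemma continuous_mult: "continuous_map (prod_topology (grp_top G) (grp_top G)) (grp_top G) (\<lambda>(g, h). g \<otimes> h)"
  using topological by (simp add: topological_group_def)

lemma continuous_inv: "continuous_map (grp_top G) (grp_top G) (\<lambda>g. inv g)"
  using topological by (simp add: topological_group_def)

lemma topspace_orbit_topology [simp]: "topspace (orbit_topology G H) = lcosets H"
  using quotient_imp_surjective_map[OF quotient_map_orbit_topology[OF topological, of H]]
  by (auto simp: LCOSETS_def)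

text \<open>The preimage of the image of \<open>A\<close> is the union of the right translates of \<open>A\<close> by elements of \<open>H\<close>.\<close>
lemma coset_projection_open:
  assumes H: "subgroup H G" and A: "openin (grp_top G) A"
  shows "openin (orbit_topology G H) ((\<lambda>g. g <#\<^bsub>G\<^esub> H) ` A)"
proof -
  have AG: "A \<subseteq> carrier G" and HG: "H \<subseteq> carrier G"
    using openin_subset[OF A] subgroup.subset[OF H] by auto
  have "openin (grp_top G) {g \<in> carrier G. g \<otimes> h \<in> A}" if "h \<in> H" for h
  proof -
    have "continuous_map (grp_top G) (grp_top G) ((\<lambda>(g, h). g \<otimes> h) \<circ> (\<lambda>g. (g, h)))"
      using that HG by (intro continuous_map_compose[OF _ continuous_mult] continuous_map_pairedI) auto
    from openin_continuous_map_preimage[OF this A] show ?thesis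
      by simp
  qed
  then have "openin (grp_top G) (\<Union>h\<in>H. {g \<in> carrier G. g \<otimes> h \<in> A})"
    by blast
  also have "(\<Union>h\<in>H. {g \<in> carrier G. g \<otimes> h \<in> A}) = {g \<in> carrier G. g <#\<^bsub>G\<^esub> H \<in> (\<lambda>g. g <#\<^bsub>G\<^esub> H) ` A}"
  proof (intro equalityI subsetI)
    fix g assume "g \<in> (\<Union>h\<in>H. {g \<in> carrier G. g \<otimes> h \<in> A})"
    then obtain h where h: "h \<in> H" "g \<in> carrier G" "g \<otimes> h \<in> A"
      by blast
    then have "g <#\<^bsub>G\<^esub> H = (g \<otimes> h) <#\<^bsub>G\<^esub> H"
      by (intro l_repr_independence[OF _ _ H]) (auto simp: l_coset_def)
    with h show "g \<in> {g \<in> carrier G. g <#\<^bsub>G\<^esub> H \<in> (\<lambda>g. g <#\<^bsub>G\<^esub> H) ` A}"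
      by blast
  next
    fix g assume "g \<in> {g \<in> carrier G. g <#\<^bsub>G\<^esub> H \<in> (\<lambda>g. g <#\<^bsub>G\<^esub> H) ` A}"
    then obtain a where a: "g \<in> carrier G" "a \<in> A" "g <#\<^bsub>G\<^esub> H = a <#\<^bsub>G\<^esub> H"
      by blast
    then have "a \<in> g <#\<^bsub>G\<^esub> H"
      using lcos_self[OF _ H] AG by auto
    then obtain h where "h \<in> H" "a = g \<otimes> h"
      unfolding l_coset_def by blast
    with a show "g \<in> (\<Union>h\<in>H. {g \<in> carrier G. g \<otimes> h \<in> A})"
      by blast
  qed
  finally show ?thesis
    using AG by (auto simp: openin_orbit_topology[OF topological] LCOSETS_def)
qed

lemma compact_orbit: "compact_space (orbit_topology G H)"
proof -
  have "compactin (orbit_topology G H) ((\<lambda>g. g <#\<^bsub>G\<^esub> H) ` topspace (grp_top G))"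
    using compact quotient_imp_continuous_map[OF quotient_map_orbit_topology[OF topological]]
    by (intro image_compactin) (auto simp: compact_space_def)
  also have "(\<lambda>g. g <#\<^bsub>G\<^esub> H) ` topspace (grp_top G) = topspace (orbit_topology G H)"
    using quotient_imp_surjective_map[OF quotient_map_orbit_topology[OF topological]] .
  finally show ?thesis
    by (simp add: compact_space_def)
qed

text \<open>
  Distinct cosets \<open>aH\<close> and \<open>bH\<close> have \<open>a\<^sup>-\<^sup>1b\<close> in the open complement of \<open>H\<close>. So neighbourhoods \<open>A\<close> of \<open>a\<close> and
  \<open>B\<close> of \<open>b\<close> with \<open>A\<^sup>-\<^sup>1B\<close> disjoint from \<open>H\<close> have disjoint, and open, images in the orbit space.
\<close>
lemma Hausdorff_orbit:
  assumes H: "subgroup H G" and cl: "closedin (grp_top G) H"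
  shows "Hausdorff_space (orbit_topology G H)"
  unfolding Hausdorff_space_def
proof (intro allI impI)
  fix c d assume "c \<in> topspace (orbit_topology G H) \<and> d \<in> topspace (orbit_topology G H) \<and> c \<noteq> d"
  then obtain a b where ab: "a \<in> carrier G" "b \<in> carrier G" "c = a <#\<^bsub>G\<^esub> H" "d = b <#\<^bsub>G\<^esub> H" "a <#\<^bsub>G\<^esub> H \<noteq> b <#\<^bsub>G\<^esub> H"
    by (auto simp: LCOSETS_def)
  have HG: "H \<subseteq> carrier G"
    using H subgroup.subset by auto
  let ?T = "grp_top G"
  have mem: "x <#\<^bsub>G\<^esub> H = y <#\<^bsub>G\<^esub> H \<longleftrightarrow> inv x \<otimes> y \<in> H" if "x \<in> carrier G" "y \<in> carrier G" for x y
  proof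
    assume "x <#\<^bsub>G\<^esub> H = y <#\<^bsub>G\<^esub> H"
    then have "y \<in> x <#\<^bsub>G\<^esub> H"
      using lcos_self[OF that(2) H] by simp
    then show "inv x \<otimes> y \<in> H"
      using subgroup.lcos_module_imp[OF H is_group that(1)] by blast
  next
    assume "inv x \<otimes> y \<in> H"
    then have "y \<in> x <#\<^bsub>G\<^esub> H"
      using subgroup.lcos_module_rev[OF H is_group that] by blast
    then show "x <#\<^bsub>G\<^esub> H = y <#\<^bsub>G\<^esub> H"
      using l_repr_independence[OF _ that(1) H] by blast
  qed
  define m where "m = (\<lambda>(x, y). inv x \<otimes> y)"
  have "continuous_map (prod_topology ?T ?T) ?T ((\<lambda>(g, h). g \<otimes> h) \<circ> (\<lambda>p. (inv (fst p), snd p)))"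
    by (intro continuous_map_compose[OF _ continuous_mult] continuous_map_pairedI continuous_map_snd
        continuous_map_compose[OF continuous_map_fst continuous_inv, unfolded o_def])
  then have m: "continuous_map (prod_topology ?T ?T) ?T m"
    by (simp add: m_def o_def case_prod_unfold)
  have "openin ?T (carrier G - H)"
    using cl by (simp add: closedin_def)
  from openin_continuous_map_preimage[OF m this]
  have "openin (prod_topology ?T ?T) {p \<in> topspace (prod_topology ?T ?T). m p \<in> carrier G - H}" .
  moreover have "(a, b) \<in> {p \<in> topspace (prod_topology ?T ?T). m p \<in> carrier G - H}"
    using ab mem by (auto simp: m_def)
  ultimately obtain A B where AB: "openin ?T A" "openin ?T B" "a \<in> A" "b \<in> B"
      "A \<times> B \<subseteq> {p \<in> topspace (prod_topology ?T ?T). m p \<in> carrier G - H}"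
    by (rule openin_prod_topology_box)
  show "\<exists>U V. openin (orbit_topology G H) U \<and> openin (orbit_topology G H) V \<and> c \<in> U \<and> d \<in> V \<and> disjnt U V"
  proof (intro exI conjI)
    show "openin (orbit_topology G H) ((\<lambda>g. g <#\<^bsub>G\<^esub> H) ` A)" "openin (orbit_topology G H) ((\<lambda>g. g <#\<^bsub>G\<^esub> H) ` B)"
      using AB H coset_projection_open by auto
    show "c \<in> (\<lambda>g. g <#\<^bsub>G\<^esub> H) ` A" "d \<in> (\<lambda>g. g <#\<^bsub>G\<^esub> H) ` B"
      using ab AB by auto
    have "x <#\<^bsub>G\<^esub> H \<noteq> y <#\<^bsub>G\<^esub> H" if "x \<in> A" "y \<in> B" for x y
    proof -
      have "(x, y) \<in> {p \<in> topspace (prod_topology ?T ?T). m p \<in> carrier G - H}"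
        using AB that by blast
      then show ?thesis
        using mem[of x y] by (auto simp: m_def)
    qed
    then show "disjnt ((\<lambda>g. g <#\<^bsub>G\<^esub> H) ` A) ((\<lambda>g. g <#\<^bsub>G\<^esub> H) ` B)"
      by (auto simp: disjnt_def)
  qed
qed

lemma coset_translate:
  assumes "subgroup H G" "g \<in> carrier G" "c \<in> lcosets H"
  shows "g <#\<^bsub>G\<^esub> c \<in> lcosets H"
  using assms subgroup.subset[OF assms(1)] by (auto simp: LCOSETS_def lcos_m_assoc)

lemma coset_action:
  assumes H: "subgroup H G"
  shows "\<And>c. c \<in> lcosets H \<Longrightarrow> \<one> <#\<^bsub>G\<^esub> c = c"
    and "\<And>g h c. g \<in> carrier G \<Longrightarrow> h \<in> carrier G \<Longrightarrow> c \<in> lcosets H \<Longrightarrow> (g \<otimes> h) <#\<^bsub>G\<^esub> c = g <#\<^bsub>G\<^esub> (h <#\<^bsub>G\<^esub> c)"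
proof -
  have *: "c \<subseteq> carrier G" if "c \<in> lcosets H" for c
    using that subgroup.lcosets_carrier[OF H is_group] by blast
  show "\<one> <#\<^bsub>G\<^esub> c = c" if "c \<in> lcosets H" for c
    using *[OF that] lcos_mult_one by blast
  show "(g \<otimes> h) <#\<^bsub>G\<^esub> c = g <#\<^bsub>G\<^esub> (h <#\<^bsub>G\<^esub> c)" if "g \<in> carrier G" "h \<in> carrier G" "c \<in> lcosets H" for g h c
    using lcos_m_assoc[OF *[OF that(3)] that(1,2)] by simp
qed

lemma coset_transitive:
  assumes "subgroup H G" "c \<in> lcosets H" "d \<in> lcosets H"
  obtains g where "g \<in> carrier G" "g <#\<^bsub>G\<^esub> c = d"
proof -
  obtain a b where ab: "a \<in> carrier G" "b \<in> carrier G" "c = a <#\<^bsub>G\<^esub> H" "d = b <#\<^bsub>G\<^esub> H"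
    using assms by (auto simp: LCOSETS_def)
  have "(b \<otimes> inv a) <#\<^bsub>G\<^esub> c = d"
    using ab subgroup.subset[OF assms(1)] by (simp add: lcos_m_assoc m_assoc)
  moreover have "b \<otimes> inv a \<in> carrier G"
    using ab by simp
  ultimately show ?thesis
    using that by metis
qed

lemma continuous_coset_action:
  assumes H: "subgroup H G"
  shows "continuous_map (prod_topology (grp_top G) (orbit_topology G H)) (orbit_topology G H) (\<lambda>(g, c). g <#\<^bsub>G\<^esub> c)"
  unfolding continuous_map_def
proof (intro conjI allI impI)
  let ?T = "grp_top G" and ?O = "orbit_topology G H"
  have HG: "H \<subseteq> carrier G"
    using H subgroup.subset by auto
  show "(\<lambda>(g, c). g <#\<^bsub>G\<^esub> c) \<in> topspace (prod_topology ?T ?O) \<rightarrow> topspace ?O"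
    using coset_translate[OF H] by auto
  fix S assume S: "openin ?O S"
  show "openin (prod_topology ?T ?O) {p \<in> topspace (prod_topology ?T ?O). (case p of (g, c) \<Rightarrow> g <#\<^bsub>G\<^esub> c) \<in> S}"
    unfolding openin_prod_topology_alt
  proof (intro allI impI)
    fix g c assume gc: "(g, c) \<in> {p \<in> topspace (prod_topology ?T ?O). (case p of (g, c) \<Rightarrow> g <#\<^bsub>G\<^esub> c) \<in> S}"
    then obtain a where a: "g \<in> carrier G" "a \<in> carrier G" "c = a <#\<^bsub>G\<^esub> H" "(g \<otimes> a) <#\<^bsub>G\<^esub> H \<in> S"
      using HG by (auto simp: LCOSETS_def lcos_m_assoc)
    have "openin ?T {x \<in> carrier G. x <#\<^bsub>G\<^esub> H \<in> S}"
      using S by (simp add: openin_orbit_topology[OF topological])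
    from openin_continuous_map_preimage[OF continuous_mult this]
    have "openin (prod_topology ?T ?T) {p \<in> carrier G \<times> carrier G. (case p of (g, h) \<Rightarrow> g \<otimes> h) \<in> {x \<in> carrier G. x <#\<^bsub>G\<^esub> H \<in> S}}"
      by simp
    moreover have "(g, a) \<in> {p \<in> carrier G \<times> carrier G. (case p of (g, h) \<Rightarrow> g \<otimes> h) \<in> {x \<in> carrier G. x <#\<^bsub>G\<^esub> H \<in> S}}"
      using a by auto
    ultimately obtain A B where AB: "openin ?T A" "openin ?T B" "g \<in> A" "a \<in> B"
      "A \<times> B \<subseteq> {p \<in> carrier G \<times> carrier G. (case p of (g, h) \<Rightarrow> g \<otimes> h) \<in> {x \<in> carrier G. x <#\<^bsub>G\<^esub> H \<in> S}}"
      by (rule openin_prod_topology_box)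
    have "A \<times> (\<lambda>g. g <#\<^bsub>G\<^esub> H) ` B \<subseteq> {p \<in> topspace (prod_topology ?T ?O). (case p of (g, c) \<Rightarrow> g <#\<^bsub>G\<^esub> c) \<in> S}"
    proof clarify
      fix x y assume "x \<in> A" "y \<in> B"
      then have "(x, y) \<in> {p \<in> carrier G \<times> carrier G. (case p of (g, h) \<Rightarrow> g \<otimes> h) \<in> {x \<in> carrier G. x <#\<^bsub>G\<^esub> H \<in> S}}"
        using AB by blast
      then show "(x, y <#\<^bsub>G\<^esub> H) \<in> topspace (prod_topology ?T ?O) \<and> x <#\<^bsub>G\<^esub> (y <#\<^bsub>G\<^esub> H) \<in> S"
        using HG by (auto simp: lcos_m_assoc LCOSETS_def)
    qed
    then show "\<exists>U V. openin ?T U \<and> openin ?O V \<and> g \<in> U \<and> c \<in> V \<and>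
        U \<times> V \<subseteq> {p \<in> topspace (prod_topology ?T ?O). (case p of (g, c) \<Rightarrow> g <#\<^bsub>G\<^esub> c) \<in> S}"
      using AB a coset_projection_open[OF H AB(2)] by blast
  qed
qed

lemma points_orbit_times [simp]: "points (orbit_times G H K) = (lcosets H) \<times> topspace K"
  by (simp add: orbit_times_def)

lemma compact_Hausdorff_orbit_times:
  assumes H: "subgroup H G" "closedin (grp_top G) H" and K: "compact_space K" "Hausdorff_space K"
  shows "compact_space (gtop (orbit_times G H K))" "Hausdorff_space (gtop (orbit_times G H K))"
  using Hausdorff_orbit[OF H] compact_orbit K
  by (auto simp: orbit_times_def Hausdorff_space_prod_topology compact_space_def compactin_Times)

lemma G_space_orbit_times:
  assumes H: "subgroup H G" "closedin (grp_top G) H" and K: "compact_space K" "Hausdorff_space K"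
  shows "G_space G (orbit_times G H K)"
  unfolding G_space_def
proof (intro conjI ballI)
  let ?T = "grp_top G" and ?O = "orbit_topology G H"
  show "CGWH (gtop (orbit_times G H K))"
    using assms by (intro CGWH_compact_Hausdorff compact_Hausdorff_orbit_times)
  have "continuous_map (prod_topology ?T (prod_topology ?O K)) ?O
          ((\<lambda>(g, c). g <#\<^bsub>G\<^esub> c) \<circ> (\<lambda>p. (fst p, fst (snd p))))"
    by (intro continuous_map_compose[OF _ continuous_coset_action[OF H(1)]] continuous_map_pairedI continuous_map_fst
        continuous_map_compose[OF continuous_map_snd continuous_map_fst, unfolded o_def])
  then have "continuous_map (prod_topology ?T (prod_topology ?O K)) (prod_topology ?O K)
      (\<lambda>p. (fst p <#\<^bsub>G\<^esub> fst (snd p), snd (snd p)))"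
    by (intro continuous_map_pairedI continuous_map_compose[OF continuous_map_snd continuous_map_snd, unfolded o_def])
       (simp add: o_def)
  then show "continuous_map (prod_topology ?T (gtop (orbit_times G H K))) (gtop (orbit_times G H K))
     (\<lambda>(g, x). gact (orbit_times G H K) g x)"
    by (simp add: orbit_times_def case_prod_unfold)
qed (use H coset_action in \<open>auto simp: orbit_times_def\<close>)

end

section \<open>G-spaces, discs and cubes\<close>
lemma gtop_G_subspace [simp]: "gtop (G_subspace X S) = subtopology (gtop X) S"
  and gact_G_subspace [simp]: "gact (G_subspace X S) = gact X"
  by (simp_all add: G_subspace_def)

lemma G_space_subspace:
  assumes X: "G_space G X" and S: "G_invariant G X S" and C: "CGWH (subtopology (gtop X) S)"
    and G: "topspace (grp_top G) = carrier G"
  shows "G_space G (G_subspace X S)"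
  unfolding G_space_def
proof (intro conjI ballI)
  show "CGWH (gtop (G_subspace X S))"
    using C by simp
  have "continuous_map (subtopology (prod_topology (grp_top G) (gtop X)) (carrier G \<times> S)) (gtop X) (\<lambda>(g, x). gact X g x)"
    using X by (simp add: G_space_def continuous_map_from_subtopology)
  then show "continuous_map (prod_topology (grp_top G) (gtop (G_subspace X S))) (gtop (G_subspace X S))
     (\<lambda>(g, x). gact (G_subspace X S) g x)"
    using S G by (auto simp: prod_topology_subtopology continuous_map_in_subtopology G_invariant_def)
qed (use X in \<open>auto simp: G_space_def\<close>)

lemma G_space_closed_subspace:
  assumes "G_space G X" "G_invariant G X S" "closedin (gtop X) S" "topspace (grp_top G) = carrier G"
  shows "G_space G (G_subspace X S)"
  using assms by (intro G_space_subspace CGWH_closed_subspace) (auto simp: G_space_def)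

lemma G_space_open_subspace:
  assumes "G_space G X" "G_invariant G X S" "openin (gtop X) S" "topspace (grp_top G) = carrier G"
  shows "G_space G (G_subspace X S)"
  using assms by (intro G_space_subspace CGWH_open_subspace) (auto simp: G_space_def)

lemma G_map_compose:
  assumes "G_map G X Y f" "G_map G Y Z g"
  shows "G_map G X Z (g \<circ> f)"
proof -
  have "f x \<in> points Y" if "x \<in> points X" for x
    using assms that by (auto simp: G_map_def continuous_map_def)
  then show ?thesis
    using assms unfolding G_map_def by (auto intro: continuous_map_compose)
qed

lemma G_map_subspace:
  assumes f: "G_map G X Y f" and S: "G_space G (G_subspace X S)" and T: "G_space G (G_subspace Y T)"
    and fST: "\<And>x. x \<in> points X \<Longrightarrow> x \<in> S \<Longrightarrow> f x \<in> T"
  shows "G_map G (G_subspace X S) (G_subspace Y T) f"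
  using assms unfolding G_map_def
  by (auto simp: continuous_map_in_subtopology continuous_map_from_subtopology)

lemma Euclidean_space_top_of_set: "Euclidean_space n = top_of_set {x. \<forall>i\<ge>n. x i = 0}"
  by (simp add: Euclidean_space_def euclidean_product_topology)

definition cube :: "nat \<Rightarrow> (nat \<Rightarrow> real) set" where
  "cube n = {x. (\<forall>i\<ge>n. x i = 0) \<and> (\<forall>i<n. \<bar>x i\<bar> \<le> 1)}"

lemma compact_cube: "compact (cube n)"
proof -
  have "cube n = PiE UNIV (\<lambda>i. if i < n then {-1..1} else {0})"
  proof (rule Set.set_eqI)
    fix x :: "nat \<Rightarrow> real"
    have "x \<in> cube n \<longleftrightarrow> (\<forall>i. x i \<in> (if i < n then {-1..1} else {0}))"
      unfolding cube_def by (force simp: abs_le_iff not_less)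
    then show "x \<in> cube n \<longleftrightarrow> x \<in> PiE UNIV (\<lambda>i. if i < n then {-1..1} else {0})"
      by (simp add: PiE_UNIV_domain Pi_iff)
  qed
  moreover have "compactin (powertop_real UNIV) (PiE UNIV (\<lambda>i. if i < n then {-1..1} else {0}))"
    by (simp add: compactin_PiE)
  ultimately show ?thesis
    by (simp add: euclidean_product_topology)
qed

lemma disc_top_of_set: "disc n = top_of_set {x. (\<forall>i\<ge>n. x i = 0) \<and> (\<Sum>i<n. (x i)\<^sup>2) \<le> 1}"
  unfolding disc_def Euclidean_space_top_of_set subtopology_subtopology Collect_conj_eq ..

lemma disc_boundary_top_of_set: "disc_boundary n = top_of_set {x. (\<forall>i\<ge>n. x i = 0) \<and> (\<Sum>i<n. (x i)\<^sup>2) = 1}"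
  unfolding disc_boundary_def Euclidean_space_top_of_set subtopology_subtopology Collect_conj_eq ..

lemma continuous_coordinate [continuous_intros]: "continuous_on A (\<lambda>x::nat \<Rightarrow> real. x i)"
  by (rule continuous_on_subset[OF continuous_on_product_coordinates]) simp

lemma ball_subset_cube: "{x. (\<forall>i\<ge>n. x i = 0) \<and> (\<Sum>i<n. (x i)\<^sup>2) \<le> 1} \<subseteq> cube n"
proof (clarsimp simp: cube_def)
  fix x :: "nat \<Rightarrow> real" and i assume "(\<Sum>i<n. (x i)\<^sup>2) \<le> 1" "i < n"
  moreover have "(x i)\<^sup>2 \<le> (\<Sum>i<n. (x i)\<^sup>2)"
    using \<open>i < n\<close> by (intro member_le_sum) auto
  ultimately show "\<bar>x i\<bar> \<le> 1"
    using abs_square_le_1[of "x i"] by linarith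
qed

lemma closed_finite_coordinates: "closed {x :: nat \<Rightarrow> real. \<forall>i\<ge>n. x i = 0}"
proof -
  have "closed {x :: nat \<Rightarrow> real. x i = 0}" for i
    by (rule closed_Collect_eq[OF continuous_coordinate continuous_on_const])
  then have "closed (\<Inter>i\<in>{n..}. {x :: nat \<Rightarrow> real. x i = 0})"
    by blast
  moreover have "(\<Inter>i\<in>{n..}. {x :: nat \<Rightarrow> real. x i = 0}) = {x. \<forall>i\<ge>n. x i = 0}"
    by auto
  ultimately show ?thesis
    by simp
qed

lemma continuous_sum_squares: "continuous_on A (\<lambda>x :: nat \<Rightarrow> real. \<Sum>i<n. (x i)\<^sup>2)"
  by (intro continuous_on_sum continuous_on_power continuous_coordinate)

lemma compact_closed_in_cube:
  assumes "closed S" "S \<subseteq> cube n"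
  shows "compact S"
proof -
  have "cube n \<inter> S = S"
    using assms(2) by blast
  then show ?thesis
    using compact_Int_closed[OF compact_cube assms(1), of n] by metis
qed

lemma compact_ball: "compact {x :: nat \<Rightarrow> real. (\<forall>i\<ge>n. x i = 0) \<and> (\<Sum>i<n. (x i)\<^sup>2) \<le> 1}"
proof -
  have "closed {x :: nat \<Rightarrow> real. (\<forall>i\<ge>n. x i = 0) \<and> (\<Sum>i<n. (x i)\<^sup>2) \<le> 1}"
    by (rule closed_Collect_conj[OF closed_finite_coordinates
          closed_Collect_le[OF continuous_sum_squares continuous_on_const]])
  then show ?thesis
    by (rule compact_closed_in_cube[OF _ ball_subset_cube])
qed

lemma compact_sphere: "compact {x :: nat \<Rightarrow> real. (\<forall>i\<ge>n. x i = 0) \<and> (\<Sum>i<n. (x i)\<^sup>2) = 1}"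
proof -
  have "closed {x :: nat \<Rightarrow> real. (\<forall>i\<ge>n. x i = 0) \<and> (\<Sum>i<n. (x i)\<^sup>2) = 1}"
    by (rule closed_Collect_conj[OF closed_finite_coordinates
          closed_Collect_eq[OF continuous_sum_squares continuous_on_const]])
  moreover have "{x :: nat \<Rightarrow> real. (\<forall>i\<ge>n. x i = 0) \<and> (\<Sum>i<n. (x i)\<^sup>2) = 1} \<subseteq> cube n"
    using ball_subset_cube[of n] by (rule order_trans[rotated]) auto
  ultimately show ?thesis
    by (rule compact_closed_in_cube)
qed

lemma disc_compact_Hausdorff [simp]:
  "compact_space (disc n)" "Hausdorff_space (disc n)"
  "compact_space (disc_boundary n)" "Hausdorff_space (disc_boundary n)"
  using compact_ball[of n] compact_sphere[of n]
  by (auto simp: disc_top_of_set disc_boundary_top_of_set compact_space_subtopology Hausdorff_space_subtopology)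

lemma topspace_disc: "topspace (disc n) = {x. (\<forall>i\<ge>n. x i = 0) \<and> (\<Sum>i<n. (x i)\<^sup>2) \<le> 1}"
  by (simp add: disc_top_of_set)

lemma topspace_disc_boundary: "topspace (disc_boundary n) = {x. (\<forall>i\<ge>n. x i = 0) \<and> (\<Sum>i<n. (x i)\<^sup>2) = 1}"
  by (simp add: disc_boundary_top_of_set)

lemma disc_boundary_subset: "topspace (disc_boundary n) \<subseteq> topspace (disc n)"
  by (auto simp: topspace_disc topspace_disc_boundary)

section \<open>Cellular filtrations\<close>

text \<open>
  The normal form \<open>\<rho>\<close> replaces a point of the attaching region by its image. It is constant on the
  classes of the gluing relation and related to its argument, so it decides the relation.
\<close>
lemma glue_id_iff:
  fixes A :: "('g, 'b) gspace" and f :: "'b \<Rightarrow> 'x"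
  defines "\<rho> \<equiv> case_sum Inl (\<lambda>b. if b \<in> points A then Inl (f b) else Inr b)"
  shows "(p, q) \<in> glue A id f \<longleftrightarrow> \<rho> p = \<rho> q"
proof -
  define R where "R = {(Inl (f a), Inr a) :: ('x + 'b) \<times> ('x + 'b) | a. a \<in> points A}"
  have g: "glue A id f = (R \<union> R\<inverse>)\<^sup>*"
    by (simp add: glue_def R_def Let_def)
  have sym: "sym ((R \<union> R\<inverse>)\<^sup>*)"
    by (intro sym_rtrancl sym_Un_converse)
  have normal: "(p, \<rho> p) \<in> (R \<union> R\<inverse>)\<^sup>*" for p
    by (cases p) (auto simp: \<rho>_def R_def)
  have gen: "\<rho> p = \<rho> q" if "(p, q) \<in> R \<union> R\<inverse>" for p q
    using that by (auto simp: R_def \<rho>_def)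
  have "\<rho> p = \<rho> q" if "(p, q) \<in> (R \<union> R\<inverse>)\<^sup>*"
    using that by (induction rule: rtrancl_induct) (simp_all add: gen[symmetric])
  moreover have "(p, q) \<in> (R \<union> R\<inverse>)\<^sup>*" if "\<rho> p = \<rho> q"
    using normal[of p] normal[of q] symD[OF sym] that by (metis rtrancl_trans)
  ultimately show ?thesis
    unfolding g by blast
qed

lemma Well_order_least:
  assumes "Well_order r" "S \<subseteq> Field r" "S \<noteq> {}"
  obtains m where "m \<in> S" "\<And>b. b \<in> S \<Longrightarrow> (m, b) \<in> r"
proof -
  have "\<exists>m\<in>S. \<forall>b\<in>S. (m, b) \<in> r"
    using Linear_order_Well_order_iff[of r] assms by (simp add: well_order_on_def)
  then show ?thesis
    using that by blast
qed

lemma Well_order_total: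
  assumes "Well_order r" "a \<in> Field r" "b \<in> Field r"
  shows "a = b \<or> a \<in> underS r b \<or> b \<in> underS r a"
proof -
  have "a \<noteq> b \<Longrightarrow> (a, b) \<in> r \<or> (b, a) \<in> r"
    using assms by (simp add: well_order_on_def linear_order_on_def total_on_def)
  then show ?thesis
    by (auto simp: underS_def)
qed

lemma Well_order_underS_asym:
  assumes "Well_order r" "a \<in> underS r b" "(b, a) \<in> r"
  shows False
proof -
  have "antisym r"
    using assms(1) by (simp add: well_order_on_def linear_order_on_def partial_order_on_def)
  then show False
    using assms(2,3) by (auto simp: underS_def dest: antisymD)
qed

lemma G_map_invariant_image:
  assumes "G_map G X Y f" "G_invariant G X S" "S \<subseteq> points X"
  shows "G_invariant G Y (f ` S)"
  unfolding G_invariant_def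
proof (intro ballI)
  fix g y assume g: "g \<in> carrier G" and "y \<in> f ` S"
  then obtain x where x: "x \<in> S" "y = f x"
    by blast
  then have "gact Y g y = f (gact X g x)"
    using assms(1,3) g by (auto simp: G_map_def)
  then show "gact Y g y \<in> f ` S"
    using assms(2) g x(1) by (auto simp: G_invariant_def)
qed

locale cell_family = compact_top_group G for G :: "('g, 'm) top_group_scheme" (structure) +
  fixes \<C> :: "'g set set"
  assumes subgroups: "H \<in> \<C> \<Longrightarrow> subgroup H G"
    and closed_subgroups: "H \<in> \<C> \<Longrightarrow> closedin (grp_top G) H"
begin

text \<open>
  \<open>F'\<close> arises from \<open>F\<close> by attaching one cell. The topology takes care of itself: the cell is compact,
  so its map into the weak Hausdorff space \<open>V\<close> is closed.
\<close>
definition attaches :: "('g, 'a) gspace \<Rightarrow> 'a set \<Rightarrow> 'a set \<Rightarrow> bool" where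
  "attaches V F F' \<longleftrightarrow> F \<subset> F' \<and>
     (\<exists>n. \<exists>H\<in>\<C>. \<exists>h. G_map G (orbit_times G H (disc n)) V h \<and>
        h ` ((lcosets H) \<times> topspace (disc_boundary n)) \<subseteq> F \<and>
        bij_betw h ((lcosets H) \<times> (topspace (disc n) - topspace (disc_boundary n))) (F' - F))"

text \<open>The topology of \<open>F\<close> as a subset of \<open>V\<close> is the colimit topology of the members of \<open>P\<close>.\<close>
definition coherent :: "('g, 'a) gspace \<Rightarrow> 'a set set \<Rightarrow> 'a set \<Rightarrow> bool" where
  "coherent V P F \<longleftrightarrow> \<Union>P = F \<and>
     (\<forall>T\<subseteq>F. (\<forall>E\<in>P. closedin (gtop V) (T \<inter> E)) \<longrightarrow> closedin (gtop V) T)"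

text \<open>
  That each nonempty subfamily contains its intersection says that inclusion well-orders the family. The union of the proper predecessors of \<open>F\<close> is then either the immediate predecessor
  of \<open>F\<close>, from which \<open>F\<close> must arise by attaching a cell, or all of \<open>F\<close>, which is the limit case. Attaching
  enlarges strictly, so the two alternatives exclude each other.
\<close>
definition cell_filtration :: "('g, 'a) gspace \<Rightarrow> 'a set \<Rightarrow> 'a set \<Rightarrow> 'a set set \<Rightarrow> bool" where
  "cell_filtration V F\<^sub>0 F\<^sub>1 \<F> \<longleftrightarrow>
     F\<^sub>0 \<in> \<F> \<and> F\<^sub>1 \<in> \<F> \<and>
     (\<forall>F\<in>\<F>. F\<^sub>0 \<subseteq> F \<and> F \<subseteq> F\<^sub>1 \<and> closedin (gtop V) F \<and> G_invariant G V F) \<and>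
     (\<forall>\<S>\<subseteq>\<F>. \<S> \<noteq> {} \<longrightarrow> \<Inter>\<S> \<in> \<S>) \<and>
     (\<forall>F\<in>\<F> - {F\<^sub>0}.
        \<Union>{E \<in> \<F>. E \<subset> F} \<in> \<F> \<and> attaches V (\<Union>{E \<in> \<F>. E \<subset> F}) F \<or>
        coherent V {E \<in> \<F>. E \<subset> F} F)"

definition cellular :: "('g, 'a) gspace \<Rightarrow> 'a set \<Rightarrow> 'a set \<Rightarrow> bool" where
  "cellular V F\<^sub>0 F\<^sub>1 \<longleftrightarrow> (\<exists>\<F>. cell_filtration V F\<^sub>0 F\<^sub>1 \<F>)"

lemma cell_filtrationD:
  assumes "cell_filtration V F\<^sub>0 F\<^sub>1 \<F>"
  shows "F\<^sub>0 \<in> \<F>" "F\<^sub>1 \<in> \<F>"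
    and "\<And>F. F \<in> \<F> \<Longrightarrow> F\<^sub>0 \<subseteq> F" "\<And>F. F \<in> \<F> \<Longrightarrow> F \<subseteq> F\<^sub>1"
    and "\<And>F. F \<in> \<F> \<Longrightarrow> closedin (gtop V) F" "\<And>F. F \<in> \<F> \<Longrightarrow> G_invariant G V F"
    and "\<And>\<S>. \<S> \<subseteq> \<F> \<Longrightarrow> \<S> \<noteq> {} \<Longrightarrow> \<Inter>\<S> \<in> \<S>"
    and "\<And>F. F \<in> \<F> \<Longrightarrow> F \<noteq> F\<^sub>0 \<Longrightarrow>
           \<Union>{E \<in> \<F>. E \<subset> F} \<in> \<F> \<and> attaches V (\<Union>{E \<in> \<F>. E \<subset> F}) F \<or> coherent V {E \<in> \<F>. E \<subset> F} F"
  using assms unfolding cell_filtration_def by blast+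

lemma cell_filtration_linear:
  assumes "cell_filtration V F\<^sub>0 F\<^sub>1 \<F>" "E \<in> \<F>" "F \<in> \<F>"
  shows "E \<subseteq> F \<or> F \<subseteq> E"
  using cell_filtrationD(7)[OF assms(1), of "{E, F}"] assms(2,3) by auto

lemma cellularD:
  assumes "cellular V F\<^sub>0 F\<^sub>1"
  shows "F\<^sub>0 \<subseteq> F\<^sub>1" "closedin (gtop V) F\<^sub>0" "closedin (gtop V) F\<^sub>1" "G_invariant G V F\<^sub>0" "G_invariant G V F\<^sub>1"
  using assms unfolding cellular_def by (blast dest: cell_filtrationD)+

lemma cellular_refl:
  assumes "closedin (gtop V) F" "G_invariant G V F"
  shows "cellular V F F"
  unfolding cellular_def cell_filtration_def
  by (rule exI[of _ "{F}"]) (use assms in \<open>auto simp: subset_singleton_iff\<close>)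

lemma closed_cell_map:
  assumes "H \<in> \<C>" "G_map G (orbit_times G H (disc n)) V h"
  shows "closed_map (gtop (orbit_times G H (disc n))) (gtop V) h"
  using assms subgroups[OF assms(1)] closed_subgroups[OF assms(1)]
  by (intro weak_Hausdorff_closed_map compact_Hausdorff_orbit_times) (auto simp: G_map_def G_space_def CGWH_def)

lemma invariant_orbit_times: "H \<in> \<C> \<Longrightarrow> G_invariant G (orbit_times G H K) (points (orbit_times G H K))"
  using subgroups by (auto simp: G_invariant_def orbit_times_def coset_translate)

lemma attached_cell:
  assumes "F \<subset> F'" "h ` ((lcosets H) \<times> topspace (disc_boundary n)) \<subseteq> F"
    "bij_betw h ((lcosets H) \<times> (topspace (disc n) - topspace (disc_boundary n))) (F' - F)"
  shows "F' = F \<union> h ` points (orbit_times G H (disc n))"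
proof -
  let ?I = "(lcosets H) \<times> (topspace (disc n) - topspace (disc_boundary n))"
  have "points (orbit_times G H (disc n)) = ?I \<union> (lcosets H) \<times> topspace (disc_boundary n)"
    using disc_boundary_subset by auto
  then have "h ` points (orbit_times G H (disc n)) = (F' - F) \<union> h ` ((lcosets H) \<times> topspace (disc_boundary n))"
    using bij_betw_imp_surj_on[OF assms(3)] by (metis image_Un)
  with assms(1,2) show ?thesis
    by blast
qed

lemma cellular_attach:
  assumes F: "closedin (gtop V) F" "G_invariant G V F" and att: "attaches V F F'"
  shows "cellular V F F'"
proof -
  obtain n H h where h: "F \<subset> F'" "H \<in> \<C>" "G_map G (orbit_times G H (disc n)) V h"
      "h ` ((lcosets H) \<times> topspace (disc_boundary n)) \<subseteq> F"
      "bij_betw h ((lcosets H) \<times> (topspace (disc n) - topspace (disc_boundary n))) (F' - F)"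
    using att unfolding attaches_def by blast
  note F' = attached_cell[OF h(1,4,5)]
  have "closedin (gtop V) (h ` points (orbit_times G H (disc n)))"
    using closed_cell_map[OF h(2,3)] unfolding closed_map_def by blast
  then have cl: "closedin (gtop V) F'"
    unfolding F' using F(1) by blast
  have "G_invariant G V (h ` points (orbit_times G H (disc n)))"
    by (rule G_map_invariant_image[OF h(3) invariant_orbit_times[OF h(2)]]) simp
  then have inv: "G_invariant G V F'"
    unfolding F' using F(2) by (auto simp: G_invariant_def)
  have pred: "{E \<in> {F, F'}. E \<subset> F'} = {F}"
    using h(1) by auto
  have "\<Inter>\<S> \<in> \<S>" if "\<S> \<subseteq> {F, F'}" "\<S> \<noteq> {}" for \<S>
  proof -
    have "\<S> = {F} \<or> \<S> = {F'} \<or> \<S> = {F, F'}"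
      using that by blast
    then show ?thesis
      using h(1) by (auto simp: Int_absorb2)
  qed
  then have "cell_filtration V F F' {F, F'}"
    unfolding cell_filtration_def using F cl inv att h(1) pred by auto
  then show ?thesis
    unfolding cellular_def by blast
qed

lemma coherentD:
  assumes "coherent V P F"
  shows "\<Union>P = F"
    and "\<And>T. T \<subseteq> F \<Longrightarrow> (\<And>E. E \<in> P \<Longrightarrow> closedin (gtop V) (T \<inter> E)) \<Longrightarrow> closedin (gtop V) T"
proof -
  show "\<Union>P = F"
    using assms by (simp add: coherent_def)
  fix T assume "T \<subseteq> F" "\<And>E. E \<in> P \<Longrightarrow> closedin (gtop V) (T \<inter> E)"
  then show "closedin (gtop V) T"
    using assms by (simp add: coherent_def)
qed

lemma coherent_closed_invariant:
  assumes "coherent V P F" "\<And>E. E \<in> P \<Longrightarrow> closedin (gtop V) E \<and> G_invariant G V E"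
  shows "closedin (gtop V) F" "G_invariant G V F"
proof -
  have "F \<inter> E = E" if "E \<in> P" for E
    using coherentD(1)[OF assms(1)] that by blast
  then show "closedin (gtop V) F"
    using assms(2) by (intro coherentD(2)[OF assms(1), of F]) simp_all
  show "G_invariant G V F"
    unfolding G_invariant_def coherentD(1)[OF assms(1), symmetric]
    using assms(2) by (auto simp: G_invariant_def)
qed

lemma coherent_mono:
  assumes "coherent V P F" "P \<subseteq> Q" "\<Union>Q \<subseteq> F"
  shows "coherent V Q F"
  unfolding coherent_def
proof (intro conjI allI impI)
  show "\<Union>Q = F"
    using assms coherentD(1)[OF assms(1)] by blast
  fix T assume "T \<subseteq> F" "\<forall>E\<in>Q. closedin (gtop V) (T \<inter> E)"
  then show "closedin (gtop V) T"
    using assms(2) by (intro coherentD(2)[OF assms(1), of T]) auto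
qed

lemma coherent_top: "F \<in> P \<Longrightarrow> \<Union>P \<subseteq> F \<Longrightarrow> coherent V P F"
  unfolding coherent_def by (auto simp: Int_absorb2)

text \<open>
  Transfinite composition. Insert a filtration \<open>K a\<close> from \<open>F b\<close> to \<open>F a\<close> at each successor step and take
  the union of all of them. A nonempty subfamily meets some \<open>K a\<close> with \<open>a\<close> least, and its members in \<open>K a\<close> have a
  least element, which lies below all members in later \<open>K b\<close>. Repetitions in \<open>F\<close> do no harm:
  a set is always treated at the least index at which it occurs.
\<close>
lemma cellular_transfinite:
  fixes r :: "'i rel" and F :: "'i \<Rightarrow> 'a set"
  assumes wo: "Well_order r" and z: "z \<in> Field r" "\<And>a. a \<in> Field r \<Longrightarrow> (z, a) \<in> r"
    and Fz: "closedin (gtop V) (F z)" "G_invariant G V (F z)"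
    and mono: "\<And>a b. (a, b) \<in> r \<Longrightarrow> F a \<subseteq> F b"
    and step: "\<And>a. a \<in> Field r \<Longrightarrow> a \<noteq> z \<Longrightarrow>
          (\<exists>b\<in>underS r a. cellular V (F b) (F a) \<and> (\<forall>c\<in>underS r a. F c \<subseteq> F b)) \<or>
          coherent V (F ` underS r a) (F a)"
    and total: "coherent V (F ` Field r) T"
  shows "cellular V (F z) T"
proof -
  have FS: "a \<in> Field r \<and> b \<in> Field r \<and> (a, b) \<in> r" if "a \<in> underS r b" for a b
    using that by (auto simp: underS_def Field_def)
  have underS_z: "underS r z = {}"
    using Well_order_underS_asym[OF wo] z(2) FS by blast
  have ci: "closedin (gtop V) (F a) \<and> G_invariant G V (F a)" if "a \<in> Field r" for a
  proof (rule ccontr)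
    let ?S = "{a \<in> Field r. \<not> (closedin (gtop V) (F a) \<and> G_invariant G V (F a))}"
    assume "\<not> (closedin (gtop V) (F a) \<and> G_invariant G V (F a))"
    with that have "?S \<subseteq> Field r" "?S \<noteq> {}"
      by auto
    from Well_order_least[OF wo this]
    obtain m where m: "m \<in> ?S" "\<And>b. b \<in> ?S \<Longrightarrow> (m, b) \<in> r"
      by blast
    have below: "closedin (gtop V) (F b) \<and> G_invariant G V (F b)" if b: "b \<in> underS r m" for b
    proof (rule ccontr)
      assume "\<not> ?thesis"
      then have "(m, b) \<in> r"
        using m(2) FS[OF b] by simp
      then show False
        by (rule Well_order_underS_asym[OF wo b])
    qed
    have "m \<noteq> z"
      using m(1) Fz by auto
    then consider b where "b \<in> underS r m" "cellular V (F b) (F m)" | "coherent V (F ` underS r m) (F m)"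
      using step[of m] m(1) by blast
    then show False
    proof cases
      case 1
      then show ?thesis
        using m(1) cellularD[OF 1(2)] by simp
    next
      case 2
      then have "closedin (gtop V) (F m)" "G_invariant G V (F m)"
        using below coherent_closed_invariant[OF 2] by blast+
      then show ?thesis
        using m(1) by simp
    qed
  qed
  \<comment> \<open>what the filtration inserted at index \<open>a\<close> has to satisfy; it reduces to \<open>{F a}\<close> at the first and at limit indices\<close>
  define Q where "Q = (\<lambda>a \<K>. F a \<in> \<K> \<and>
      (\<forall>E\<in>\<K>. \<Union>(F ` underS r a) \<subseteq> E \<and> E \<subseteq> F a \<and> closedin (gtop V) E \<and> G_invariant G V E) \<and>
      (\<forall>\<S>\<subseteq>\<K>. \<S> \<noteq> {} \<longrightarrow> \<Inter>\<S> \<in> \<S>) \<and>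
      (\<forall>E\<in>\<K>. a = z \<and> E = F z \<or> E \<in> F ` underS r a \<or>
         E = F a \<and> coherent V (F ` underS r a) E \<or>
         (\<Union>(F ` underS r a) \<in> F ` underS r a \<inter> \<K> \<and>
          (\<Union>{D \<in> \<K>. D \<subset> E} \<in> \<K> \<and> attaches V (\<Union>{D \<in> \<K>. D \<subset> E}) E \<or> coherent V {D \<in> \<K>. D \<subset> E} E))))"
  have "\<exists>\<K>. Q a \<K>" if a: "a \<in> Field r" for a
  proof -
    consider "a = z" | "a \<noteq> z" "coherent V (F ` underS r a) (F a)" |
      b where "a \<noteq> z" "b \<in> underS r a" "cellular V (F b) (F a)" "\<forall>c\<in>underS r a. F c \<subseteq> F b"
      using step[OF a] by blast
    then show ?thesis
    proof cases
      case 1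
      then show ?thesis
        unfolding Q_def using underS_z Fz by (intro exI[of _ "{F a}"]) (auto simp: subset_singleton_iff)
    next
      case 2
      then show ?thesis
        unfolding Q_def using 2 ci[OF a] coherentD(1)[OF 2(2)] by (intro exI[of _ "{F a}"]) (auto simp: subset_singleton_iff)
    next
      case 3
      then obtain \<K> where K: "cell_filtration V (F b) (F a) \<K>"
        unfolding cellular_def by blast
      note D = cell_filtrationD[OF K]
      have U: "\<Union>(F ` underS r a) = F b"
        using 3(2,4) by blast
      have 4: "E = F b \<or>
          (\<Union>{D \<in> \<K>. D \<subset> E} \<in> \<K> \<and> attaches V (\<Union>{D \<in> \<K>. D \<subset> E}) E \<or> coherent V {D \<in> \<K>. D \<subset> E} E)"
        if "E \<in> \<K>" for E
        using D(8)[OF that] by blast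
      have "Q a \<K>"
        unfolding Q_def U
      proof (intro conjI ballI allI impI)
        show "F a \<in> \<K>"
          by (rule D(2))
        show "\<Inter>\<S> \<in> \<S>" if "\<S> \<subseteq> \<K>" "\<S> \<noteq> {}" for \<S>
          using that by (rule D(7))
        have "F b \<in> F ` underS r a \<inter> \<K>"
          using 3(2) D(1) by blast
        then show "a = z \<and> E = F z \<or> E \<in> F ` underS r a \<or> E = F a \<and> coherent V (F ` underS r a) E \<or>
           (F b \<in> F ` underS r a \<inter> \<K> \<and>
            (\<Union>{D \<in> \<K>. D \<subset> E} \<in> \<K> \<and> attaches V (\<Union>{D \<in> \<K>. D \<subset> E}) E \<or> coherent V {D \<in> \<K>. D \<subset> E} E))"
          if "E \<in> \<K>" for E
          using 4[OF that] by (elim disjE) simp_all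
        show "F b \<subseteq> E" "E \<subseteq> F a" "closedin (gtop V) E" "G_invariant G V E" if "E \<in> \<K>" for E
          using D(3-6)[OF that] by simp_all
      qed
      then show ?thesis
        by (rule exI)
    qed
  qed
  then have "\<exists>K. \<forall>a\<in>Field r. Q a (K a)"
    by (intro bchoice) simp
  then obtain K where K: "\<And>a. a \<in> Field r \<Longrightarrow> Q a (K a)"
    by auto
  have K1: "F a \<in> K a" if "a \<in> Field r" for a
    using K[OF that] by (simp add: Q_def)
  have K2: "\<Union>(F ` underS r a) \<subseteq> E" "E \<subseteq> F a" "closedin (gtop V) E" "G_invariant G V E"
    if "a \<in> Field r" "E \<in> K a" for a E
    using K[OF that(1)] that(2) by (simp_all add: Q_def)
  have K3: "\<Inter>\<S> \<in> \<S>" if "a \<in> Field r" "\<S> \<subseteq> K a" "\<S> \<noteq> {}" for a \<S>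
    using K[OF that(1)] that(2,3) by (simp add: Q_def)
  have K4: "a = z \<and> E = F z \<or> E \<in> F ` underS r a \<or>
         E = F a \<and> coherent V (F ` underS r a) E \<or>
         (\<Union>(F ` underS r a) \<in> F ` underS r a \<inter> K a \<and> 
          (\<Union>{D \<in> K a. D \<subset> E} \<in> K a \<and> attaches V (\<Union>{D \<in> K a. D \<subset> E}) E \<or> coherent V {D \<in> K a. D \<subset> E} E))"
    if "a \<in> Field r" "E \<in> K a" for a E
    using K[OF that(1)] that(2) unfolding Q_def by simp
  have T: "F a \<subseteq> T" if "a \<in> Field r" for a
    using coherentD(1)[OF total] that by blast
  have ciT: "closedin (gtop V) T" "G_invariant G V T"
    using coherent_closed_invariant[OF total] ci by blast+
  have later: "F a \<subseteq> E" if "a \<in> underS r b" "E \<in> K b" for a b E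
    using K2(1)[of b E] FS[OF that(1)] that by blast
  define \<H> where "\<H> = insert T (\<Union>a\<in>Field r. K a)"
  have inter: "\<Inter>\<S> \<in> \<S>" if S: "\<S> \<subseteq> \<H>" "\<S> \<noteq> {}" for \<S>
  proof (cases "\<S> = {T}")
    case False
    let ?A = "{a \<in> Field r. K a \<inter> \<S> \<noteq> {}}"
    have "?A \<subseteq> Field r" "?A \<noteq> {}"
      using S False unfolding \<H>_def by blast+
    from Well_order_least[OF wo this]
    obtain a where a: "a \<in> ?A" "\<And>b. b \<in> ?A \<Longrightarrow> (a, b) \<in> r"
      by blast
    define M where "M = \<Inter>(K a \<inter> \<S>)"
    have M: "M \<in> K a \<inter> \<S>"
      unfolding M_def using a(1) by (intro K3) auto
    have "M \<subseteq> E" if E: "E \<in> \<S>" for E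
    proof -
      have MF: "M \<subseteq> F a"
        using K2(2) a(1) M by blast
      consider "E = T" | b where "b \<in> Field r" "E \<in> K b"
        using S(1) E unfolding \<H>_def by blast
      then show ?thesis
      proof cases
        case 1
        then show ?thesis
          using MF T[of a] a(1) by blast
      next
        case 2
        then have "(a, b) \<in> r"
          using a(2) E by blast
        then have "a = b \<or> a \<in> underS r b"
          by (auto simp: underS_def)
        then show ?thesis
          using 2 E MF later[of a b E] unfolding M_def by blast
      qed
    qed
    then have "\<Inter>\<S> = M"
      using M by blast
    then show ?thesis
      using M by blast
  qed auto
  have Fz_in: "F z \<in> \<H>"
    unfolding \<H>_def using K1 z by blast
  have bounds: "F z \<subseteq> E \<and> E \<subseteq> T \<and> closedin (gtop V) E \<and> G_invariant G V E" if E: "E \<in> \<H>" for E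
  proof -
    consider "E = T" | b where "b \<in> Field r" "E \<in> K b"
      using E unfolding \<H>_def by blast
    then show ?thesis
    proof cases
      case 1
      then show ?thesis
        using T[OF z(1)] ciT by blast
    next
      case 2
      have "F z \<subseteq> E"
      proof (cases "b = z")
        case True
        then show ?thesis
          using K4[OF 2] underS_z by auto
      next
        case False
        then have "z \<in> underS r b"
          using z 2 by (auto simp: underS_def)
        then show ?thesis
          using later 2 by blast
      qed
      then show ?thesis
        using K2[OF 2] T[OF 2(1)] by blast
    qed
  qed
  have "\<Union>{D \<in> \<H>. D \<subset> E} \<in> \<H> \<and> attaches V (\<Union>{D \<in> \<H>. D \<subset> E}) E \<or> coherent V {D \<in> \<H>. D \<subset> E} E"
    if E: "E \<in> \<H>" "E \<noteq> F z" for E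
  proof (cases "E \<in> (\<Union>a\<in>Field r. K a)")
    case False
    then have ET: "E = T"
      using E unfolding \<H>_def by blast
    have "F a \<subset> T" if "a \<in> Field r" for a
      using T[OF that] K1[OF that] False ET that by blast
    then have "F ` Field r \<subseteq> {D \<in> \<H>. D \<subset> E}"
      using K1 ET unfolding \<H>_def by blast
    then have "coherent V {D \<in> \<H>. D \<subset> E} E"
      unfolding ET by (intro coherent_mono[OF total]) auto
    then show ?thesis ..
  next
    case True
    let ?A = "{a \<in> Field r. E \<in> K a}"
    have "?A \<subseteq> Field r" "?A \<noteq> {}"
      using True by auto
    from Well_order_least[OF wo this]
    obtain a where a: "a \<in> ?A" "\<And>b. b \<in> ?A \<Longrightarrow> (a, b) \<in> r"
      by blast
    then have aF: "a \<in> Field r" "E \<in> K a"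
      by auto
    have new: "E \<notin> K b" if "b \<in> underS r a" for b
      using a(2)[of b] FS[OF that] Well_order_underS_asym[OF wo that] by blast
    have F_below: "F b \<in> \<H> \<and> F b \<subset> E" if "b \<in> underS r a" for b
      using new[OF that] K1 FS[OF that] later[OF that aF(2)] unfolding \<H>_def by blast
    consider "E = F a" "coherent V (F ` underS r a) E" |
      "\<Union>(F ` underS r a) \<in> F ` underS r a \<inter> K a"
      "\<Union>{D \<in> K a. D \<subset> E} \<in> K a \<and> attaches V (\<Union>{D \<in> K a. D \<subset> E}) E \<or> coherent V {D \<in> K a. D \<subset> E} E"
      using K4[OF aF] E(2) new K1 FS by blast
    then show ?thesis
    proof cases
      case 1
      then have "coherent V {D \<in> \<H>. D \<subset> E} E"
        using F_below by (intro coherent_mono[OF 1(2)]) auto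
      then show ?thesis ..
    next
      case 2
      obtain b where b: "b \<in> underS r a" "\<Union>(F ` underS r a) = F b" "F b \<in> K a"
        using 2(1) by auto
      have sub: "{D \<in> K a. D \<subset> E} \<subseteq> {D \<in> \<H>. D \<subset> E}"
        using aF unfolding \<H>_def by blast
      have "D \<subseteq> \<Union>{D \<in> K a. D \<subset> E}" if D: "D \<in> \<H>" "D \<subset> E" for D
      proof -
        have "E \<subseteq> T"
          using bounds E by blast
        then obtain c where c: "c \<in> Field r" "D \<in> K c"
          using D unfolding \<H>_def by blast
        consider "c = a" | "c \<in> underS r a" | "a \<in> underS r c"
          using Well_order_total[OF wo c(1) aF(1)] by blast
        then show ?thesis
        proof cases
          case 1
          then show ?thesis
            using c D by blast
        next
          case 2
          then have "D \<subseteq> F b"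
            using K2(2)[OF c] b(2) by blast
          then show ?thesis
            using F_below[OF b(1)] b(3) by blast
        next
          case 3
          then have "E \<subseteq> D"
            using later[OF 3 c(2)] K2(2)[OF aF] by blast
          then show ?thesis
            using D by blast
        qed
      qed
      then have U: "\<Union>{D \<in> \<H>. D \<subset> E} = \<Union>{D \<in> K a. D \<subset> E}"
        using sub by blast
      have "K a \<subseteq> \<H>"
        using aF unfolding \<H>_def by blast
      moreover have "coherent V {D \<in> \<H>. D \<subset> E} E" if "coherent V {D \<in> K a. D \<subset> E} E"
        using that sub by (rule coherent_mono) auto
      ultimately show ?thesis
        using 2(2) unfolding U by blast
    qed
  qed
  then have "cell_filtration V (F z) T \<H>"
    unfolding cell_filtration_def using Fz_in inter bounds by (simp add: \<H>_def)
  then show ?thesis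
    unfolding cellular_def by blast
qed

lemma cellular_countable:
  fixes F :: "nat \<Rightarrow> 'a set"
  assumes "\<And>n. cellular V (F n) (F (Suc n))" "coherent V (range F) T"
  shows "cellular V (F 0) T"
proof (rule cellular_transfinite[where r = natLeq and F = F])
  have le: "F m \<subseteq> F n" if "m \<le> n" for m n
    using cellularD(1)[OF assms(1)] that by (rule lift_Suc_mono_le)
  show "F a \<subseteq> F b" if "(a, b) \<in> natLeq" for a b
    using that le by (simp add: natLeq_def)
  show "closedin (gtop V) (F 0)" "G_invariant G V (F 0)"
    using cellularD(2,4)[OF assms(1)] .
  show "Well_order natLeq"
    by (rule natLeq_Well_order)
  show "(\<exists>b\<in>underS natLeq a. cellular V (F b) (F a) \<and> (\<forall>c\<in>underS natLeq a. F c \<subseteq> F b)) \<or>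
          coherent V (F ` underS natLeq a) (F a)" if "a \<noteq> 0" for a
  proof -
    obtain b where b: "a = Suc b"
      using \<open>a \<noteq> 0\<close> not0_implies_Suc by blast
    then have "b \<in> underS natLeq a" "\<forall>c\<in>underS natLeq a. F c \<subseteq> F b"
      using le by (auto simp: underS_def natLeq_def)
    then show ?thesis
      using assms(1)[of b] b by blast
  qed
  show "coherent V (F ` Field natLeq) T"
    using assms(2) by (simp add: Field_natLeq)
  show "0 \<in> Field natLeq" "\<And>a. (0, a) \<in> natLeq"
    by (simp add: Field_natLeq, simp add: natLeq_def)
qed

lemma cellular_trans:
  assumes "cellular V F\<^sub>0 F\<^sub>1" "cellular V F\<^sub>1 F\<^sub>2"
  shows "cellular V F\<^sub>0 F\<^sub>2"
proof -
  let ?F = "\<lambda>n::nat. if n = 0 then F\<^sub>0 else if n = 1 then F\<^sub>1 else F\<^sub>2"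
  have "cellular V (?F n) (?F (Suc n))" for n
    using assms cellularD(3,5)[OF assms(2)] by (auto intro: cellular_refl)
  moreover have "coherent V (range ?F) F\<^sub>2"
  proof (rule coherent_top)
    have "?F 2 = F\<^sub>2"
      by simp
    then show "F\<^sub>2 \<in> range ?F"
      using rangeI[of ?F 2] by simp
    show "\<Union>(range ?F) \<subseteq> F\<^sub>2"
      using cellularD(1)[OF assms(1)] cellularD(1)[OF assms(2)] by (auto split: if_splits)
  qed
  ultimately have "cellular V (?F 0) F\<^sub>2"
    by (rule cellular_countable)
  then show ?thesis
    by simp
qed

end

lemma G_subspace_points: "G_subspace X (points X) = X"
  by (cases X) (simp add: G_subspace_def)

context cell_family begin

lemma G_space_of_closed:
  assumes "G_space G V" "closedin (gtop V) F" "G_invariant G V F"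
  shows "G_space G (G_subspace V F)"
  using assms by (intro G_space_closed_subspace) auto

lemma points_G_subspace_closed:
  "closedin (gtop V) F \<Longrightarrow> points (G_subspace V F) = F"
  using closedin_subset[of "gtop V" F] by (simp add: Int_absorb1)

lemma G_map_inclusion:
  assumes "G_space G V" "closedin (gtop V) E" "G_invariant G V E" "closedin (gtop V) F" "G_invariant G V F" "E \<subseteq> F"
  shows "G_map G (G_subspace V E) (G_subspace V F) (\<lambda>x. x)"
  using assms G_space_of_closed[OF assms(1)] unfolding G_map_def
  by (auto simp: continuous_map_in_subtopology intro: continuous_map_from_subtopology)

lemma G_map_into_subspace:
  assumes "G_map G X V h" "G_space G (G_subspace V F)" "h ` points X \<subseteq> F"
  shows "G_map G X (G_subspace V F) h"
  using assms unfolding G_map_def by (auto simp: continuous_map_in_subtopology)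

lemma G_map_sphere_inclusion:
  assumes "H \<in> \<C>"
  shows "G_map G (orbit_times G H (disc_boundary n)) (orbit_times G H (disc n)) id"
proof -
  have "continuous_map (disc_boundary n) (disc n) (\<lambda>x. x)"
    unfolding disc_top_of_set disc_boundary_top_of_set by (auto intro: continuous_map_from_subtopology)
  then have "continuous_map (prod_topology (orbit_topology G H) (disc_boundary n)) (disc n) (\<lambda>p. snd p)"
    using continuous_map_compose[OF continuous_map_snd] by (fastforce simp: o_def)
  then have "continuous_map (prod_topology (orbit_topology G H) (disc_boundary n))
      (prod_topology (orbit_topology G H) (disc n)) (\<lambda>p. (fst p, snd p))"
    by (intro continuous_map_pairedI continuous_map_fst)
  moreover have "G_space G (orbit_times G H (disc_boundary n))" "G_space G (orbit_times G H (disc n))"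
    by (intro G_space_orbit_times subgroups closed_subgroups assms disc_compact_Hausdorff)+
  ultimately show ?thesis
    unfolding G_map_def by (simp add: orbit_times_def id_def)
qed

lemma closedin_complement_subspace:
  assumes F: "closedin X F" and T: "T \<subseteq> F"
  shows "closedin X (F - T) \<longleftrightarrow> openin (subtopology X F) T"
proof -
  have FX: "topspace (subtopology X F) = F"
    using closedin_subset[OF F] by auto
  have "openin (subtopology X F) T \<longleftrightarrow> closedin (subtopology X F) (F - T)"
    using T FX by (metis openin_closedin)
  also have "\<dots> \<longleftrightarrow> closedin X (F - T)"
    using closedin_closed_subtopology[OF F, of "F - T"] by auto
  finally show ?thesis
    by simp
qed

section \<open>From filtrations to relative cell complexes\<close>

text \<open>
  That the square is a pushout of spaces rests on closed maps: if \<open>T\<close> has open preimages in \<open>F\<close> and in the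
  cell, then \<open>F' - T\<close> is the union of a closed part of \<open>F\<close> and the image of a closed part of the cell.
\<close>
lemma attaches_imp_pushout:
  assumes V: "G_space G V" and F: "closedin (gtop V) F" "G_invariant G V F" and att: "attaches V F F'"
  shows "pushout_of_generating_cofibration G \<C> (G_subspace V F) (G_subspace V F') (\<lambda>x. x)"
proof -
  obtain n H h where h: "F \<subset> F'" "H \<in> \<C>" "G_map G (orbit_times G H (disc n)) V h"
      "h ` ((lcosets H) \<times> topspace (disc_boundary n)) \<subseteq> F"
      "bij_betw h ((lcosets H) \<times> (topspace (disc n) - topspace (disc_boundary n))) (F' - F)"
    using att unfolding attaches_def by blast
  note F'_eq = attached_cell[OF h(1,4,5)]
  have F': "closedin (gtop V) F'" "G_invariant G V F'"
    using cellularD[OF cellular_attach[OF F att]] by auto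
  define A where "A = orbit_times G H (disc_boundary n)"
  define D where "D = orbit_times G H (disc n)"
  let ?X = "G_subspace V F" and ?Y = "G_subspace V F'"
  have pts: "points ?X = F" "points ?Y = F'"
    using F F' points_G_subspace_closed by auto
  have pA: "points A = (lcosets H) \<times> topspace (disc_boundary n)"
    and pD: "points D = (lcosets H) \<times> topspace (disc n)"
    by (simp_all add: A_def D_def)
  have AD: "points A \<subseteq> points D"
    unfolding pA pD using disc_boundary_subset by blast
  have spaces: "G_space G ?X" "G_space G ?Y"
    using V F F' G_space_of_closed by auto
  have AD_map: "G_map G A D id"
    unfolding A_def D_def by (rule G_map_sphere_inclusion[OF h(2)])
  have hD: "G_map G D V h"
    using h(3) by (simp add: D_def)
  have hA: "h ` points A \<subseteq> F"
    using h(4) by (simp add: pA)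
  have bij: "bij_betw h (points D - points A) (F' - F)"
  proof -
    have "points D - points A = (lcosets H) \<times> (topspace (disc n) - topspace (disc_boundary n))"
      unfolding pA pD by blast
    then show ?thesis
      using h(5) by simp
  qed
  have F'D: "F' = F \<union> h ` points D"
    using F'_eq by (simp add: D_def)
  have hDY: "G_map G D ?Y h"
    using hD F'D by (intro G_map_into_subspace spaces) auto
  have XY: "G_map G ?X ?Y (\<lambda>x. x)"
    using V F F' h(1) by (intro G_map_inclusion) auto
  have "pushout G A D ?X ?Y id h h (\<lambda>x. x)"
    unfolding pushout_def
  proof (intro conjI ballI allI impI)
    show "G_map G A D id"
      by (rule AD_map)
    show "G_map G A ?X h"
      using G_map_compose[OF AD_map hD] hA by (intro G_map_into_subspace spaces) simp_all
    show "G_map G D ?Y h" "G_map G ?X ?Y (\<lambda>x. x)"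
      by (rule hDY, rule XY)
    show "case_sum (\<lambda>x. x) h ` (points ?X <+> points D) = points ?Y"
    proof -
      have "case_sum (\<lambda>x. x) h ` (F <+> points D) = F \<union> h ` points D"
        by (auto simp: Plus_def image_Un image_image)
      then show ?thesis
        unfolding pts using F'D by metis
    qed
  next
    let ?k = "case_sum (\<lambda>x. x) h"
    let ?\<rho> = "case_sum Inl (\<lambda>b. if b \<in> points A then Inl (h b) else Inr b)"
    let ?N = "Inl ` F \<union> Inr ` (points D - points A)"
    fix p q assume pq: "p \<in> points ?X <+> points D" "q \<in> points ?X <+> points D"
    have k\<rho>: "?k (?\<rho> p) = ?k p" for p
      by (cases p) auto
    have N: "?\<rho> p \<in> ?N" if "p \<in> points ?X <+> points D" for p
      using that hA unfolding pts by (cases p) auto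
    have hint: "h b \<in> F' - F" if "b \<in> points D - points A" for b
      using bij_betwE[OF bij] that by blast
    have "inj_on ?k ?N"
    proof (rule inj_onI)
      fix x y assume xy: "x \<in> ?N" "y \<in> ?N" "?k x = ?k y"
      show "x = y"
        using xy hint bij_betw_imp_inj_on[OF bij] by (auto dest: inj_onD) 
    qed
    then have "?k p = ?k q \<longleftrightarrow> ?\<rho> p = ?\<rho> q"
      using N[OF pq(1)] N[OF pq(2)] k\<rho> by (metis (no_types, lifting) inj_onD)
    then show "?k p = ?k q \<longleftrightarrow> (p, q) \<in> glue A id h"
      unfolding glue_id_iff .
  next
    fix T assume "T \<subseteq> points ?Y"
    then have TF': "T \<subseteq> F'"
      by (simp add: pts)
    have cont: "continuous_map (gtop D) (gtop ?Y) h" "continuous_map (gtop ?X) (gtop ?Y) (\<lambda>x. x)"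
      using hDY XY by (simp_all add: G_map_def)
    show "openin (gtop ?Y) T \<longleftrightarrow> openin (gtop ?X) {x \<in> points ?X. x \<in> T} \<and> openin (gtop D) {b \<in> points D. h b \<in> T}"
    proof
      assume "openin (gtop ?Y) T"
      then show "openin (gtop ?X) {x \<in> points ?X. x \<in> T} \<and> openin (gtop D) {b \<in> points D. h b \<in> T}"
        using openin_continuous_map_preimage[OF cont(1)] openin_continuous_map_preimage[OF cont(2)] by blast
    next
      assume *: "openin (gtop ?X) {x \<in> points ?X. x \<in> T} \<and> openin (gtop D) {b \<in> points D. h b \<in> T}"
      have "{x \<in> points ?X. x \<in> T} = F \<inter> T"
        unfolding pts by auto
      then have "openin (subtopology (gtop V) F) (F \<inter> T)"
        using * by simp
      then have c1: "closedin (gtop V) (F - (F \<inter> T))"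
        using closedin_complement_subspace[OF F(1)] by simp
      have "closedin (gtop D) (points D - {b \<in> points D. h b \<in> T})"
        using * by blast
      then have c2: "closedin (gtop V) (h ` (points D - {b \<in> points D. h b \<in> T}))"
        using closed_cell_map[OF h(2,3)] by (simp add: D_def closed_map_def)
      have "F' - T = (F - (F \<inter> T)) \<union> h ` (points D - {b \<in> points D. h b \<in> T})"
        unfolding F'D by auto
      then have "closedin (gtop V) (F' - T)"
        using closedin_Un[OF c1 c2] by simp
      then show "openin (gtop ?Y) T"
        using closedin_complement_subspace[OF F'(1) TF'] by simp
    qed
  qed
  then show ?thesis
    unfolding pushout_of_generating_cofibration_def A_def D_def using h(2) by blast
qed

lemma coherent_imp_directed_colimit:
  fixes V :: "('g, 'a) gspace" and S :: "'i \<Rightarrow> 'a set"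
  assumes V: "G_space G V" and S: "\<And>a. a \<in> I \<Longrightarrow> closedin (gtop V) (S a) \<and> G_invariant G V (S a)"
    and dir: "\<And>a b. a \<in> I \<Longrightarrow> b \<in> I \<Longrightarrow> \<exists>c\<in>I. (a, c) \<in> r \<and> (b, c) \<in> r"
    and coh: "coherent V (S ` I) F"
  shows "directed_colimit G r I (\<lambda>a. G_subspace V (S a)) (\<lambda>a b x. x) (G_subspace V F) (\<lambda>a x. x)"
proof -
  have F: "closedin (gtop V) F" "G_invariant G V F"
    using S by (auto intro!: coherent_closed_invariant[OF coh])
  have U: "\<Union>(S ` I) = F"
    by (rule coherentD(1)[OF coh])
  have pts: "points (G_subspace V F) = F" "\<And>a. a \<in> I \<Longrightarrow> points (G_subspace V (S a)) = S a"
    using S F points_G_subspace_closed by auto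
  have incl: "G_map G (G_subspace V (S a)) (G_subspace V F) (\<lambda>x. x)" if "a \<in> I" for a
    using V S[OF that] F U that by (intro G_map_inclusion) auto
  show ?thesis
    unfolding directed_colimit_def
  proof (intro conjI ballI allI impI)
    show "G_map G (G_subspace V (S a)) (G_subspace V F) (\<lambda>x. x)" if "a \<in> I" for a
      by (rule incl[OF that])
    show "(\<Union>a\<in>I. (\<lambda>x. x) ` points (G_subspace V (S a))) = points (G_subspace V F)"
      using pts U by auto
    show "\<exists>c\<in>I. (a, c) \<in> r \<and> (b, c) \<in> r \<and> x = y" if "a \<in> I" "b \<in> I" "x = y" for a b x y
      using dir[OF that(1,2)] that(3) by blast
    fix T assume "T \<subseteq> points (G_subspace V F)"
    then have TF: "T \<subseteq> F"
      by (simp add: pts)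
    show "openin (gtop (G_subspace V F)) T \<longleftrightarrow>
        (\<forall>a\<in>I. openin (gtop (G_subspace V (S a))) {x \<in> points (G_subspace V (S a)). x \<in> T})"
    proof (intro iffI ballI)
      fix a assume "openin (gtop (G_subspace V F)) T" "a \<in> I"
      moreover have "continuous_map (gtop (G_subspace V (S a))) (gtop (G_subspace V F)) (\<lambda>x. x)"
        using incl[OF \<open>a \<in> I\<close>] by (simp only: G_map_def)
      ultimately show "openin (gtop (G_subspace V (S a))) {x \<in> points (G_subspace V (S a)). x \<in> T}"
        using openin_continuous_map_preimage by blast
    next
      assume *: "\<forall>a\<in>I. openin (gtop (G_subspace V (S a))) {x \<in> points (G_subspace V (S a)). x \<in> T}"
      have "closedin (gtop V) ((F - T) \<inter> S a)" if a: "a \<in> I" for a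
      proof -
        have "{x \<in> points (G_subspace V (S a)). x \<in> T} = S a \<inter> T"
          unfolding pts(2)[OF a] by auto
        then have "openin (subtopology (gtop V) (S a)) (S a \<inter> T)"
          using bspec[OF * a] by simp
        then have "closedin (gtop V) (S a - (S a \<inter> T))"
          using closedin_complement_subspace[of "gtop V" "S a" "S a \<inter> T"] S[OF a] by simp
        moreover have "S a - (S a \<inter> T) = (F - T) \<inter> S a"
          using U a by auto
        ultimately show ?thesis
          by simp
      qed
      then have "closedin (gtop V) (F - T)"
        by (intro coherentD(2)[OF coh, of "F - T"]) auto
      then show "openin (gtop (G_subspace V F)) T"
        using closedin_complement_subspace[OF F(1) TF] by simp
    qed
  qed auto
qed

text \<open>
  A stage other than the last is named by a point of the next stage outside it. Larger stages
  contain the points that name smaller ones, so names do not clash. The natural number only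
  keeps the last stage, which has no successor, apart from the others.
\<close>
lemma filtration_indexing:
  fixes V :: "('g, 'u) gspace"
  assumes filt: "cell_filtration V F\<^sub>0 F\<^sub>1 \<F>"
  obtains \<iota> :: "'u set \<Rightarrow> 'u \<times> nat" where "inj_on \<iota> \<F>"
proof
  note D = cell_filtrationD[OF filt]
  \<comment> \<open>the immediate successor of \<open>F\<close>\<close>
  define nxt where "nxt = (\<lambda>F. \<Inter>{E \<in> \<F>. F \<subset> E})"
  define \<iota> where "\<iota> = (\<lambda>F. if F = F\<^sub>1 then (undefined, 1) else (SOME x. x \<in> nxt F - F, 0::nat))"
  have nx: "fst (\<iota> F) \<in> nxt F - F" if "F \<in> \<F>" "F \<noteq> F\<^sub>1" for F
  proof -
    have "F\<^sub>1 \<in> {E \<in> \<F>. F \<subset> E}"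
      using that D(2,4) by auto
    then have "nxt F \<in> {E \<in> \<F>. F \<subset> E}"
      unfolding nxt_def by (intro D(7)) auto
    then have "\<exists>x. x \<in> nxt F - F"
      by auto
    then show ?thesis
      unfolding \<iota>_def using that(2) someI_ex[of "\<lambda>x. x \<in> nxt F - F"] by simp
  qed
  have less: "\<iota> E \<noteq> \<iota> F" if "E \<in> \<F>" "F \<in> \<F>" "E \<subset> F" for E F
  proof (cases "F = F\<^sub>1")
    case True
    then show ?thesis
      using that by (auto simp: \<iota>_def)
  next
    case False
    have "E \<noteq> F\<^sub>1"
      using that D(4)[of F] by auto
    have "nxt E \<subseteq> F"
      using that unfolding nxt_def by blast
    then show ?thesis
      using nx[OF that(1) \<open>E \<noteq> F\<^sub>1\<close>] nx[OF that(2) False] by (metis DiffD1 DiffD2 subsetD)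
  qed
  show "inj_on \<iota> \<F>"
  proof (rule inj_onI, rule ccontr)
    fix E F assume *: "E \<in> \<F>" "F \<in> \<F>" "\<iota> E = \<iota> F" "E \<noteq> F"
    then consider "E \<subset> F" | "F \<subset> E"
      using cell_filtration_linear[OF filt, of E F] by blast
    then show False
      using less *(1-3) by cases metis+
  qed
qed

lemma cell_filtration_imp_relative_cell_complex:
  fixes V :: "('g, 'u) gspace"
  assumes V: "G_space G V" and filt: "cell_filtration V F\<^sub>0 (points V) \<F>"
  shows "relative_cell_complex G \<C> (G_subspace V F\<^sub>0) V (\<lambda>x. x)"
proof -
  note D = cell_filtrationD[OF filt]
  obtain \<iota> :: "'u set \<Rightarrow> 'u \<times> nat" where \<iota>: "inj_on \<iota> \<F>"
    using filtration_indexing[OF filt] .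
  define I where "I = \<iota> ` \<F>"
  define S where "S = inv_into \<F> \<iota>"
  have S\<iota>: "S (\<iota> F) = F" if "F \<in> \<F>" for F
    using that \<iota> by (simp add: S_def)
  have S: "S a \<in> \<F>" if "a \<in> I" for a
    using that S\<iota> by (auto simp: I_def)
  have S_inj: "S a = S b \<longleftrightarrow> a = b" if "a \<in> I" "b \<in> I" for a b
    using that S\<iota> by (auto simp: I_def)
  have SI: "S ` I = \<F>"
    using S\<iota> by (force simp: I_def)
  define r where "r = {(a, b). a \<in> I \<and> b \<in> I \<and> S a \<subseteq> S b}"
  have Fr: "Field r = I"
    by (auto simp: Field_def r_def)
  have lin: "S a \<subseteq> S b \<or> S b \<subseteq> S a" if "a \<in> I" "b \<in> I" for a b
    using cell_filtration_linear[OF filt] S that by blast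
  have linear: "Linear_order r"
    unfolding linear_order_on_def partial_order_on_def preorder_on_def Fr
    using lin S_inj by (auto simp: r_def refl_on_def trans_def antisym_def total_on_def)
  have "\<exists>a\<in>A. \<forall>b\<in>A. (a, b) \<in> r" if A: "A \<subseteq> I" "A \<noteq> {}" for A
  proof -
    have "\<Inter>(S ` A) \<in> S ` A"
      using A S by (intro D(7)) auto
    then obtain a where "a \<in> A" "\<Inter>(S ` A) = S a"
      by auto
    then show ?thesis
      using A unfolding r_def by blast
  qed
  then have wo: "Well_order r"
    using Linear_order_Well_order_iff[OF linear] by (simp add: Fr)
  have under: "underS r b = {a \<in> I. S a \<subset> S b}" if "b \<in> I" for b
  proof (rule Set.set_eqI)
    show "a \<in> underS r b \<longleftrightarrow> a \<in> {a \<in> I. S a \<subset> S b}" for a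
      using S_inj[of a b] that by (auto simp: underS_def r_def)
  qed
  have under_image: "S ` underS r b = {E \<in> \<F>. E \<subset> S b}" if "b \<in> I" for b
    unfolding under[OF that] using SI by blast
  have ci: "closedin (gtop V) (S a)" "G_invariant G V (S a)" if "a \<in> I" for a
    using D(5,6) S[OF that] by auto
  have dir: "\<exists>c\<in>J. (a, c) \<in> r \<and> (b, c) \<in> r" if "a \<in> J" "b \<in> J" "J \<subseteq> I" for a b J
    using lin[of a b] that unfolding r_def by blast
  have incl: "G_map G (G_subspace V (S a)) (G_subspace V (S b)) (\<lambda>x. x)" if "(a, b) \<in> r" for a b
    using V ci that by (intro G_map_inclusion) (auto simp: r_def)
  have "cell_sequence G \<C> r (\<lambda>a. G_subspace V (S a)) (\<lambda>a b x. x)"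
    unfolding cell_sequence_def
  proof (intro conjI allI impI ballI)
    fix a b assume ab: "immediate_succ r a b"
    then have I: "a \<in> I" "b \<in> I" and pred: "underS r b = under r a"
      by (auto simp: immediate_succ_def Fr)
    have "under r a = {c \<in> I. S c \<subseteq> S a}"
      using I by (auto simp: under_def r_def)
    then have "S ` under r a = {E \<in> \<F>. E \<subseteq> S a}"
      unfolding SI[symmetric] by blast
    then have U: "{E \<in> \<F>. E \<subset> S b} = {E \<in> \<F>. E \<subseteq> S a}"
      using under_image[OF I(2)] pred by simp
    have "S a \<in> {E \<in> \<F>. E \<subset> S b}"
      unfolding U using S[OF I(1)] by simp
    then have "S a \<subset> S b"
      by simp
    then have "S b \<noteq> F\<^sub>0"
      using D(3)[OF S[OF I(1)]] by auto
    have Ua: "\<Union>{E \<in> \<F>. E \<subset> S b} = S a"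
      unfolding U using S[OF I(1)] by auto
    have "\<not> coherent V {E \<in> \<F>. E \<subset> S b} (S b)"
      using coherentD(1)[of V "{E \<in> \<F>. E \<subset> S b}" "S b"] Ua \<open>S a \<subset> S b\<close> by auto
    then have "attaches V (S a) (S b)"
      using D(8)[OF S[OF I(2)] \<open>S b \<noteq> F\<^sub>0\<close>] unfolding Ua by simp
    then show "pushout_of_generating_cofibration G \<C> (G_subspace V (S a)) (G_subspace V (S b)) (\<lambda>x. x)"
      using V ci[OF I(1)] by (intro attaches_imp_pushout)
  next
    fix b assume b: "limit_index r b"
    then have I: "b \<in> I" and ne: "underS r b \<noteq> {}" and nosucc: "\<And>a. \<not> immediate_succ r a b"
      by (auto simp: limit_index_def Fr)
    obtain c where c: "c \<in> I" "S c \<subset> S b"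
      using ne under[OF I] by auto
    then have "S b \<noteq> F\<^sub>0"
      using D(3)[OF S[OF c(1)]] by blast
    have "\<Union>{E \<in> \<F>. E \<subset> S b} \<notin> \<F> \<or> \<not> attaches V (\<Union>{E \<in> \<F>. E \<subset> S b}) (S b)"
    proof (rule ccontr)
      assume "\<not> ?thesis"
      then have in\<F>: "\<Union>{E \<in> \<F>. E \<subset> S b} \<in> \<F>" and sub: "\<Union>{E \<in> \<F>. E \<subset> S b} \<subset> S b"
        by (auto simp: attaches_def)
      then have "\<Union>{E \<in> \<F>. E \<subset> S b} \<in> S ` I"
        by (simp add: SI)
      then obtain a where a: "a \<in> I" "S a = \<Union>{E \<in> \<F>. E \<subset> S b}"
        by (metis (lifting) imageE)
      have "underS r b = under r a"
      proof
        show "underS r b \<subseteq> under r a"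
          using S a unfolding under[OF I] by (auto simp: under_def r_def)
        show "under r a \<subseteq> underS r b"
          using a sub unfolding under[OF I] by (auto simp: under_def r_def)
      qed
      then show False
        using nosucc[of a] a(1) I by (simp add: immediate_succ_def Fr)
    qed
    then have "coherent V (S ` underS r b) (S b)"
      using D(8)[OF S[OF I] \<open>S b \<noteq> F\<^sub>0\<close>] unfolding under_image[OF I] by (elim disjE conjE) simp_all
    moreover have "underS r b \<subseteq> I"
      using under[OF I] by auto
    ultimately show "directed_colimit G r (underS r b) (\<lambda>a. G_subspace V (S a)) (\<lambda>a b x. x)
        (G_subspace V (S b)) (\<lambda>a x. x)"
      using V ci dir[of _ "underS r b"] by (intro coherent_imp_directed_colimit) auto
  qed (use wo incl in auto)
  moreover have "directed_colimit G r (Field r) (\<lambda>a. G_subspace V (S a)) (\<lambda>a b x. x) V (\<lambda>a x. x)"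
  proof -
    have "coherent V (S ` I) (points V)"
      unfolding SI using D(2,4) by (intro coherent_top) auto
    then have "directed_colimit G r I (\<lambda>a. G_subspace V (S a)) (\<lambda>a b x. x) (G_subspace V (points V)) (\<lambda>a x. x)"
      using V ci dir by (intro coherent_imp_directed_colimit) auto
    then show ?thesis
      by (simp add: Fr G_subspace_points)
  qed
  moreover have "\<iota> F\<^sub>0 \<in> Field r" "\<forall>a\<in>Field r. (\<iota> F\<^sub>0, a) \<in> r" "G_subspace V F\<^sub>0 = G_subspace V (S (\<iota> F\<^sub>0))"
    using D(1,3) S S\<iota>[OF D(1)] unfolding Fr by (auto simp: r_def I_def)
  ultimately show ?thesis
    unfolding relative_cell_complex_def
    by (intro exI[of _ r] exI[of _ "\<lambda>a. G_subspace V (S a)"] exI[of _ "\<lambda>a b x. x"] exI[of _ "\<lambda>a x. x"]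
        exI[of _ "\<iota> F\<^sub>0"]) simp
qed

end

section \<open>Radial identification of the disc with the cube\<close>
definition cube_boundary :: "nat \<Rightarrow> (nat \<Rightarrow> real) set" where
  "cube_boundary n = {x \<in> cube n. \<exists>i<n. \<bar>x i\<bar> = 1}"

primrec max_norm :: "nat \<Rightarrow> (nat \<Rightarrow> real) \<Rightarrow> real" where
  "max_norm 0 x = 0"
| "max_norm (Suc n) x = max (max_norm n x) \<bar>x n\<bar>"

lemma max_norm_nonneg: "0 \<le> max_norm n x"
  by (induction n) auto

lemma max_norm_upper: "i < n \<Longrightarrow> \<bar>x i\<bar> \<le> max_norm n x"
  by (induction n) (auto simp: less_Suc_eq)

lemma max_norm_le_iff: "0 \<le> c \<Longrightarrow> max_norm n x \<le> c \<longleftrightarrow> (\<forall>i<n. \<bar>x i\<bar> \<le> c)"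
  by (induction n) (auto simp: less_Suc_eq)

lemma max_norm_attained: "max_norm n x \<noteq> 0 \<Longrightarrow> \<exists>i<n. \<bar>x i\<bar> = max_norm n x"
proof (induction n)
  case (Suc n)
  show ?case
  proof (cases "max_norm n x \<le> \<bar>x n\<bar>")
    case True
    then show ?thesis
      by (intro exI[of _ n]) simp
  next
    case False
    then have "max_norm (Suc n) x = max_norm n x"
      by simp
    then show ?thesis
      using Suc by (metis less_SucI)
  qed
qed simp

lemma max_norm_scale: "0 \<le> c \<Longrightarrow> max_norm n (\<lambda>i. c * x i) = c * max_norm n x"
  by (induction n) (auto simp: abs_mult max_mult_distrib_left)

lemma continuous_max_norm: "continuous_on A (max_norm n)"
proof (induction n)
  case (Suc n)
  have "continuous_on A (\<lambda>x. max (max_norm n x) \<bar>x n\<bar>)"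
    by (intro continuous_on_max continuous_on_rabs continuous_coordinate Suc)
  then show ?case
    by simp
qed simp

definition two_norm :: "nat \<Rightarrow> (nat \<Rightarrow> real) \<Rightarrow> real" where
  "two_norm n x = sqrt (\<Sum>i<n. (x i)\<^sup>2)"

lemma two_norm_nonneg: "0 \<le> two_norm n x"
  by (simp add: two_norm_def sum_nonneg)

lemma two_norm_scale: "0 \<le> c \<Longrightarrow> two_norm n (\<lambda>i. c * x i) = c * two_norm n x"
  by (simp add: two_norm_def power_mult_distrib real_sqrt_mult flip: sum_distrib_left)

lemma continuous_two_norm: "continuous_on A (two_norm n)"
  unfolding two_norm_def by (intro continuous_on_real_sqrt continuous_sum_squares)

lemma norms_zero:
  "max_norm n x = 0 \<longleftrightarrow> (\<forall>i<n. x i = 0)" "two_norm n x = 0 \<longleftrightarrow> (\<forall>i<n. x i = 0)"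
proof -
  show "max_norm n x = 0 \<longleftrightarrow> (\<forall>i<n. x i = 0)"
    using max_norm_le_iff[of 0 n x] max_norm_nonneg[of n x] by auto
  show "two_norm n x = 0 \<longleftrightarrow> (\<forall>i<n. x i = 0)"
    by (auto simp: two_norm_def sum_nonneg_eq_0_iff)
qed

lemma cube_iff: "x \<in> cube n \<longleftrightarrow> (\<forall>i\<ge>n. x i = 0) \<and> max_norm n x \<le> 1"
  by (simp add: cube_def max_norm_le_iff)

lemma cube_boundary_iff: "x \<in> cube_boundary n \<longleftrightarrow> (\<forall>i\<ge>n. x i = 0) \<and> max_norm n x = 1"
proof
  assume "x \<in> cube_boundary n"
  then show "(\<forall>i\<ge>n. x i = 0) \<and> max_norm n x = 1"
    unfolding cube_boundary_def cube_iff using max_norm_upper[of _ n x] by fastforce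
next
  assume "(\<forall>i\<ge>n. x i = 0) \<and> max_norm n x = 1"
  then show "x \<in> cube_boundary n"
    unfolding cube_boundary_def cube_iff using max_norm_attained[of n x] by auto
qed

lemma disc_iff: "x \<in> topspace (disc n) \<longleftrightarrow> (\<forall>i\<ge>n. x i = 0) \<and> two_norm n x \<le> 1"
  by (simp add: topspace_disc two_norm_def)

lemma disc_boundary_iff: "x \<in> topspace (disc_boundary n) \<longleftrightarrow> (\<forall>i\<ge>n. x i = 0) \<and> two_norm n x = 1"
  by (simp add: topspace_disc_boundary two_norm_def)

text \<open>
  Rescale each ray so that the Euclidean norm becomes the maximum norm, and back. At the origin the quotient
  of norms is \<open>0/0 = 0\<close>, and the maps take the right value there.
\<close>
definition square_up :: "nat \<Rightarrow> (nat \<Rightarrow> real) \<Rightarrow> nat \<Rightarrow> real" where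
  "square_up n x = (\<lambda>i. two_norm n x / max_norm n x * x i)"

definition round_off :: "nat \<Rightarrow> (nat \<Rightarrow> real) \<Rightarrow> nat \<Rightarrow> real" where
  "round_off n x = (\<lambda>i. max_norm n x / two_norm n x * x i)"

lemma max_norm_square_up: "max_norm n (square_up n x) = two_norm n x"
proof (cases "max_norm n x = 0")
  case True
  then have "two_norm n x = 0"
    by (simp add: norms_zero)
  with True show ?thesis
    using max_norm_scale[of 0 n x] by (simp add: square_up_def)
next
  case False
  have "max_norm n (square_up n x) = two_norm n x / max_norm n x * max_norm n x"
    unfolding square_up_def using max_norm_nonneg[of n x] two_norm_nonneg[of n x]
    by (intro max_norm_scale) simp
  with False show ?thesis
    by simp
qed

lemma two_norm_round_off: "two_norm n (round_off n x) = max_norm n x"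
proof (cases "two_norm n x = 0")
  case True
  then have "max_norm n x = 0"
    by (simp add: norms_zero)
  with True show ?thesis
    using two_norm_scale[of 0 n x] by (simp add: round_off_def)
next
  case False
  have "two_norm n (round_off n x) = max_norm n x / two_norm n x * two_norm n x"
    unfolding round_off_def using max_norm_nonneg[of n x] two_norm_nonneg[of n x]
    by (intro two_norm_scale) simp
  with False show ?thesis
    by simp
qed

lemma max_norm_zero_iff_two_norm_zero: "max_norm n x = 0 \<longleftrightarrow> two_norm n x = 0"
  by (simp add: norms_zero)

lemma round_off_square_up:
  assumes "\<forall>i\<ge>n. x i = 0"
  shows "round_off n (square_up n x) = x"
proof (cases "max_norm n x = 0")
  case True
  then have "x = (\<lambda>i. 0)"
    using assms by (auto simp: norms_zero fun_eq_iff) (metis not_less)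
  then show ?thesis
    by (simp add: round_off_def square_up_def)
next
  case False
  let ?c = "two_norm n x / max_norm n x"
  have c: "?c > 0"
    using False max_norm_nonneg[of n x] two_norm_nonneg[of n x]
    by (simp add: max_norm_zero_iff_two_norm_zero less_le)
  have "two_norm n (square_up n x) = ?c * two_norm n x"
    unfolding square_up_def using c by (intro two_norm_scale) simp
  then have "round_off n (square_up n x) = (\<lambda>i. two_norm n x / (?c * two_norm n x) * (?c * x i))"
    unfolding round_off_def max_norm_square_up by (simp add: square_up_def)
  also have "\<dots> = x"
    using False c by (auto simp: max_norm_zero_iff_two_norm_zero fun_eq_iff)
  finally show ?thesis .
qed

lemma square_up_round_off:
  assumes "\<forall>i\<ge>n. x i = 0"
  shows "square_up n (round_off n x) = x"
proof (cases "max_norm n x = 0")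
  case True
  then have "x = (\<lambda>i. 0)"
    using assms by (auto simp: norms_zero fun_eq_iff) (metis not_less)
  then show ?thesis
    by (simp add: round_off_def square_up_def)
next
  case False
  let ?c = "max_norm n x / two_norm n x"
  have c: "?c > 0"
    using False max_norm_nonneg[of n x] two_norm_nonneg[of n x]
    by (simp add: max_norm_zero_iff_two_norm_zero less_le)
  have "max_norm n (round_off n x) = ?c * max_norm n x"
    unfolding round_off_def using c by (intro max_norm_scale) simp
  then have "square_up n (round_off n x) = (\<lambda>i. max_norm n x / (?c * max_norm n x) * (?c * x i))"
    unfolding square_up_def two_norm_round_off by (simp add: round_off_def)
  also have "\<dots> = x"
    using False c by (auto simp: max_norm_zero_iff_two_norm_zero fun_eq_iff)
  finally show ?thesis .
qed

text \<open>At the origin the quotient of norms need not have a limit, but the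
  coordinates of \<open>square_up n x\<close> are bounded by the norm of \<open>x\<close>.\<close>
lemma continuous_square_up: "continuous_on {x. \<forall>i\<ge>n. x i = 0} (square_up n)"
proof (rule continuous_on_coordinatewise_then_product)
  fix i
  show "continuous_on {x. \<forall>i\<ge>n. x i = 0} (\<lambda>x. square_up n x i)"
  proof (cases "i < n")
    case False
    then have "\<forall>x\<in>{x. \<forall>i\<ge>n. x i = 0}. square_up n x i = 0"
      by (simp add: square_up_def)
    then show ?thesis
      by (metis (no_types, lifting) continuous_on_cong continuous_on_const)
  next
    case True
    have bound: "\<bar>square_up n x i\<bar> \<le> two_norm n x" for x
      using max_norm_upper[OF True, of "square_up n x"] by (simp add: max_norm_square_up)
    have isC: "isCont (two_norm n) x" "isCont (max_norm n) x" "isCont (\<lambda>x. x i) x" for x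
      using continuous_two_norm[of UNIV n] continuous_max_norm[of UNIV n] continuous_coordinate[of UNIV i]
      unfolding continuous_on_eq_continuous_at[OF open_UNIV] by blast+
    have "isCont (\<lambda>x. square_up n x i) x" for x
    proof (cases "max_norm n x = 0")
      case False
      then show ?thesis
        unfolding square_up_def by (intro continuous_intros isC)
    next
      case m: True
      then have "two_norm n x = 0"
        by (simp add: max_norm_zero_iff_two_norm_zero)
      then have "(two_norm n \<longlongrightarrow> 0) (at x)"
        using isC(1)[of x] by (simp add: isCont_def)
      then have "((\<lambda>x. square_up n x i) \<longlongrightarrow> 0) (at x)"
        by (rule Lim_null_comparison[rotated]) (simp add: bound)
      then show ?thesis
        using m by (simp add: isCont_def square_up_def)
    qed
    then show ?thesis
      by (simp add: continuous_at_imp_continuous_on)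
  qed
qed

lemma homeomorphism_disc_cube:
  "homeomorphism (topspace (disc n)) (cube n) (square_up n) (round_off n)"
proof -
  have im: "square_up n ` topspace (disc n) = cube n"
  proof
    show "square_up n ` topspace (disc n) \<subseteq> cube n"
      unfolding image_subset_iff Ball_def disc_iff cube_iff max_norm_square_up by (simp add: square_up_def)
    show "cube n \<subseteq> square_up n ` topspace (disc n)"
    proof
      fix x assume x: "x \<in> cube n"
      then have "round_off n x \<in> topspace (disc n)"
        unfolding disc_iff cube_iff two_norm_round_off by (simp add: round_off_def)
      moreover have "square_up n (round_off n x) = x"
        using x by (intro square_up_round_off) (simp add: cube_iff)
      ultimately show "x \<in> square_up n ` topspace (disc n)"
        by (metis imageI)
    qed
  qed
  have inv: "round_off n (square_up n x) = x" if "x \<in> topspace (disc n)" for x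
    using that by (intro round_off_square_up) (simp add: disc_iff)
  have "compact (topspace (disc n))"
    using compact_ball[of n] by (simp add: topspace_disc)
  moreover have "continuous_on (topspace (disc n)) (square_up n)"
    by (rule continuous_on_subset[OF continuous_square_up]) (auto simp: disc_iff)
  moreover have "inj_on (square_up n) (topspace (disc n))"
    using inv by (auto intro: inj_on_inverseI)
  ultimately obtain g where g: "homeomorphism (topspace (disc n)) (cube n) (square_up n) g"
    using homeomorphism_compact[of "topspace (disc n)" "square_up n" "cube n"] im by blast
  have "g y = round_off n y" if "y \<in> cube n" for y
    using g that inv unfolding homeomorphism_def by (metis image_eqI)
  then show ?thesis
    using g inv by (auto simp: homeomorphism_def cong: continuous_on_cong)
qed

lemma square_up_boundary: "x \<in> topspace (disc n) \<Longrightarrow> square_up n x \<in> cube_boundary n \<longleftrightarrow> x \<in> topspace (disc_boundary n)"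
  unfolding cube_boundary_iff disc_boundary_iff disc_iff max_norm_square_up by (simp add: square_up_def)

section \<open>Cubical grids\<close>

text \<open>
  The cells containing \<open>x\<close> of the grid \<open>(1/M)\<int>\<^sup>n\<close>: the open cell, to which \<open>x\<close> belongs, and its closure. A
  coordinate with \<open>M * x i\<close> integral has equal floor and ceiling and is constant on the cell; the other
  coordinates range over an interval of length \<open>1/M\<close>, and their number is the dimension of the cell.
\<close>
definition closed_cell :: "nat \<Rightarrow> (nat \<Rightarrow> real) \<Rightarrow> (nat \<Rightarrow> real) set" where
  "closed_cell M x = {y. \<forall>i. \<lfloor>real M * x i\<rfloor> \<le> real M * y i \<and> real M * y i \<le> \<lceil>real M * x i\<rceil>}"

definition open_cell :: "nat \<Rightarrow> (nat \<Rightarrow> real) \<Rightarrow> (nat \<Rightarrow> real) set" where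
  "open_cell M x = {y. \<forall>i. \<lfloor>real M * y i\<rfloor> = \<lfloor>real M * x i\<rfloor> \<and> \<lceil>real M * y i\<rceil> = \<lceil>real M * x i\<rceil>}"

definition cell_dim :: "nat \<Rightarrow> (nat \<Rightarrow> real) \<Rightarrow> nat" where
  "cell_dim M x = card {i. \<lfloor>real M * x i\<rfloor> \<noteq> \<lceil>real M * x i\<rceil>}"

lemma open_cell_self: "x \<in> open_cell M x"
  by (simp add: open_cell_def)

lemma open_cell_subset: "open_cell M x \<subseteq> closed_cell M x"
  unfolding open_cell_def closed_cell_def by auto (metis of_int_floor_le, metis le_of_int_ceiling)

lemma closed_cell_mono: "y \<in> closed_cell M x \<Longrightarrow> closed_cell M y \<subseteq> closed_cell M x"
proof
  fix z assume y: "y \<in> closed_cell M x" and z: "z \<in> closed_cell M y"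
  have "\<lfloor>real M * x i\<rfloor> \<le> \<lfloor>real M * y i\<rfloor>" "\<lceil>real M * y i\<rceil> \<le> \<lceil>real M * x i\<rceil>" for i
    using y by (simp_all add: closed_cell_def le_floor_iff ceiling_le_iff)
  then have "of_int \<lfloor>real M * x i\<rfloor> \<le> real M * z i" "real M * z i \<le> of_int \<lceil>real M * x i\<rceil>" for i
    using z unfolding closed_cell_def by (smt (verit) mem_Collect_eq of_int_le_iff)+
  then show "z \<in> closed_cell M x"
    by (simp add: closed_cell_def)
qed

lemma open_cell_eq:
  assumes "y \<in> open_cell M x"
  shows "closed_cell M y = closed_cell M x" "open_cell M y = open_cell M x" "cell_dim M y = cell_dim M x"
  using assms by (simp_all add: open_cell_def closed_cell_def cell_dim_def)

lemma cell_zero: "M > 0 \<Longrightarrow> x i = 0 \<Longrightarrow> y \<in> closed_cell M x \<Longrightarrow> y i = 0"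
  unfolding closed_cell_def by (auto dest!: spec[of _ i] simp: mult_le_0_iff zero_le_mult_iff)

lemma cell_coordinate_bounds:
  assumes "x \<in> cube n"
  shows "- int M \<le> \<lfloor>real M * x i\<rfloor>" "\<lceil>real M * x i\<rceil> \<le> int M"
proof -
  have "\<bar>x i\<bar> \<le> 1"
    using assms by (cases "i < n") (auto simp: cube_def)
  then have "- real M \<le> real M * x i" "real M * x i \<le> real M"
    using mult_left_mono[of "x i" 1 "real M"] mult_left_mono[of "-1" "x i" "real M"] by auto
  then show "- int M \<le> \<lfloor>real M * x i\<rfloor>" "\<lceil>real M * x i\<rceil> \<le> int M"
    by (simp_all add: le_floor_iff ceiling_le_iff)
qed

lemma closed_cell_in_cube:
  assumes M: "M > 0" and x: "x \<in> cube n"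
  shows "closed_cell M x \<subseteq> cube n"
proof
  fix y assume y: "y \<in> closed_cell M x"
  have "\<bar>y i\<bar> \<le> 1" for i
  proof -
    have "- real M \<le> of_int \<lfloor>real M * x i\<rfloor>" "of_int \<lceil>real M * x i\<rceil> \<le> real M"
      using cell_coordinate_bounds[OF x, of M i] by linarith+
    then have "real M * (-1) \<le> real M * y i" "real M * y i \<le> real M * 1"
      using y unfolding closed_cell_def by (auto dest!: spec[of _ i])
    then have "-1 \<le> y i" "y i \<le> 1"
      using M by (simp_all only: mult_le_cancel_left_pos of_nat_0_less_iff)
    then show ?thesis
      by linarith
  qed
  moreover have "y i = 0" if "i \<ge> n" for i
    using cell_zero[OF M _ y] x that by (simp add: cube_def)
  ultimately show "y \<in> cube n"
    by (simp add: cube_def)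
qed

lemma closed_cell_in_cube_boundary:
  assumes M: "M > 0" and x: "x \<in> cube_boundary n"
  shows "closed_cell M x \<subseteq> cube_boundary n"
proof
  fix y assume y: "y \<in> closed_cell M x"
  obtain i where i: "i < n" "\<bar>x i\<bar> = 1" and xc: "x \<in> cube n"
    using x by (auto simp: cube_boundary_def)
  have "real M * y i = real M * x i"
  proof -
    have "x i = 1 \<or> x i = -1"
      using i by linarith
    then have "real M * x i = of_int (int M) \<or> real M * x i = of_int (- int M)"
      by auto
    then obtain k :: int where k: "real M * x i = of_int k"
      by blast
    then show ?thesis
      using y unfolding closed_cell_def by (auto dest!: spec[of _ i])
  qed
  then have "y i = x i"
    using M by simp
  then show "y \<in> cube_boundary n"
    using closed_cell_in_cube[OF M xc] y i by (auto simp: cube_boundary_def)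
qed

lemma finite_cells:
  shows "finite (open_cell M ` cube n)"
proof -
  let ?B = "{f. \<forall>i. (i \<in> {..<n} \<longrightarrow> f i \<in> {- int M..int M}) \<and> (i \<notin> {..<n} \<longrightarrow> f i = (0::int))}"
  have "finite ?B"
    by (rule finite_set_of_finite_funs) auto
  define code where "code = (\<lambda>x::nat \<Rightarrow> real. (\<lambda>i. \<lfloor>real M * x i\<rfloor>, \<lambda>i. \<lceil>real M * x i\<rceil>))"
  have "code x \<in> ?B \<times> ?B" if x: "x \<in> cube n" for x
  proof -
    have "\<lfloor>real M * x i\<rfloor> \<le> int M" "- int M \<le> \<lceil>real M * x i\<rceil>" for i
      using cell_coordinate_bounds[OF x, of M i] by linarith+
    then show ?thesis
      using cell_coordinate_bounds[OF x, of M] x by (auto simp: code_def cube_def)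
  qed
  then have "code ` cube n \<subseteq> ?B \<times> ?B"
    by blast
  then have "finite (code ` cube n)"
    using \<open>finite ?B\<close> by (meson finite_SigmaI finite_subset)
  moreover have "open_cell M x = (\<lambda>(f, c). {y. \<forall>i. \<lfloor>real M * y i\<rfloor> = f i \<and> \<lceil>real M * y i\<rceil> = c i}) (code x)" for x
    by (simp add: open_cell_def code_def)
  ultimately show ?thesis
    by (simp add: image_image[symmetric] finite_imageI flip: image_image)
qed

text \<open>
  A coordinate that is integral for \<open>x\<close> is integral for \<open>y\<close>. If no other one were, \<open>y\<close> would have the floors and
  ceilings of \<open>x\<close>.
\<close>
lemma cell_dim_decreases:
  assumes M: "M > 0" and x: "x \<in> cube n" and y: "y \<in> closed_cell M x" "y \<notin> open_cell M x"
  shows "cell_dim M y < cell_dim M x"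
proof -
  let ?J = "\<lambda>x. {i. \<lfloor>real M * x i\<rfloor> \<noteq> \<lceil>real M * x i\<rceil>}"
  have fin: "finite (?J x)"
    by (rule finite_subset[of _ "{..<n}"]) (use x in \<open>auto simp: cube_def not_less[symmetric]\<close>)
  have b: "of_int \<lfloor>real M * x i\<rfloor> \<le> real M * y i" "real M * y i \<le> of_int \<lceil>real M * x i\<rceil>" for i
    using y(1) by (auto simp: closed_cell_def)
  have int: "\<lfloor>real M * y i\<rfloor> = \<lfloor>real M * x i\<rfloor> \<and> \<lceil>real M * y i\<rceil> = \<lceil>real M * x i\<rceil>"
    if "\<lfloor>real M * x i\<rfloor> = \<lceil>real M * x i\<rceil>" for i
  proof -
    have "real M * y i = of_int \<lfloor>real M * x i\<rfloor>"
      using b[of i] that by simp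
    then show ?thesis
      using that by simp
  qed
  have nonint: "\<lfloor>real M * y i\<rfloor> = \<lfloor>real M * x i\<rfloor> \<and> \<lceil>real M * y i\<rceil> = \<lceil>real M * x i\<rceil>"
    if "\<lfloor>real M * x i\<rfloor> \<noteq> \<lceil>real M * x i\<rceil>" "\<lfloor>real M * y i\<rfloor> \<noteq> \<lceil>real M * y i\<rceil>" for i
  proof -
    have "\<lceil>real M * x i\<rceil> = \<lfloor>real M * x i\<rfloor> + 1" "\<lceil>real M * y i\<rceil> = \<lfloor>real M * y i\<rfloor> + 1"
      using that by (auto simp: ceiling_altdef)
    moreover have "\<lfloor>real M * x i\<rfloor> \<le> \<lfloor>real M * y i\<rfloor>" "\<lceil>real M * y i\<rceil> \<le> \<lceil>real M * x i\<rceil>"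
      using b[of i] by (simp_all add: le_floor_iff ceiling_le_iff)
    ultimately show ?thesis
      by linarith
  qed
  have sub: "?J y \<subseteq> ?J x"
    using int by auto
  obtain i where i: "\<not> (\<lfloor>real M * y i\<rfloor> = \<lfloor>real M * x i\<rfloor> \<and> \<lceil>real M * y i\<rceil> = \<lceil>real M * x i\<rceil>)"
    using y(2) by (auto simp: open_cell_def)
  then have "i \<in> ?J x" "i \<notin> ?J y"
    using int[of i] nonint[of i] by blast+
  then have "?J y \<subset> ?J x"
    using sub by blast
  then show ?thesis
    unfolding cell_dim_def using fin by (rule psubset_card_mono[rotated])
qed

lemma cell_dim_le: "x \<in> cube n \<Longrightarrow> cell_dim M x \<le> n"
proof -
  assume x: "x \<in> cube n"
  have "{i. \<lfloor>real M * x i\<rfloor> \<noteq> \<lceil>real M * x i\<rceil>} \<subseteq> {..<n}"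
    using x by (auto simp: cube_def not_less[symmetric])
  then show ?thesis
    unfolding cell_dim_def using card_mono[of "{..<n}"] by simp
qed

text \<open>
  The map is affine: the free coordinates \<open>J\<close> of the cell are numbered by \<open>\<sigma>\<close>, and \<open>[-1, 1]\<close> is
  mapped onto the interval between floor and ceiling. For a coordinate outside \<open>J\<close> the formula degenerates to the
  constant \<open>lo i = hi i\<close>, whatever the value of \<open>\<sigma>\<close> there.
\<close>
lemma characteristic_map:
  assumes M: "M > 0" and x: "x \<in> cube n"
  obtains c where "continuous_on UNIV c"
    "c ` cube (cell_dim M x) \<subseteq> closed_cell M x"
    "c ` cube_boundary (cell_dim M x) \<inter> open_cell M x = {}"
    "bij_betw c (cube (cell_dim M x) - cube_boundary (cell_dim M x)) (open_cell M x)"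
proof -
  define J where "J = {i. \<lfloor>real M * x i\<rfloor> \<noteq> \<lceil>real M * x i\<rceil>}"
  define k where "k = cell_dim M x"
  define lo where "lo = (\<lambda>i. real_of_int \<lfloor>real M * x i\<rfloor>)"
  define hi where "hi = (\<lambda>i. real_of_int \<lceil>real M * x i\<rceil>)"
  have "finite J"
    by (rule finite_subset[of _ "{..<n}"]) (use x in \<open>auto simp: J_def cube_def not_less[symmetric]\<close>)
  then obtain \<sigma> where \<sigma>: "bij_betw \<sigma> J {..<k}"
    using finite_same_card_bij[of J "{..<k}"] by (auto simp: k_def cell_dim_def J_def)
  have hJ: "hi i = lo i + 1" if "i \<in> J" for i
    using that by (auto simp: J_def hi_def lo_def ceiling_altdef)
  have nJ: "hi i = lo i" if "i \<notin> J" for i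
    using that by (auto simp: J_def hi_def lo_def)
  define c where "c = (\<lambda>(y::nat \<Rightarrow> real) i. ((lo i + hi i) + (hi i - lo i) * y (\<sigma> i)) / (2 * real M))"
  have Mc: "real M * c y i = ((lo i + hi i) + (hi i - lo i) * y (\<sigma> i)) / 2" for y i
    using M by (simp add: c_def)
  have McJ: "real M * c y i = lo i + (1 + y (\<sigma> i)) / 2" if "i \<in> J" for y i
    unfolding Mc hJ[OF that] by (simp add: field_simps)
  have McN: "real M * c y i = lo i" if "i \<notin> J" for y i
    unfolding Mc nJ[OF that] by simp
  have cont: "continuous_on UNIV c"
    unfolding c_def
    by (rule continuous_on_coordinatewise_then_product) (use M in \<open>auto intro!: continuous_intros\<close>)
  have inside: "c y \<in> closed_cell M x" if y: "y \<in> cube k" for y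
  proof -
    have "lo i \<le> real M * c y i \<and> real M * c y i \<le> hi i" for i
    proof (cases "i \<in> J")
      case True
      then have "\<sigma> i < k"
        using bij_betwE[OF \<sigma>] by auto
      then have "\<bar>y (\<sigma> i)\<bar> \<le> 1"
        using y by (simp add: cube_def)
      then show ?thesis
        unfolding McJ[OF True] hJ[OF True] by (auto simp: abs_le_iff)
    next
      case False
      then show ?thesis
        by (simp add: McN nJ)
    qed
    then show ?thesis
      by (simp add: closed_cell_def lo_def hi_def)
  qed
  have floor_lo: "\<lfloor>lo i\<rfloor> = \<lfloor>real M * x i\<rfloor>" "\<lceil>hi i\<rceil> = \<lceil>real M * x i\<rceil>" for i
    by (simp_all add: lo_def hi_def)
  have bd: "c y \<notin> open_cell M x" if y: "y \<in> cube_boundary k" for y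
  proof -
    obtain j where j: "j < k" "\<bar>y j\<bar> = 1"
      using y by (auto simp: cube_boundary_def)
    then obtain i where i: "i \<in> J" "\<sigma> i = j"
      using bij_betw_imp_surj_on[OF \<sigma>] by (metis imageE lessThan_iff)
    have "y j = 1 \<or> y j = -1"
      using j by linarith
    then have "real M * c y i = of_int (\<lfloor>real M * x i\<rfloor> + 1) \<or> real M * c y i = of_int \<lfloor>real M * x i\<rfloor>"
      unfolding McJ[OF i(1)] i(2) by (auto simp: lo_def)
    then have "\<lfloor>real M * c y i\<rfloor> = \<lceil>real M * c y i\<rceil>"
      by (metis ceiling_of_int floor_of_int)
    then show ?thesis
      using i(1) unfolding J_def open_cell_def by (auto intro!: exI[of _ i])
  qed
  have inner: "c y \<in> open_cell M x" if y: "y \<in> cube k - cube_boundary k" for y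
  proof -
    have "\<lfloor>real M * c y i\<rfloor> = \<lfloor>real M * x i\<rfloor> \<and> \<lceil>real M * c y i\<rceil> = \<lceil>real M * x i\<rceil>" for i
    proof (cases "i \<in> J")
      case True
      then have "\<sigma> i < k"
        using bij_betwE[OF \<sigma>] by auto
      then have "\<bar>y (\<sigma> i)\<bar> < 1"
        using y by (auto simp: cube_def cube_boundary_def less_le)
      then have "lo i < real M * c y i" "real M * c y i < lo i + 1"
        unfolding McJ[OF True] by (auto simp: abs_less_iff)
      then show ?thesis
        using hJ[OF True] unfolding lo_def hi_def by linarith
    next
      case False
      then show ?thesis
        using McN[OF False, of y] nJ[OF False] by (simp add: lo_def hi_def)
    qed
    then show ?thesis
      by (simp add: open_cell_def)
  qed
  have "bij_betw c (cube k - cube_boundary k) (open_cell M x)"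
    unfolding bij_betw_def
  proof
    show "inj_on c (cube k - cube_boundary k)"
    proof (rule inj_onI, rule ext)
      fix y z j assume yz: "y \<in> cube k - cube_boundary k" "z \<in> cube k - cube_boundary k" "c y = c z"
      show "y j = z j"
      proof (cases "j < k")
        case True
        then obtain i where i: "i \<in> J" "\<sigma> i = j"
          using bij_betw_imp_surj_on[OF \<sigma>] by (metis imageE lessThan_iff)
        then show ?thesis
          using McJ[OF i(1), of y] McJ[OF i(1), of z] yz(3) by simp
      next
        case False
        then show ?thesis
          using yz by (simp add: cube_def)
      qed
    qed
    show "c ` (cube k - cube_boundary k) = open_cell M x"
    proof
      show "c ` (cube k - cube_boundary k) \<subseteq> open_cell M x"
        using inner by blast
      show "open_cell M x \<subseteq> c ` (cube k - cube_boundary k)"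
      proof
        fix z assume z: "z \<in> open_cell M x"
        define \<tau> where "\<tau> = inv_into J \<sigma>"
        define y where "y = (\<lambda>j. if j < k then 2 * (real M * z (\<tau> j) - lo (\<tau> j)) - 1 else 0)"
        have \<tau>: "\<tau> j \<in> J" "\<sigma> (\<tau> j) = j" if "j < k" for j
          using that bij_betw_imp_surj_on[OF \<sigma>] unfolding \<tau>_def
          by (auto intro: inv_into_into f_inv_into_f)
        have zb: "lo i < real M * z i \<and> real M * z i < lo i + 1" if "i \<in> J" for i
        proof -
          have "\<lfloor>real M * z i\<rfloor> = \<lfloor>real M * x i\<rfloor>" "\<lceil>real M * z i\<rceil> = \<lceil>real M * x i\<rceil>"
            "\<lfloor>real M * x i\<rfloor> \<noteq> \<lceil>real M * x i\<rceil>"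
            using z that by (auto simp: open_cell_def J_def)
          then show ?thesis
            unfolding lo_def by linarith
        qed
        have "\<bar>y j\<bar> < 1" if "j < k" for j
          using zb[OF \<tau>(1)[OF that]] that unfolding y_def by (simp add: abs_less_iff)
        then have "y \<in> cube k - cube_boundary k"
          by (fastforce simp: cube_def cube_boundary_def y_def)
        moreover have "c y = z"
        proof
          fix i
          have "real M * c y i = real M * z i"
          proof (cases "i \<in> J")
            case True
            then have "\<sigma> i < k" "\<tau> (\<sigma> i) = i"
              using bij_betwE[OF \<sigma>] bij_betw_imp_inj_on[OF \<sigma>] by (auto simp: \<tau>_def)
            then show ?thesis
              unfolding McJ[OF True] by (simp add: y_def field_simps)
          next
            case False
            then have "\<lfloor>real M * z i\<rfloor> = \<lfloor>real M * x i\<rfloor>" "\<lceil>real M * z i\<rceil> = \<lfloor>real M * x i\<rfloor>"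
              using z by (auto simp: open_cell_def J_def)
            then have "real M * z i = lo i"
              unfolding lo_def by linarith
            then show ?thesis
              by (simp add: McN[OF False])
          qed
          then show "c y i = z i"
            using M by simp
        qed
        ultimately show "z \<in> c ` (cube k - cube_boundary k)"
          by blast
      qed
    qed
  qed
  with cont inside bd that show ?thesis
    unfolding k_def by blast
qed

text \<open>The largest subcomplex of the grid on the cube that is contained in \<open>W\<close>.\<close>
definition inner_cells :: "nat \<Rightarrow> nat \<Rightarrow> (nat \<Rightarrow> real) set \<Rightarrow> (nat \<Rightarrow> real) set" where
  "inner_cells n M W = {x \<in> cube n. closed_cell M x \<subseteq> W}"

lemma closed_cell_self: "x \<in> closed_cell M x"
  using open_cell_self open_cell_subset by blast

lemma inner_cells_subset: "inner_cells n M W \<subseteq> W"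
  using closed_cell_self by (auto simp: inner_cells_def)

text \<open>
  Floor and ceiling of \<open>t\<close> are determined by those of \<open>2t\<close>. So halving the mesh subdivides cells, and
  the inner cells of the coarse grid form a subcomplex of the fine grid.
\<close>
lemma refine_cell:
  shows "closed_cell (2 * M) x \<subseteq> closed_cell M x"
    and "y \<in> open_cell (2 * M) x \<Longrightarrow> closed_cell M y = closed_cell M x"
proof -
  have f: "\<lfloor>t\<rfloor> = \<lfloor>2 * t\<rfloor> div 2" "\<lceil>t\<rceil> = - ((- \<lceil>2 * t\<rceil>) div 2)" for t :: real
  proof -
    have *: "\<lfloor>t\<rfloor> = \<lfloor>2 * t\<rfloor> div 2" for t :: real
      by linarith
    show "\<lfloor>t\<rfloor> = \<lfloor>2 * t\<rfloor> div 2"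
      by (rule *)
    show "\<lceil>t\<rceil> = - ((- \<lceil>2 * t\<rceil>) div 2)"
      using *[of "- t"] by (simp add: ceiling_def)
  qed
  show "closed_cell (2 * M) x \<subseteq> closed_cell M x"
  proof
    fix y assume "y \<in> closed_cell (2 * M) x"
    then have *: "of_int \<lfloor>2 * (real M * x i)\<rfloor> \<le> 2 * (real M * y i)" "2 * (real M * y i) \<le> of_int \<lceil>2 * (real M * x i)\<rceil>" for i
      by (auto simp: closed_cell_def mult.assoc)
    have "of_int \<lfloor>real M * x i\<rfloor> \<le> real M * y i" "real M * y i \<le> of_int \<lceil>real M * x i\<rceil>" for i
    proof -
      have "2 * \<lfloor>real M * x i\<rfloor> \<le> \<lfloor>2 * (real M * x i)\<rfloor>" "\<lceil>2 * (real M * x i)\<rceil> \<le> 2 * \<lceil>real M * x i\<rceil>"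
        by (simp_all add: le_floor_iff ceiling_le_iff)
      then have "real_of_int (2 * \<lfloor>real M * x i\<rfloor>) \<le> of_int \<lfloor>2 * (real M * x i)\<rfloor>"
        "real_of_int \<lceil>2 * (real M * x i)\<rceil> \<le> of_int (2 * \<lceil>real M * x i\<rceil>)"
        by (simp_all only: of_int_le_iff)
      then show "of_int \<lfloor>real M * x i\<rfloor> \<le> real M * y i" "real M * y i \<le> of_int \<lceil>real M * x i\<rceil>"
        using *[of i] by simp_all
    qed
    then show "y \<in> closed_cell M x"
      by (simp add: closed_cell_def)
  qed
  assume "y \<in> open_cell (2 * M) x"
  then have "\<lfloor>2 * (real M * y i)\<rfloor> = \<lfloor>2 * (real M * x i)\<rfloor>" "\<lceil>2 * (real M * y i)\<rceil> = \<lceil>2 * (real M * x i)\<rceil>" for i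
    by (auto simp: open_cell_def mult.assoc)
  then have "\<lfloor>real M * y i\<rfloor> = \<lfloor>real M * x i\<rfloor>" "\<lceil>real M * y i\<rceil> = \<lceil>real M * x i\<rceil>" for i
    using f[of "real M * y i"] f[of "real M * x i"] by simp_all
  then show "closed_cell M y = closed_cell M x"
    by (simp add: closed_cell_def)
qed

lemma inner_cells_refine: "inner_cells n M W \<subseteq> inner_cells n (2 * M) W"
  using refine_cell(1) by (fastforce simp: inner_cells_def)

text \<open>
  If \<open>W\<close> contains the points of the cube at distance less than \<open>d\<close> from \<open>x\<close> in the maximum norm, and the mesh is less than
  \<open>d/2\<close>, then the cell of any point at distance less than \<open>d/2\<close> from \<open>x\<close> lies in \<open>W\<close>.
\<close>
lemma inner_cells_neighbourhood:
  assumes W: "openin (top_of_set (cube n)) W" and x: "x \<in> W"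
  obtains N U where "openin (top_of_set (cube n)) U" "x \<in> U" "U \<subseteq> inner_cells n (2 ^ N) W"
proof -
  obtain O' where O': "open O'" "W = cube n \<inter> O'"
    using W by (auto simp: openin_open)
  then have O'_open: "openin (powertop_real UNIV) O'" and xO': "x \<in> O'" and xc: "x \<in> cube n"
    using x by (simp_all add: euclidean_product_topology)
  from product_topology_open_contains_basis[OF O'_open xO']
  obtain X where X: "x \<in> PiE UNIV X" "\<forall>i. openin euclideanreal (X i)" "PiE UNIV X \<subseteq> O'"
    by (elim exE conjE)
  have "\<exists>e>0. \<forall>t. \<bar>t - x i\<bar> < e \<longrightarrow> t \<in> X i" for i
    using X(1) X(2) unfolding open_openin[symmetric] open_dist by (auto simp: PiE_UNIV_domain Pi_iff dist_real_def)
  then obtain e where e: "\<And>i. e i > 0" "\<And>i t. \<bar>t - x i\<bar> < e i \<Longrightarrow> t \<in> X i"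
    by metis
  define d where "d = Min (insert 1 (e ` {..<n}))"
  have d: "d > 0" "\<And>i. i < n \<Longrightarrow> d \<le> e i"
    unfolding d_def using e(1) by auto
  have dW: "y \<in> W" if "y \<in> cube n" "\<And>i. i < n \<Longrightarrow> \<bar>y i - x i\<bar> < d" for y
  proof -
    have "y i \<in> X i" for i
    proof (cases "i < n")
      case True
      then show ?thesis
        using that(2)[OF True] d(2)[OF True] e(2)[of "y i" i] by linarith
    next
      case False
      then have "y i = x i"
        using that(1) xc by (simp add: cube_def)
      then show ?thesis
        using e(1)[of i] e(2)[of "y i" i] by simp
    qed
    then show ?thesis
      using X(3) O'(2) that(1) by (auto simp: PiE_UNIV_domain Pi_iff)
  qed
  obtain N where N: "(1/2::real) ^ N < d / 2"
    using real_arch_pow_inv[of "d / 2" "1/2"] d(1) by auto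
  define M :: nat where "M = 2 ^ N"
  have M: "M > 0" and M2: "1 / real M < d / 2"
    using N by (simp_all add: M_def power_one_over)
  define U where "U = cube n \<inter> (\<Inter>i<n. {y. \<bar>y i - x i\<bar> < d / 2})"
  show ?thesis
  proof
    have "open (\<Inter>i<n. {y::nat \<Rightarrow> real. \<bar>y i - x i\<bar> < d / 2})"
      by (intro open_INT finite_lessThan ballI open_Collect_less) (auto intro!: continuous_intros)
    then show "openin (top_of_set (cube n)) U"
      unfolding U_def by (rule openin_open_Int)
    show "x \<in> U"
      using xc d(1) by (simp add: U_def)
    show "U \<subseteq> inner_cells n (2 ^ N) W"
    proof
      fix y assume y: "y \<in> U"
      have "z \<in> W" if z: "z \<in> closed_cell M y" for z
      proof (rule dW)
        show "z \<in> cube n"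
          using closed_cell_in_cube[OF M] y z by (auto simp: U_def)
        fix i assume i: "i < n"
        have "of_int \<lfloor>real M * y i\<rfloor> \<le> real M * z i" "real M * z i \<le> of_int \<lceil>real M * y i\<rceil>"
          using z by (auto simp: closed_cell_def)
        then have "\<bar>real M * z i - real M * y i\<bar> \<le> 1"
          by linarith
        then have "real M * \<bar>z i - y i\<bar> \<le> 1"
          by (simp add: abs_mult flip: right_diff_distrib)
        then have "\<bar>z i - y i\<bar> \<le> 1 / real M"
          using M by (simp add: field_simps)
        moreover have "\<bar>y i - x i\<bar> < d / 2"
          using y i by (auto simp: U_def)
        ultimately show "\<bar>z i - x i\<bar> < d"
          using M2 by linarith
      qed
      then show "y \<in> inner_cells n (2 ^ N) W"
        using y by (auto simp: inner_cells_def U_def M_def)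
    qed
  qed
qed

context cell_family begin

section \<open>Open parts of a cell\<close>

text \<open>
  Compose \<open>h\<close> with the characteristic map of the grid cell, after identifying its source, a cube, with a
  disc.
\<close>
lemma attaches_open_cell:
  assumes V: "G_space G V" and H: "H \<in> \<C>"
    and cont: "continuous_map (prod_topology (orbit_topology G H) (top_of_set W)) (gtop V) h"
    and equiv: "\<And>g c x. g \<in> carrier G \<Longrightarrow> c \<in> lcosets H \<Longrightarrow> x \<in> W \<Longrightarrow> h (g <#\<^bsub>G\<^esub> c, x) = gact V g (h (c, x))"
    and cell: "M > 0" "x \<in> cube n" "closed_cell M x \<subseteq> W"
    and bd: "h ` ((lcosets H) \<times> (closed_cell M x - open_cell M x)) \<subseteq> F"
    and sub: "F \<subseteq> F'" and bij: "bij_betw h ((lcosets H) \<times> open_cell M x) (F' - F)"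
  shows "attaches V F F'"
proof -
  define k where "k = cell_dim M x"
  obtain c where c: "continuous_on UNIV c" "c ` cube k \<subseteq> closed_cell M x"
      "c ` cube_boundary k \<inter> open_cell M x = {}" "bij_betw c (cube k - cube_boundary k) (open_cell M x)"
    using characteristic_map[OF cell(1,2)] unfolding k_def by metis
  define e where "e = c \<circ> square_up k"
  define m where "m = (\<lambda>p :: 'g set \<times> (nat \<Rightarrow> real). (fst p, e (snd p)))"
  let ?D = "topspace (disc k)" and ?S = "topspace (disc_boundary k)"
  have sq: "square_up k v \<in> cube k" if "v \<in> ?D" for v
    using homeomorphism_disc_cube[of k] that unfolding homeomorphism_def by blast
  have e_in: "e v \<in> closed_cell M x" if "v \<in> ?D" for v
    using sq[OF that] c(2) by (auto simp: e_def)
  have e_bd: "e v \<notin> open_cell M x" if "v \<in> ?S" for v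
  proof -
    have "square_up k v \<in> cube_boundary k"
      using that square_up_boundary[of v k] disc_boundary_subset by blast
    then show ?thesis
      using c(3) by (auto simp: e_def)
  qed
  have e_bij: "bij_betw e (?D - ?S) (open_cell M x)"
    unfolding e_def
  proof (rule bij_betw_trans[OF _ c(4)])
    show "bij_betw (square_up k) (?D - ?S) (cube k - cube_boundary k)"
    proof (rule bij_betw_imageI)
      show "inj_on (square_up k) (?D - ?S)"
        using homeomorphism_disc_cube[of k] unfolding homeomorphism_def by (metis DiffD1 inj_on_def)
      have "square_up k ` (?D - ?S) = square_up k ` ?D - cube_boundary k"
        using square_up_boundary[of _ k] by blast
      then show "square_up k ` (?D - ?S) = cube k - cube_boundary k"
        using homeomorphism_disc_cube[of k] by (simp add: homeomorphism_def)
    qed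
  qed
  have "continuous_on ?D e"
    unfolding e_def using homeomorphism_disc_cube[of k]
    by (intro continuous_on_compose continuous_on_subset[OF c(1)]) (auto simp: homeomorphism_def)
  then have "continuous_map (disc k) (top_of_set W) e"
    using e_in cell(3) unfolding disc_top_of_set by (auto simp: topspace_disc)
  then have "continuous_map (prod_topology (orbit_topology G H) (disc k)) (prod_topology (orbit_topology G H) (top_of_set W)) m"
    unfolding m_def by (intro continuous_map_pairedI continuous_map_fst
        continuous_map_compose[OF continuous_map_snd, unfolded o_def])
  then have hm_cont: "continuous_map (prod_topology (orbit_topology G H) (disc k)) (gtop V) (h \<circ> m)"
    using cont by (rule continuous_map_compose)
  have hm: "G_map G (orbit_times G H (disc k)) V (h \<circ> m)"
    unfolding G_map_def
  proof (intro conjI ballI)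
    show "G_space G (orbit_times G H (disc k))"
      by (intro G_space_orbit_times subgroups closed_subgroups H disc_compact_Hausdorff)
    show "continuous_map (gtop (orbit_times G H (disc k))) (gtop V) (h \<circ> m)"
      using hm_cont by (simp add: orbit_times_def)
    fix g p assume g: "g \<in> carrier G" and "p \<in> points (orbit_times G H (disc k))"
    then obtain d v where p: "p = (d, v)" "d \<in> lcosets H" "v \<in> ?D"
      by auto
    then show "(h \<circ> m) (gact (orbit_times G H (disc k)) g p) = gact V g ((h \<circ> m) p)"
      using equiv[OF g p(2), of "e v"] e_in[OF p(3)] cell(3) by (auto simp: orbit_times_def m_def)
  qed (rule V)
  moreover have "(h \<circ> m) ` ((lcosets H) \<times> ?S) \<subseteq> F"
  proof -
    have "m ` ((lcosets H) \<times> ?S) \<subseteq> (lcosets H) \<times> (closed_cell M x - open_cell M x)"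
      using e_bd e_in disc_boundary_subset[of k] by (auto simp: m_def)
    then show ?thesis
      using order_trans[OF image_mono bd, of "m ` ((lcosets H) \<times> ?S)"] by (simp add: image_comp)
  qed
  moreover have "bij_betw (h \<circ> m) ((lcosets H) \<times> (?D - ?S)) (F' - F)"
  proof (rule bij_betw_trans[OF _ bij])
    show "bij_betw m ((lcosets H) \<times> (?D - ?S)) ((lcosets H) \<times> open_cell M x)"
    proof (rule bij_betw_imageI)
      show "inj_on m ((lcosets H) \<times> (?D - ?S))"
      proof (rule inj_onI)
        fix p q assume pq: "p \<in> (lcosets H) \<times> (?D - ?S)" "q \<in> (lcosets H) \<times> (?D - ?S)" "m p = m q"
        then have "snd p = snd q"
          by (intro inj_onD[OF bij_betw_imp_inj_on[OF e_bij], of "snd p" "snd q"]) (auto simp: m_def)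
        then show "p = q"
          using pq(3) by (simp add: m_def prod_eq_iff)
      qed
      have "m ` ((lcosets H) \<times> (?D - ?S)) = (lcosets H) \<times> e ` (?D - ?S)"
        by (force simp: m_def)
      then show "m ` ((lcosets H) \<times> (?D - ?S)) = (lcosets H) \<times> open_cell M x"
        using bij_betw_imp_surj_on[OF e_bij] by simp
    qed
  qed
  moreover have "F \<subset> F'"
  proof -
    have "\<one> <#\<^bsub>G\<^esub> H \<in> lcosets H"
      unfolding LCOSETS_def by blast
    then have "h (\<one> <#\<^bsub>G\<^esub> H, x) \<in> F' - F"
      using bij_betwE[OF bij] open_cell_self by blast
    then show ?thesis
      using sub by blast
  qed
  ultimately show ?thesis
    unfolding attaches_def using H by metis
qed

text \<open>
  The part \<open>G/H \<times> W\<close> of a cell is attached to \<open>F\<close> in countably many steps. Step \<open>N\<close> adds the inner cells of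
  the grid of mesh \<open>2\<^sup>-\<^sup>N\<close>, in order of dimension, since the boundary of a grid cell is made of cells of
  smaller dimension. The limit is coherent because the union of the inner cells is locally reached at a finite
  step and \<open>h\<close> is a closed map.
\<close>
lemma cellular_open_subset_of_cell:
  assumes V: "G_space G V" and H: "H \<in> \<C>" and W: "openin (top_of_set (cube n)) W"
    and cont: "continuous_map (prod_topology (orbit_topology G H) (top_of_set W)) (gtop V) h"
    and equiv: "\<And>g c x. g \<in> carrier G \<Longrightarrow> c \<in> lcosets H \<Longrightarrow> x \<in> W \<Longrightarrow> h (g <#\<^bsub>G\<^esub> c, x) = gact V g (h (c, x))"
    and clmap: "closed_map (prod_topology (orbit_topology G H) (top_of_set W)) (gtop V) h"
    and F: "closedin (gtop V) F" "G_invariant G V F" and sub: "F \<subseteq> F'"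
    and bd: "h ` ((lcosets H) \<times> (W \<inter> cube_boundary n)) \<subseteq> F"
    and bij: "bij_betw h ((lcosets H) \<times> (W - cube_boundary n)) (F' - F)"
  shows "cellular V F F'"
proof -
  let ?L = "lcosets H"
  have Wc: "W \<subseteq> cube n"
    using openin_imp_subset[OF W] .
  define \<Phi> where "\<Phi> = (\<lambda>Z. F \<union> h ` (?L \<times> Z))"
  have \<Phi>_bij: "bij_betw h (?L \<times> e) (\<Phi> (Z \<union> e) - \<Phi> Z)"
    if Z: "Z \<subseteq> W" and e: "e \<subseteq> W - cube_boundary n" "e \<inter> Z = {}" for Z e
  proof (rule bij_betw_imageI)
    have inj: "inj_on h (?L \<times> (W - cube_boundary n))"
      by (rule bij_betw_imp_inj_on[OF bij])
    show "inj_on h (?L \<times> e)"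
      by (rule inj_on_subset[OF inj]) (use e in auto)
    have "h p \<notin> \<Phi> Z" if p: "p \<in> ?L \<times> e" for p
    proof
      assume "h p \<in> \<Phi> Z"
      have pW: "p \<in> ?L \<times> (W - cube_boundary n)"
        using p e by auto
      then have "h p \<notin> F"
        using bij_betwE[OF bij] by blast
      then obtain q where q: "q \<in> ?L \<times> Z" "h p = h q"
        using \<open>h p \<in> \<Phi> Z\<close> by (auto simp: \<Phi>_def)
      have "q \<in> ?L \<times> (W - cube_boundary n)"
      proof -
        have "q \<notin> ?L \<times> (W \<inter> cube_boundary n)"
          using bd q(2) \<open>h p \<notin> F\<close> by auto
        then show ?thesis
          using q(1) Z by auto
      qed
      then have "p = q"
        using inj_onD[OF inj q(2) pW] by blast
      then show False
        using p q(1) e(2) by auto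
    qed
    then show "h ` (?L \<times> e) = \<Phi> (Z \<union> e) - \<Phi> Z"
      unfolding \<Phi>_def by auto
  qed
  have grow: "cellular V (\<Phi> A) (\<Phi> (A \<union> inner_cells n M W))"
    if M: "M > 0" and A: "A \<subseteq> W" "W \<inter> cube_boundary n \<subseteq> A"
      and \<Phi>A: "closedin (gtop V) (\<Phi> A)" "G_invariant G V (\<Phi> A)"
      and sat: "\<And>x y. x \<in> inner_cells n M W \<Longrightarrow> y \<in> open_cell M x \<Longrightarrow> y \<in> A \<Longrightarrow> x \<in> A"
    for A M
  proof -
    let ?Q = "inner_cells n M W"
    have Q: "x \<in> cube n" "closed_cell M x \<subseteq> W" if "x \<in> ?Q" for x
      using that by (auto simp: inner_cells_def)
    have Q_closed: "y \<in> ?Q" if "x \<in> ?Q" "y \<in> closed_cell M x" for x y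
      using closed_cell_mono[OF that(2)] closed_cell_in_cube[OF M, of x n] that Q[OF that(1)]
      by (auto simp: inner_cells_def)
    \<comment> \<open>\<open>A\<close> together with the skeleton of the new cells of dimension below \<open>k\<close>\<close>
    define A' where "A' = (\<lambda>k. A \<union> {x \<in> ?Q. cell_dim M x < k})"
    have A'W: "A' k \<subseteq> W" for k
      using A(1) inner_cells_subset[of n M W] by (auto simp: A'_def)
    have "cellular V (\<Phi> A) (\<Phi> (A' k))" for k
    proof (induction k)
      case 0
      then show ?case
        using \<Phi>A by (simp add: A'_def cellular_refl)
    next
      case (Suc k)
      define E where "E = open_cell M ` {x \<in> ?Q - A. cell_dim M x = k}"
      have "finite E"
        by (rule finite_subset[OF _ finite_cells[of M n]]) (use Q in \<open>auto simp: E_def\<close>)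
      have E_W: "\<Union>E \<subseteq> W"
        using Q(2) open_cell_subset unfolding E_def by blast
      \<comment> \<open>cells of equal dimension are disjoint, so they may be attached one by one in any order\<close>
      have "cellular V (\<Phi> A) (\<Phi> (A' k \<union> \<Union>D))" if "finite D" "D \<subseteq> E" for D
        using that
      proof (induction D rule: finite_induct)
        case empty
        then show ?case
          using Suc.IH by simp
      next
        case (insert e D)
        let ?Z = "A' k \<union> \<Union>D"
        have IH: "cellular V (\<Phi> A) (\<Phi> ?Z)"
          using insert by simp
        have "e \<in> E"
          using insert.prems by simp
        then obtain x where x: "x \<in> ?Q" "x \<notin> A" "cell_dim M x = k" "e = open_cell M x"
          unfolding E_def by blast
        have ZW: "?Z \<subseteq> W"
          using A'W E_W insert.prems by blast
        have eA: "e \<inter> A = {}"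
          using sat[OF x(1)] x(2,4) by blast
        have eW: "e \<subseteq> W - cube_boundary n"
          using eA A(2) Q(2)[OF x(1)] open_cell_subset[of M x] x(4) by blast
        have "y \<notin> ?Z" if y: "y \<in> e" for y
        proof -
          have yx: "y \<in> open_cell M x"
            using y x(4) by simp
          have "y \<notin> A' k"
            using eA y open_cell_eq(3)[OF yx] x(3) by (auto simp: A'_def)
          moreover have "y \<notin> d" if d: "d \<in> D" for d
          proof
            assume "y \<in> d"
            obtain x' where x': "d = open_cell M x'"
              using d insert.prems unfolding E_def by blast
            then have "d = open_cell M y"
              using \<open>y \<in> d\<close> open_cell_eq(2)[of y M x'] by simp
            also have "\<dots> = e"
              using open_cell_eq(2)[OF yx] x(4) by simp
            finally show False
              using d insert.hyps(2) by simp
          qed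
          ultimately show ?thesis
            by blast
        qed
        then have eZ: "e \<inter> ?Z = {}"
          by blast
        have "closed_cell M x - open_cell M x \<subseteq> A' k"
        proof
          fix y assume y: "y \<in> closed_cell M x - open_cell M x"
          then have "cell_dim M y < k"
            using cell_dim_decreases[OF M Q(1)[OF x(1)], of y] x(3) by simp
          then show "y \<in> A' k"
            using Q_closed[OF x(1)] y by (simp add: A'_def)
        qed
        then have bdZ: "h ` (?L \<times> (closed_cell M x - open_cell M x)) \<subseteq> \<Phi> ?Z"
          unfolding \<Phi>_def by blast
        have "\<Phi> ?Z \<subseteq> \<Phi> (?Z \<union> e)"
          unfolding \<Phi>_def by blast
        then have "attaches V (\<Phi> ?Z) (\<Phi> (?Z \<union> e))"
          using \<Phi>_bij[OF ZW eW eZ] unfolding x(4)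
          by (intro attaches_open_cell[OF V H cont equiv M Q[OF x(1)] bdZ]) simp_all
        then have "cellular V (\<Phi> ?Z) (\<Phi> (?Z \<union> e))"
          by (rule cellular_attach[OF cellularD(3,5)[OF IH]])
        then have "cellular V (\<Phi> A) (\<Phi> (?Z \<union> e))"
          by (rule cellular_trans[OF IH])
        moreover have "?Z \<union> e = A' k \<union> \<Union>(insert e D)"
          by blast
        ultimately show ?case
          by simp
      qed
      then have "cellular V (\<Phi> A) (\<Phi> (A' k \<union> \<Union>E))"
        using \<open>finite E\<close> by blast
      moreover have "A' k \<union> \<Union>E = A' (Suc k)"
      proof
        have "y \<in> A' (Suc k)" if "x \<in> ?Q" "cell_dim M x = k" "y \<in> open_cell M x" for x y
          using that open_cell_eq(3)[OF that(3)] Q_closed[OF that(1)] open_cell_subset[of M x]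
          by (auto simp: A'_def)
        then show "A' k \<union> \<Union>E \<subseteq> A' (Suc k)"
          by (auto simp: E_def) (auto simp: A'_def)
        show "A' (Suc k) \<subseteq> A' k \<union> \<Union>E"
          using open_cell_self[of _ M] by (auto simp: A'_def E_def less_Suc_eq)
      qed
      ultimately show ?case
        by simp
    qed
    moreover have "A' (Suc n) = A \<union> ?Q"
      using cell_dim_le Q(1) by (auto simp: A'_def less_Suc_eq_le)
    ultimately show ?thesis
      by metis
  qed
  define Z where "Z = (\<lambda>N. case N of 0 \<Rightarrow> W \<inter> cube_boundary n | Suc N \<Rightarrow> W \<inter> cube_boundary n \<union> inner_cells n (2 ^ N) W)"
  have Z0: "\<Phi> (Z 0) = F"
    using bd by (auto simp: Z_def \<Phi>_def)
  \<comment> \<open>an inner cell that meets the boundary of the cube lies in it, so none of its points is new\<close>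
  have bd_sat: "x \<in> W \<inter> cube_boundary n"
    if "M > 0" "x \<in> inner_cells n M W" "y \<in> open_cell M x" "y \<in> cube_boundary n" for x y M
  proof -
    have "x \<in> closed_cell M y"
      using open_cell_eq(1)[OF that(3)] closed_cell_self by simp
    then show ?thesis
      using closed_cell_in_cube_boundary[OF that(1,4)] inner_cells_subset that(2) by blast
  qed
  have stage: "cellular V (\<Phi> (Z N)) (\<Phi> (Z (Suc N)))"
    if "closedin (gtop V) (\<Phi> (Z N))" "G_invariant G V (\<Phi> (Z N))" for N
  proof (cases N)
    case 0
    have "cellular V (\<Phi> (Z 0)) (\<Phi> (Z 0 \<union> inner_cells n 1 W))"
      using that 0 bd_sat[of 1] by (intro grow) (auto simp: Z_def)
    then show ?thesis
      using 0 by (simp add: Z_def)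
  next
    case (Suc N')
    have "x \<in> Z N" if x: "x \<in> inner_cells n (2 ^ N) W" "y \<in> open_cell (2 ^ N) x" "y \<in> Z N" for x y
    proof (cases "y \<in> cube_boundary n")
      case True
      then show ?thesis
        using bd_sat[OF _ x(1,2)] Suc by (simp add: Z_def)
    next
      case False
      then have "y \<in> inner_cells n (2 ^ N') W"
        using x(3) Suc by (simp add: Z_def)
      moreover have "closed_cell (2 ^ N') y = closed_cell (2 ^ N') x"
        using refine_cell(2)[of y "2 ^ N'" x] x(2) Suc by simp
      ultimately show ?thesis
        using x(1) Suc by (simp add: Z_def inner_cells_def)
    qed
    then have "cellular V (\<Phi> (Z N)) (\<Phi> (Z N \<union> inner_cells n (2 ^ N) W))"
      using that Suc inner_cells_subset[of n] by (intro grow) (auto simp: Z_def)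
    moreover have "Z N \<union> inner_cells n (2 ^ N) W = Z (Suc N)"
      using inner_cells_refine[of n "2 ^ N'" W] Suc by (auto simp: Z_def)
    ultimately show ?thesis
      by simp
  qed
  have ci: "closedin (gtop V) (\<Phi> (Z N)) \<and> G_invariant G V (\<Phi> (Z N))" for N
  proof (induction N)
    case 0
    then show ?case
      using F by (simp add: Z0)
  next
    case (Suc N)
    then show ?case
      using cellularD(3,5)[OF stage] by simp
  qed
  have Z_sub: "Z N \<subseteq> W" for N
    using inner_cells_subset by (auto simp: Z_def split: nat.split)
  have F'_eq: "F' = \<Phi> W"
  proof -
    have "?L \<times> W = ?L \<times> (W - cube_boundary n) \<union> ?L \<times> (W \<inter> cube_boundary n)"
      by auto
    then have "h ` (?L \<times> W) = (F' - F) \<union> h ` (?L \<times> (W \<inter> cube_boundary n))"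
      using bij_betw_imp_surj_on[OF bij] by (metis image_Un)
    then show ?thesis
      unfolding \<Phi>_def using bd sub by blast
  qed
  have "coherent V (range (\<lambda>N. \<Phi> (Z N))) F'"
    unfolding coherent_def
  proof (intro conjI allI impI)
    show "\<Union>(range (\<lambda>N. \<Phi> (Z N))) = F'"
    proof -
      have "x \<in> (\<Union>N. Z N)" if xW: "x \<in> W" for x
      proof -
        obtain N U where "openin (top_of_set (cube n)) U" "x \<in> U" "U \<subseteq> inner_cells n (2 ^ N) W"
          using inner_cells_neighbourhood[OF W xW] .
        then have "x \<in> Z (Suc N)"
          by (auto simp: Z_def)
        then show ?thesis
          by blast
      qed
      then have "(\<Union>N. Z N) = W"
        using Z_sub by blast
      then show ?thesis
        unfolding F'_eq \<Phi>_def by blast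
    qed
    fix T assume T: "T \<subseteq> F'" and "\<forall>E\<in>range (\<lambda>N. \<Phi> (Z N)). closedin (gtop V) (T \<inter> E)"
    then have cl: "closedin (gtop V) (T \<inter> \<Phi> (Z N))" for N
      by simp
    let ?D = "prod_topology (orbit_topology G H) (top_of_set W)"
    have topD: "topspace ?D = ?L \<times> W"
      by simp
    define C where "C = {p \<in> topspace ?D. h p \<in> T}"
    have "openin ?D (topspace ?D - C)"
      unfolding openin_subopen[of ?D "topspace ?D - C"]
    proof
      fix p assume p: "p \<in> topspace ?D - C"
      then have "snd p \<in> W"
        by auto
      then obtain N U where U: "openin (top_of_set (cube n)) U" "snd p \<in> U" "U \<subseteq> inner_cells n (2 ^ N) W"
        using inner_cells_neighbourhood[OF W] by metis
      have UW: "U \<subseteq> W"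
        using U(3) inner_cells_subset by blast
      have "openin (top_of_set W) U"
        using U(1) UW Wc by (rule openin_subset_trans)
      then have "openin ?D (?L \<times> U)"
        using openin_topspace[of "orbit_topology G H"] by (simp add: openin_prod_Times_iff)
      moreover define C' where "C' = {p \<in> topspace ?D. h p \<in> T \<inter> \<Phi> (Z (Suc N))}"
      moreover have "closedin ?D C'"
        unfolding C'_def using cont cl by (rule closedin_continuous_map_preimage)
      ultimately have "openin ?D (?L \<times> U - C')"
        by (simp add: openin_diff)
      moreover have "p \<in> ?L \<times> U - C'"
        using p U(2) by (auto simp: C_def C'_def)
      moreover have "?L \<times> U - C' \<subseteq> topspace ?D - C"
      proof
        fix q assume q: "q \<in> ?L \<times> U - C'"
        have "U \<subseteq> Z (Suc N)"
          using U(3) by (auto simp: Z_def)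
        then have "h q \<in> \<Phi> (Z (Suc N))"
          using q by (auto simp: \<Phi>_def)
        then show "q \<in> topspace ?D - C"
          using q UW by (auto simp: C_def C'_def)
      qed
      ultimately show "\<exists>T. openin ?D T \<and> p \<in> T \<and> T \<subseteq> topspace ?D - C"
        by metis
    qed
    then have "closedin ?D C"
      by (simp add: closedin_def C_def)
    then have "closedin (gtop V) (h ` C)"
      using clmap by (simp add: closed_map_def)
    then have "closedin (gtop V) ((T \<inter> \<Phi> (Z 0)) \<union> h ` C)"
      using cl[of 0] by (rule closedin_Un[rotated])
    moreover have "(T \<inter> \<Phi> (Z 0)) \<union> h ` C = T"
    proof -
      have "T \<subseteq> F \<union> h ` (?L \<times> W)"
        using T F'_eq by (simp add: \<Phi>_def)
      then show ?thesis
        unfolding Z0 C_def topD by blast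
    qed
    ultimately show "closedin (gtop V) T"
      by simp
  qed
  then have "cellular V (\<Phi> (Z 0)) F'"
    by (rule cellular_countable[where F = "\<lambda>N. \<Phi> (Z N)", rotated]) (use stage ci in simp)
  then show ?thesis
    by (simp add: Z0)
qed

end

lemma G_space_action_closed:
  assumes "G_space G X" "topspace (grp_top G) = carrier G" "g \<in> carrier G" "x \<in> points X"
  shows "gact X g x \<in> points X"
proof -
  have "(\<lambda>(g, x). gact X g x) \<in> topspace (prod_topology (grp_top G) (gtop X)) \<rightarrow> points X"
    using assms(1) by (simp add: G_space_def continuous_map_def)
  from funcset_mem[OF this, of "(g, x)"] show ?thesis
    using assms(2-4) by simp
qed

lemma G_map_image: "G_map G X Y f \<Longrightarrow> x \<in> points X \<Longrightarrow> f x \<in> points Y"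
  by (auto simp: G_map_def continuous_map_def)

section \<open>Stages of a cell complex\<close>

text \<open>
  For a closed set \<open>S\<close> in stage \<open>a\<close>, the preimage of its image in stage \<open>b\<close> is an image of \<open>S\<close> if \<open>b\<close> is later and
  a preimage of \<open>S\<close> if \<open>b\<close> is earlier.
\<close>
lemma directed_colimit_closed_embedding:
  assumes colim: "directed_colimit G r I X t Y s"
    and total: "\<And>a b. a \<in> I \<Longrightarrow> b \<in> I \<Longrightarrow> (a, b) \<in> r \<or> (b, a) \<in> r"
    and t: "\<And>a b. a \<in> I \<Longrightarrow> b \<in> I \<Longrightarrow> (a, b) \<in> r \<Longrightarrow> G_map G (X a) (X b) (t a b) \<and>
              inj_on (t a b) (points (X a)) \<and> closed_map (gtop (X a)) (gtop (X b)) (t a b)"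
    and a: "a \<in> I"
  shows "inj_on (s a) (points (X a)) \<and> closed_map (gtop (X a)) (gtop Y) (s a)"
proof
  have s: "G_map G (X b) Y (s b)" if "b \<in> I" for b
    using colim that by (simp add: directed_colimit_def)
  have st: "s c (t b c x) = s b x" if "b \<in> I" "c \<in> I" "(b, c) \<in> r" "x \<in> points (X b)" for b c x
    using colim that by (simp add: directed_colimit_def)
  have merge: "\<exists>c\<in>I. (b, c) \<in> r \<and> (d, c) \<in> r \<and> t b c x = t d c y"
    if "b \<in> I" "d \<in> I" "x \<in> points (X b)" "y \<in> points (X d)" "s b x = s d y" for b d x y
    using colim that by (simp add: directed_colimit_def)
  have opens: "openin (gtop Y) V \<longleftrightarrow> (\<forall>b\<in>I. openin (gtop (X b)) {x \<in> points (X b). s b x \<in> V})"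
    if "V \<subseteq> points Y" for V
    using colim that by (simp add: directed_colimit_def)
  have inj: "inj_on (s b) (points (X b))" if b: "b \<in> I" for b
  proof (rule inj_onI)
    fix x y assume xy: "x \<in> points (X b)" "y \<in> points (X b)" "s b x = s b y"
    then obtain c where c: "c \<in> I" "(b, c) \<in> r" "t b c x = t b c y"
      using merge[OF b b] by blast
    then show "x = y"
      using t[OF b c(1,2)] xy(1,2) by (metis inj_onD)
  qed
  show "inj_on (s a) (points (X a))"
    by (rule inj[OF a])
  show "closed_map (gtop (X a)) (gtop Y) (s a)"
    unfolding closed_map_def
  proof (intro allI impI)
    fix S assume S: "closedin (gtop (X a)) S"
    have SX: "S \<subseteq> points (X a)"
      using closedin_subset[OF S] .
    have sS: "s a ` S \<subseteq> points Y"
      using G_map_image[OF s[OF a]] SX by blast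
    have "openin (gtop (X b)) {x \<in> points (X b). s b x \<in> points Y - s a ` S}" if b: "b \<in> I" for b
    proof -
      have "closedin (gtop (X b)) {x \<in> points (X b). s b x \<in> s a ` S}"
      proof (cases "(a, b) \<in> r")
        case True
        have "{x \<in> points (X b). s b x \<in> s a ` S} = t a b ` S"
        proof
          show "t a b ` S \<subseteq> {x \<in> points (X b). s b x \<in> s a ` S}"
            using G_map_image[of G "X a" "X b" "t a b"] t[OF a b True] st[OF a b True] SX by auto
          show "{x \<in> points (X b). s b x \<in> s a ` S} \<subseteq> t a b ` S"
          proof
            fix x assume "x \<in> {x \<in> points (X b). s b x \<in> s a ` S}"
            then obtain y where y: "x \<in> points (X b)" "y \<in> S" "s b x = s a y"
              by blast
            then have "s b x = s b (t a b y)"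
              using st[OF a b True] SX by auto
            then have "x = t a b y"
              using inj_onD[OF inj[OF b]] y(1,2) SX t[OF a b True] G_map_image[of G "X a" "X b" "t a b"] by blast
            then show "x \<in> t a b ` S"
              using y(2) by blast
          qed
        qed
        then show ?thesis
          using t[OF a b True] S by (simp add: closed_map_def)
      next
        case False
        then have ba: "(b, a) \<in> r"
          using total[OF a b] by blast
        have "s b x \<in> s a ` S \<longleftrightarrow> t b a x \<in> S" if "x \<in> points (X b)" for x
          using st[OF b a ba that] inj_on_image_mem_iff[OF inj[OF a] _ SX, of "t b a x"]
            G_map_image[of G "X b" "X a" "t b a"] t[OF b a ba] that by metis
        then have "{x \<in> points (X b). s b x \<in> s a ` S} = {x \<in> points (X b). t b a x \<in> S}"
          by blast
        moreover have "continuous_map (gtop (X b)) (gtop (X a)) (t b a)"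
          using t[OF b a ba] by (simp add: G_map_def)
        ultimately show ?thesis
          using S by (simp add: closedin_continuous_map_preimage)
      qed
      then have "openin (gtop (X b)) (points (X b) - {x \<in> points (X b). s b x \<in> s a ` S})"
        by (rule openin_diff[OF openin_topspace])
      also have "points (X b) - {x \<in> points (X b). s b x \<in> s a ` S} = {x \<in> points (X b). s b x \<in> points Y - s a ` S}"
        using G_map_image[OF s[OF b]] by auto
      finally show ?thesis .
    qed
    then have "openin (gtop Y) (points Y - s a ` S)"
      by (subst opens) auto
    then show "closedin (gtop Y) (s a ` S)"
      using sS by (simp add: closedin_def)
  qed
qed

text \<open>
  Passing to an open set \<open>U\<close> preserves the colimit topology: to be closed in \<open>U\<close> means that the complement in
  \<open>U\<close> is open, and openness of that complement is tested on the stages. The map \<open>p\<close> is a closed map of the colimit into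
  the ambient space, so that the lemma also serves limit stages.
\<close>
lemma directed_colimit_detects_closed:
  assumes colim: "directed_colimit G r I X t Y u"
    and p: "continuous_map (gtop Y) Z p" "closed_map (gtop Y) Z p"
    and U: "openin Z U" and T: "T \<subseteq> p ` points Y \<inter> U"
    and cl: "\<And>b. b \<in> I \<Longrightarrow> closedin (subtopology Z U) (T \<inter> (p ` u b ` points (X b) \<inter> U))"
  shows "closedin (subtopology Z U) T"
proof -
  have u: "continuous_map (gtop (X b)) (gtop Y) (u b)" if "b \<in> I" for b
    using colim that by (simp add: directed_colimit_def G_map_def)
  have UZ: "U \<subseteq> topspace Z"
    using openin_subset[OF U] .
  let ?O = "{y \<in> points Y. p y \<in> U - T}"
  have "openin (gtop (X b)) {x \<in> points (X b). u b x \<in> ?O}" if b: "b \<in> I" for b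
  proof -
    let ?S = "T \<inter> (p ` u b ` points (X b) \<inter> U)"
    have "openin (subtopology Z U) (topspace (subtopology Z U) - ?S)"
      using cl[OF b] by blast
    then have "openin Z (U - ?S)"
      using UZ openin_open_subtopology[OF U] by (simp add: Int_absorb1)
    moreover have "continuous_map (gtop (X b)) Z (p \<circ> u b)"
      using u[OF b] p(1) by (rule continuous_map_compose)
    ultimately have "openin (gtop (X b)) {x \<in> points (X b). (p \<circ> u b) x \<in> U - ?S}"
      by (rule openin_continuous_map_preimage[rotated])
    also have "{x \<in> points (X b). (p \<circ> u b) x \<in> U - ?S} = {x \<in> points (X b). u b x \<in> ?O}"
      using continuous_map_image_subset_topspace[OF u[OF b]] by auto
    finally show ?thesis .
  qed
  moreover have "openin (gtop Y) ?O \<longleftrightarrow> (\<forall>b\<in>I. openin (gtop (X b)) {x \<in> points (X b). u b x \<in> ?O})"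
    using colim unfolding directed_colimit_def by (elim conjE) (erule allE[of _ ?O], simp)
  ultimately have "openin (gtop Y) ?O"
    by blast
  then have "closedin Z (p ` (points Y - ?O))"
    using p(2) by (simp add: closed_map_def openin_closedin_eq)
  moreover have "T = p ` (points Y - ?O) \<inter> U"
    using T by auto
  ultimately show ?thesis
    unfolding closedin_subtopology by blast
qed

context cell_family begin

text \<open>What attaching a cell means for points and closed sets, read off from the gluing relation.\<close>
lemma pushout_of_generating_cofibrationE:
  assumes "pushout_of_generating_cofibration G \<C> X Y j"
  obtains n H h where "H \<in> \<C>" "G_map G (orbit_times G H (disc n)) Y h"
    "inj_on j (points X)" "closed_map (gtop X) (gtop Y) j"
    "h ` ((lcosets H) \<times> topspace (disc_boundary n)) \<subseteq> j ` points X"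
    "bij_betw h ((lcosets H) \<times> (topspace (disc n) - topspace (disc_boundary n))) (points Y - j ` points X)"
proof -
  obtain n H f h where H: "H \<in> \<C>" and
    po: "pushout G (orbit_times G H (disc_boundary n)) (orbit_times G H (disc n)) X Y id f h j"
    using assms unfolding pushout_of_generating_cofibration_def by blast
  define A where "A = orbit_times G H (disc_boundary n)"
  define D where "D = orbit_times G H (disc n)"
  have pA: "points A = (lcosets H) \<times> topspace (disc_boundary n)"
    and pD: "points D = (lcosets H) \<times> topspace (disc n)"
    by (simp_all add: A_def D_def)
  have AD: "points A \<subseteq> points D"
    unfolding pA pD using disc_boundary_subset by blast
  have maps: "G_map G A D id" "G_map G A X f" "G_map G D Y h" "G_map G X Y j"
    and surj: "case_sum j h ` (points X <+> points D) = points Y"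
    and kernel: "\<And>p q. p \<in> points X <+> points D \<Longrightarrow> q \<in> points X <+> points D \<Longrightarrow>
        case_sum j h p = case_sum j h q \<longleftrightarrow> (p, q) \<in> glue A id f"
    and opens: "\<And>V. V \<subseteq> points Y \<Longrightarrow> openin (gtop Y) V \<longleftrightarrow>
        openin (gtop X) {x \<in> points X. j x \<in> V} \<and> openin (gtop D) {b \<in> points D. h b \<in> V}"
    using po unfolding pushout_def A_def[symmetric] D_def[symmetric] by simp_all
  have inj: "inj_on j (points X)"
  proof (rule inj_onI)
    fix x y assume "x \<in> points X" "y \<in> points X" "j x = j y"
    then show "x = y"
      using kernel[of "Inl x" "Inl y"] by (simp add: glue_id_iff InlI InrI)
  qed
  have hA: "h b = j (f b)" "f b \<in> points X" if "b \<in> points A" for b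
  proof -
    show fb: "f b \<in> points X"
      by (rule G_map_image[OF maps(2) that])
    show "h b = j (f b)"
      using kernel[of "Inr b" "Inl (f b)"] fb that AD by (auto simp: glue_id_iff InlI InrI)
  qed
  have interior: "h b \<notin> j ` points X" if "b \<in> points D - points A" for b
  proof
    assume "h b \<in> j ` points X"
    then obtain x where "x \<in> points X" "h b = j x"
      by blast
    then show False
      using kernel[of "Inr b" "Inl x"] that by (simp add: glue_id_iff InlI InrI)
  qed
  have inj_int: "inj_on h (points D - points A)"
  proof (rule inj_onI)
    fix b c assume "b \<in> points D - points A" "c \<in> points D - points A" "h b = h c"
    then show "b = c"
      using kernel[of "Inr b" "Inr c"] by (simp add: glue_id_iff InlI InrI)
  qed
  have bd: "h ` points A \<subseteq> j ` points X"
    using hA by auto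
  have D_image: "h ` points D = h ` (points D - points A) \<union> h ` points A"
    using AD by (metis Diff_partition Un_commute image_Un)
  have "points Y = j ` points X \<union> h ` points D"
    unfolding surj[symmetric] by (auto simp: Plus_def image_Un image_image)
  also have "\<dots> = j ` points X \<union> h ` (points D - points A)"
    using bd unfolding D_image by blast
  finally have "points Y - j ` points X = h ` (points D - points A) - j ` points X"
    by (simp add: Un_Diff)
  moreover have "h ` (points D - points A) \<inter> j ` points X = {}"
    using interior by auto
  ultimately have "h ` (points D - points A) = points Y - j ` points X"
    by (simp add: Diff_triv)
  then have bij: "bij_betw h (points D - points A) (points Y - j ` points X)"
    using inj_int by (simp add: bij_betw_def)
  have cl: "closed_map (gtop X) (gtop Y) j"
    unfolding closed_map_def
  proof (intro allI impI)
    fix S assume S: "closedin (gtop X) S"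
    have SX: "S \<subseteq> points X"
      using closedin_subset[OF S] .
    have jS: "j ` S \<subseteq> points Y"
      using G_map_image[OF maps(4)] SX by blast
    have jmem: "j x \<in> j ` S \<longleftrightarrow> x \<in> S" if "x \<in> points X" for x
      using inj_on_image_mem_iff[OF inj that SX] .
    have "{x \<in> points X. j x \<in> points Y - j ` S} = points X - S"
      using G_map_image[OF maps(4)] jmem SX by auto
    then have o1: "openin (gtop X) {x \<in> points X. j x \<in> points Y - j ` S}"
      using S by (simp add: closedin_def)
    have "closedin (gtop A) {a \<in> points A. f a \<in> S}"
      by (rule closedin_continuous_map_preimage[OF _ S]) (use maps(2) in \<open>simp add: G_map_def\<close>)
    moreover have "closed_map (gtop A) (gtop D) id"
      using maps(1) compact_Hausdorff_orbit_times(1)[OF subgroups[OF H] closed_subgroups[OF H], of "disc_boundary n"]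
        compact_Hausdorff_orbit_times(2)[OF subgroups[OF H] closed_subgroups[OF H], of "disc n"]
      by (intro continuous_imp_closed_map) (auto simp: G_map_def A_def D_def)
    ultimately have "closedin (gtop D) (id ` {a \<in> points A. f a \<in> S})"
      unfolding closed_map_def by blast
    moreover have "points D - id ` {a \<in> points A. f a \<in> S} = {b \<in> points D. h b \<in> points Y - j ` S}"
    proof -
      have "h b \<in> j ` S \<longleftrightarrow> b \<in> points A \<and> f b \<in> S" if b: "b \<in> points D" for b
      proof (cases "b \<in> points A")
        case True
        then show ?thesis
          using hA[OF True] jmem by simp
      next
        case False
        then show ?thesis
          using interior[of b] b SX by blast
      qed
      then show ?thesis
        using G_map_image[OF maps(3)] by auto
    qed
    ultimately have o2: "openin (gtop D) {b \<in> points D. h b \<in> points Y - j ` S}"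
      using openin_diff[OF openin_topspace, of "gtop D" "id ` {a \<in> points A. f a \<in> S}"] by simp
    have "openin (gtop Y) (points Y - j ` S)"
      using o1 o2 by (subst opens) auto
    then show "closedin (gtop Y) (j ` S)"
      using jS by (simp add: closedin_def)
  qed
  have "points D - points A = (lcosets H) \<times> (topspace (disc n) - topspace (disc_boundary n))"
    unfolding pA pD by blast
  then show ?thesis
    using that[OF H, of n h] maps(3) inj cl bd bij by (simp add: pA D_def)
qed

text \<open>By transfinite induction on \<open>b\<close>, for all \<open>a\<close> at once.\<close>
lemma cell_sequence_closed_embedding:
  assumes seq: "cell_sequence G \<C> r X t" and ab: "(a, b) \<in> r"
  shows "inj_on (t a b) (points (X a)) \<and> closed_map (gtop (X a)) (gtop (X b)) (t a b)"
proof (rule ccontr)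
  let ?P = "\<lambda>a b. inj_on (t a b) (points (X a)) \<and> closed_map (gtop (X a)) (gtop (X b)) (t a b)"
  have wo: "Well_order r"
    and G_maps: "\<And>a b. (a, b) \<in> r \<Longrightarrow> G_map G (X a) (X b) (t a b)"
    and ident: "\<And>a x. a \<in> Field r \<Longrightarrow> x \<in> points (X a) \<Longrightarrow> t a a x = x"
    and comp: "\<And>a b c x. (a, b) \<in> r \<Longrightarrow> (b, c) \<in> r \<Longrightarrow> x \<in> points (X a) \<Longrightarrow> t b c (t a b x) = t a c x"
    and succ: "\<And>a b. immediate_succ r a b \<Longrightarrow> pushout_of_generating_cofibration G \<C> (X a) (X b) (t a b)"
    and limit: "\<And>b. limit_index r b \<Longrightarrow> directed_colimit G r (underS r b) X t (X b) (\<lambda>a. t a b)"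
    using seq unfolding cell_sequence_def by blast+
  define S where "S = {b. \<exists>a. (a, b) \<in> r \<and> \<not> ?P a b}"
  assume "\<not> ?P a b"
  then have "S \<subseteq> Field r" "S \<noteq> {}"
    using ab unfolding S_def by (auto simp: Field_def)
  from Well_order_least[OF wo this]
  obtain m where m: "m \<in> S" "\<And>b. b \<in> S \<Longrightarrow> (m, b) \<in> r"
    by blast
  obtain d where d: "(d, m) \<in> r" "\<not> ?P d m"
    using m(1) unfolding S_def by blast
  have fields: "d \<in> Field r" "m \<in> Field r"
    using d(1) by (auto simp: Field_def)
  have below: "?P a c" if "c \<in> underS r m" "(a, c) \<in> r" for a c
  proof (rule ccontr)
    assume "\<not> ?P a c"
    then have "(m, c) \<in> r"
      using m(2) that(2) unfolding S_def by blast
    then show False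
      using Well_order_underS_asym[OF wo that(1)] by blast
  qed
  have "d \<noteq> m"
  proof
    assume "d = m"
    have "inj_on (t m m) (points (X m))"
      using ident[OF fields(2)] by (simp add: inj_on_def)
    moreover have "t m m ` S = S" if "closedin (gtop (X m)) S" for S
      using ident[OF fields(2)] closedin_subset[OF that] by force
    then have "closed_map (gtop (X m)) (gtop (X m)) (t m m)"
      by (simp add: closed_map_def)
    ultimately show False
      using d(2) \<open>d = m\<close> by simp
  qed
  then have dm: "d \<in> underS r m"
    using d(1) by (simp add: underS_def)
  show False
  proof (cases "\<exists>c. immediate_succ r c m")
    case True
    then obtain c where c: "immediate_succ r c m"
      by blast
    then have "underS r m = under r c" "c \<in> Field r"
      by (simp_all add: immediate_succ_def)
    moreover have "(c, c) \<in> r"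
      using wo \<open>c \<in> Field r\<close> by (simp add: well_order_on_def linear_order_on_def partial_order_on_def preorder_on_def refl_on_def)
    ultimately have cm: "c \<in> underS r m" and dc: "(d, c) \<in> r"
      using dm by (auto simp: under_def)
    have cmr: "(c, m) \<in> r"
      using cm by (simp add: underS_def)
    have P1: "?P d c"
      by (rule below[OF cm dc])
    have P2: "?P c m"
      by (rule pushout_of_generating_cofibrationE[OF succ[OF c]]) simp
    have comp': "t d m x = (t c m \<circ> t d c) x" if "x \<in> points (X d)" for x
      using comp[OF dc cmr that] by simp
    have "t d c ` points (X d) \<subseteq> points (X c)"
      using G_map_image[OF G_maps[OF dc]] by blast
    then have "inj_on (t c m \<circ> t d c) (points (X d))"
      using P1 P2 by (meson comp_inj_on inj_on_subset)
    then have "inj_on (t d m) (points (X d))"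
      using comp' inj_on_cong by blast
    moreover have "closed_map (gtop (X d)) (gtop (X m)) (t c m \<circ> t d c)"
      using P1 P2 closed_map_compose by blast
    then have "closed_map (gtop (X d)) (gtop (X m)) (t d m)"
      using comp' by (metis closed_map_eq)
    ultimately show False
      using d(2) by blast
  next
    case False
    then have "limit_index r m"
      using fields(2) dm by (auto simp: limit_index_def)
    moreover have "(a, b) \<in> r \<or> (b, a) \<in> r" if "a \<in> underS r m" "b \<in> underS r m" for a b
    proof -
      have "a \<in> Field r" "b \<in> Field r"
        using that by (auto simp: underS_def Field_def)
      then show ?thesis
        using wo by (cases "a = b") (auto simp: well_order_on_def linear_order_on_def total_on_def
            partial_order_on_def preorder_on_def refl_on_def)
    qed
    ultimately have "?P d m"
      using below G_maps dm by (intro directed_colimit_closed_embedding[OF limit]) auto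
    then show False
      using d(2) by blast
  qed
qed

end

context cell_family begin

section \<open>Open subspaces of cell complexes\<close>

text \<open>
  By transitivity of \<open>G\<close> on \<open>G/H\<close>, whether \<open>k (c, y)\<close> lies in the invariant set \<open>U\<close> does not depend on \<open>c\<close>. So the
  part of the cell over \<open>U\<close> is \<open>G/H \<times> W\<close>, where \<open>W\<close> is read off at the base coset \<open>c\<^sub>0\<close>, and \<open>k\<close> restricts to a closed map
  from it to \<open>U\<close>.
\<close>
lemma cellular_open_part_of_cell:
  assumes B: "G_space G B" and H: "H \<in> \<C>" and h: "G_map G (orbit_times G H (disc n)) B h"
    and U: "openin (gtop B) U" "G_invariant G B U"
    and F: "closedin (gtop B) F" "G_invariant G B F" and sub: "F \<subseteq> F'"
    and bd: "h ` ((lcosets H) \<times> topspace (disc_boundary n)) \<subseteq> F"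
    and bij: "bij_betw h ((lcosets H) \<times> (topspace (disc n) - topspace (disc_boundary n))) (F' - F)"
  shows "cellular (G_subspace B U) (F \<inter> U) (F' \<inter> U)"
proof -
  let ?L = "lcosets H" and ?O = "orbit_topology G H"
  let ?D = "topspace (disc n)" and ?S = "topspace (disc_boundary n)"
  have subH: "subgroup H G" and clH: "closedin (grp_top G) H"
    using subgroups[OF H] closed_subgroups[OF H] .
  define k where "k = (\<lambda>p :: 'g set \<times> (nat \<Rightarrow> real). h (fst p, round_off n (snd p)))"
  have ro: "round_off n y \<in> ?D" if "y \<in> cube n" for y
    using homeomorphism_disc_cube[of n] that unfolding homeomorphism_def by blast
  have sr: "square_up n (round_off n y) = y" if "y \<in> cube n" for y
    using homeomorphism_disc_cube[of n] that unfolding homeomorphism_def by blast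
  have ro_bd: "round_off n y \<in> ?S \<longleftrightarrow> y \<in> cube_boundary n" if "y \<in> cube n" for y
    using square_up_boundary[OF ro[OF that]] sr[OF that] by simp
  have "continuous_map (top_of_set (cube n)) (disc n) (round_off n)"
    using homeomorphism_disc_cube[of n] unfolding disc_top_of_set homeomorphism_def
    using ro by (auto simp: topspace_disc)
  then have "continuous_map (prod_topology ?O (top_of_set (cube n))) (prod_topology ?O (disc n))
      (\<lambda>p. (fst p, round_off n (snd p)))"
    by (intro continuous_map_pairedI continuous_map_fst continuous_map_compose[OF continuous_map_snd, unfolded o_def])
  moreover have "continuous_map (prod_topology ?O (disc n)) (gtop B) h"
    using h by (simp add: G_map_def orbit_times_def)
  ultimately have kc: "continuous_map (prod_topology ?O (top_of_set (cube n))) (gtop B) k"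
    unfolding k_def by (rule continuous_map_compose[unfolded o_def])
  have k_equiv: "k (g <#\<^bsub>G\<^esub> c, y) = gact B g (k (c, y))"
    if "g \<in> carrier G" "c \<in> ?L" "y \<in> cube n" for g c y
  proof -
    have "h (gact (orbit_times G H (disc n)) g (c, round_off n y)) = gact B g (h (c, round_off n y))"
      using h that(1,2) ro[OF that(3)] by (simp add: G_map_def)
    then show ?thesis
      by (simp add: k_def orbit_times_def)
  qed
  have "compact_space (prod_topology ?O (top_of_set (cube n)))" "Hausdorff_space (prod_topology ?O (top_of_set (cube n)))"
    using compact_Hausdorff_orbit_times[OF subH clH, of "top_of_set (cube n)"] compact_cube
    by (simp_all add: orbit_times_def compact_space_subtopology Hausdorff_space_subtopology)
  then have k_closed: "closed_map (prod_topology ?O (top_of_set (cube n))) (gtop B) k"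
    using B kc by (intro weak_Hausdorff_closed_map) (simp_all add: G_space_def CGWH_def)
  define c\<^sub>0 where "c\<^sub>0 = \<one> <#\<^bsub>G\<^esub> H"
  have c\<^sub>0: "c\<^sub>0 \<in> ?L"
    unfolding c\<^sub>0_def LCOSETS_def by blast
  define W where "W = {y \<in> cube n. k (c\<^sub>0, y) \<in> U}"
  have kU: "k (c, y) \<in> U \<longleftrightarrow> y \<in> W" if c: "c \<in> ?L" and y: "y \<in> cube n" for c y
  proof -
    have "k (d, y) \<in> U" if ke: "k (e, y) \<in> U" and d: "d \<in> ?L" and e: "e \<in> ?L" for d e
    proof -
      obtain g where g: "g \<in> carrier G" "g <#\<^bsub>G\<^esub> e = d"
        using coset_transitive[OF subH e d] .
      then show ?thesis
        using k_equiv[OF g(1) e y] U(2) ke by (simp add: G_invariant_def)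
    qed
    then show ?thesis
      using c c\<^sub>0 y unfolding W_def by blast
  qed
  have Wc: "W \<subseteq> cube n"
    by (auto simp: W_def)
  have W: "openin (top_of_set (cube n)) W"
  proof -
    have "continuous_map (top_of_set (cube n)) (prod_topology ?O (top_of_set (cube n))) (\<lambda>y. (c\<^sub>0, y))"
      using c\<^sub>0 by (intro continuous_map_pairedI) auto
    then have "continuous_map (top_of_set (cube n)) (gtop B) (\<lambda>y. k (c\<^sub>0, y))"
      using kc by (rule continuous_map_compose[unfolded o_def])
    from openin_continuous_map_preimage[OF this U(1)] show ?thesis
      by (simp add: W_def)
  qed
  have preimage: "{p \<in> topspace (prod_topology ?O (top_of_set (cube n))). k p \<in> U} = ?L \<times> W"
    using kU Wc by auto
  have topW: "subtopology (prod_topology ?O (top_of_set (cube n))) (?L \<times> W) = prod_topology ?O (top_of_set W)"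
  proof -
    have "subtopology ?O ?L = ?O"
      by (metis subtopology_topspace topspace_orbit_topology)
    then show ?thesis
      unfolding subtopology_Times using Wc by (simp add: subtopology_subtopology Int_absorb1)
  qed
  have hk: "h (c, v) = k (c, square_up n v)" if "v \<in> ?D" for c v
    using homeomorphism_disc_cube[of n] that by (simp add: k_def homeomorphism_def)
  have k_bij: "bij_betw k (?L \<times> (cube n - cube_boundary n)) (F' - F)"
  proof -
    have "bij_betw (\<lambda>p. (fst p, round_off n (snd p))) (?L \<times> (cube n - cube_boundary n)) (?L \<times> (?D - ?S))"
    proof (rule bij_betw_byWitness[where f' = "\<lambda>p. (fst p, square_up n (snd p))"])
      show "(\<lambda>p. (fst p, round_off n (snd p))) ` (?L \<times> (cube n - cube_boundary n)) \<subseteq> ?L \<times> (?D - ?S)"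
        using ro ro_bd by auto
      show "(\<lambda>p. (fst p, square_up n (snd p))) ` (?L \<times> (?D - ?S)) \<subseteq> ?L \<times> (cube n - cube_boundary n)"
        using homeomorphism_disc_cube[of n] square_up_boundary[of _ n] by (auto simp: homeomorphism_def)
    qed (use homeomorphism_disc_cube[of n] in \<open>auto simp: homeomorphism_def\<close>)
    from bij_betw_trans[OF this bij] show ?thesis
      by (simp add: k_def o_def)
  qed
  show ?thesis
  proof (rule cellular_open_subset_of_cell[where h = k and W = W and n = n, OF _ H W])
    show "G_space G (G_subspace B U)"
      using B U by (intro G_space_open_subspace) auto
    show "continuous_map (prod_topology ?O (top_of_set W)) (gtop (G_subspace B U)) k"
      using kc preimage unfolding topW[symmetric]
      by (auto simp: continuous_map_in_subtopology continuous_map_from_subtopology)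
    show "k (g <#\<^bsub>G\<^esub> c, x) = gact (G_subspace B U) g (k (c, x))"
      if "g \<in> carrier G" "c \<in> ?L" "x \<in> W" for g c x
      using k_equiv[OF that(1,2)] that(3) Wc by auto
    show "closed_map (prod_topology ?O (top_of_set W)) (gtop (G_subspace B U)) k"
      using closed_map_restriction[OF k_closed preimage] unfolding topW by simp
    show "closedin (gtop (G_subspace B U)) (F \<inter> U)"
      using F(1) by (auto simp: closedin_subtopology)
    show "G_invariant G (G_subspace B U) (F \<inter> U)"
      using F(2) U(2) by (simp add: G_invariant_def)
    show "F \<inter> U \<subseteq> F' \<inter> U"
      using sub by blast
    show "k ` (?L \<times> (W \<inter> cube_boundary n)) \<subseteq> F \<inter> U"
    proof clarify
      fix c y assume cy: "c \<in> ?L" "y \<in> W" "y \<in> cube_boundary n"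
      then have y: "y \<in> cube n"
        using Wc by blast
      then have "(c, round_off n y) \<in> ?L \<times> ?S"
        using ro_bd cy by simp
      then have "k (c, y) \<in> F"
        using bd unfolding k_def by auto
      then show "k (c, y) \<in> F \<inter> U"
        using kU[OF cy(1) y] cy(2) by simp
    qed
    show "bij_betw k (?L \<times> (W - cube_boundary n)) (F' \<inter> U - F \<inter> U)"
    proof (rule bij_betw_imageI)
      show "inj_on k (?L \<times> (W - cube_boundary n))"
        by (rule inj_on_subset[OF bij_betw_imp_inj_on[OF k_bij]]) (use Wc in auto)
      show "k ` (?L \<times> (W - cube_boundary n)) = F' \<inter> U - F \<inter> U"
      proof
        show "k ` (?L \<times> (W - cube_boundary n)) \<subseteq> F' \<inter> U - F \<inter> U"
          using bij_betwE[OF k_bij] kU Wc by auto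
        show "F' \<inter> U - F \<inter> U \<subseteq> k ` (?L \<times> (W - cube_boundary n))"
        proof
          fix z assume z: "z \<in> F' \<inter> U - F \<inter> U"
          then have "z \<in> k ` (?L \<times> (cube n - cube_boundary n))"
            using bij_betw_imp_surj_on[OF k_bij] by auto
          then obtain c y where cy: "c \<in> ?L" "y \<in> cube n - cube_boundary n" "z = k (c, y)"
            by auto
          then have "y \<in> W"
            using kU[of c y] z by simp
          then show "z \<in> k ` (?L \<times> (W - cube_boundary n))"
            using cy by auto
        qed
      qed
    qed
  qed
qed

text \<open>
  The images \<open>S a\<close> of the stages are closed in \<open>B\<close>. Cutting them down to \<open>U\<close> gives a sequence whose
  successor steps are open parts of single cells.
\<close>
lemma cellular_open_in_cell_complex:
  fixes A B :: "('g, 'b) gspace"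
  assumes complex: "relative_cell_complex G \<C> A B j" and A: "points A = {}"
    and U: "openin (gtop B) U" "G_invariant G B U"
  shows "cellular (G_subspace B U) {} U"
proof -
  obtain r :: "('b \<times> nat) rel" and X t s z where
    seq: "cell_sequence G \<C> r X t" and z: "z \<in> Field r" "\<forall>a\<in>Field r. (z, a) \<in> r" and Az: "A = X z"
    and colim: "directed_colimit G r (Field r) X t B s"
    using complex unfolding relative_cell_complex_def by (elim exE conjE) (rule that)
  let ?V = "G_subspace B U"
  have wo: "Well_order r"
    and G_maps: "\<And>a b. (a, b) \<in> r \<Longrightarrow> G_map G (X a) (X b) (t a b)"
    and succ: "\<And>a b. immediate_succ r a b \<Longrightarrow> pushout_of_generating_cofibration G \<C> (X a) (X b) (t a b)"
    and limit: "\<And>b. limit_index r b \<Longrightarrow> directed_colimit G r (underS r b) X t (X b) (\<lambda>a. t a b)"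
    using seq unfolding cell_sequence_def by blast+
  have s: "G_map G (X a) B (s a)" if "a \<in> Field r" for a
    using colim that by (simp add: directed_colimit_def)
  have B: "G_space G B"
    using s[OF z(1)] by (simp add: G_map_def)
  have st: "s b (t a b x) = s a x" if "(a, b) \<in> r" "x \<in> points (X a)" for a b x
    using colim that FieldI1[OF that(1)] FieldI2[OF that(1)] by (simp add: directed_colimit_def)
  have union: "(\<Union>a\<in>Field r. s a ` points (X a)) = points B"
    using colim by (simp add: directed_colimit_def)
  have total: "(a, b) \<in> r \<or> (b, a) \<in> r" if "a \<in> Field r" "b \<in> Field r" for a b
    using wo that by (cases "a = b") (auto simp: well_order_on_def linear_order_on_def total_on_def
        partial_order_on_def preorder_on_def refl_on_def)
  have emb: "inj_on (s a) (points (X a)) \<and> closed_map (gtop (X a)) (gtop B) (s a)" if "a \<in> Field r" for a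
    using total G_maps cell_sequence_closed_embedding[OF seq]
    by (intro directed_colimit_closed_embedding[OF colim _ _ that]) auto
  have UB: "U \<subseteq> points B"
    using openin_subset[OF U(1)] .
  define S where "S = (\<lambda>a. s a ` points (X a))"
  define F where "F = (\<lambda>a. S a \<inter> U)"
  have S_mono: "S a \<subseteq> S b" if "(a, b) \<in> r" for a b
  proof
    fix y assume "y \<in> S a"
    then obtain x where "x \<in> points (X a)" "y = s a x"
      unfolding S_def by blast
    then have "y = s b (t a b x)" "t a b x \<in> points (X b)"
      using st[OF that] G_map_image[OF G_maps[OF that]] by auto
    then show "y \<in> S b"
      unfolding S_def by blast
  qed
  have S_closed: "closedin (gtop B) (S a)" if "a \<in> Field r" for a
    using emb[OF that] by (simp add: closed_map_def S_def)
  have S_inv: "G_invariant G B (S a)" if "a \<in> Field r" for a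
    unfolding S_def
  proof (rule G_map_invariant_image[OF s[OF that]])
    show "G_invariant G (X a) (points (X a))"
      using G_space_action_closed[of G "X a"] s[OF that] by (simp add: G_invariant_def G_map_def)
  qed simp
  have underS_Field: "b \<in> Field r \<and> (b, a) \<in> r" if "b \<in> underS r a" for a b
    using that by (auto simp: underS_def Field_def)
  have Fz: "F z = {}"
    using A Az by (simp add: F_def S_def)
  have "cellular ?V (F z) U"
  proof (rule cellular_transfinite[OF wo z(1)])
    show "(z, a) \<in> r" if "a \<in> Field r" for a
      using z(2) that by blast
    show "closedin (gtop ?V) (F z)" "G_invariant G ?V (F z)"
      by (simp_all add: Fz G_invariant_def)
    show "F a \<subseteq> F b" if "(a, b) \<in> r" for a b
      using S_mono[OF that] by (auto simp: F_def)
    show "coherent ?V (F ` Field r) U"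
      unfolding coherent_def
    proof (intro conjI allI impI)
      show "\<Union>(F ` Field r) = U"
        using union UB by (auto simp: F_def S_def)
      fix T assume T: "T \<subseteq> U" "\<forall>E\<in>F ` Field r. closedin (gtop ?V) (T \<inter> E)"
      have "closedin (subtopology (gtop B) U) T"
      proof (rule directed_colimit_detects_closed[OF colim, where p = id])
        show "T \<subseteq> id ` points B \<inter> U"
          using T(1) UB by auto
        show "closedin (subtopology (gtop B) U) (T \<inter> (id ` s b ` points (X b) \<inter> U))" if "b \<in> Field r" for b
          using T(2) that by (simp add: F_def S_def)
      qed (use U in \<open>simp_all add: closed_map_def\<close>)
      then show "closedin (gtop ?V) T"
        by simp
    qed
    fix a assume a: "a \<in> Field r" "a \<noteq> z"
    then have z_under: "z \<in> underS r a"
      using z by (simp add: underS_def)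
    show "(\<exists>b\<in>underS r a. cellular ?V (F b) (F a) \<and> (\<forall>c\<in>underS r a. F c \<subseteq> F b)) \<or>
          coherent ?V (F ` underS r a) (F a)"
    proof (cases "\<exists>c. immediate_succ r c a")
      case True
      then obtain c where c: "immediate_succ r c a"
        by blast
      then have cr: "underS r a = under r c" "c \<in> Field r"
        by (simp_all add: immediate_succ_def)
      then have "c \<in> underS r a"
        using total[OF cr(2) cr(2)] by (simp add: under_def)
      then have car: "(c, a) \<in> r"
        using underS_Field by blast
      have "\<forall>d\<in>underS r a. F d \<subseteq> F c"
        using S_mono unfolding cr(1) under_def F_def by blast
      moreover have "cellular ?V (F c) (F a)"
      proof -
        obtain n H h where h: "H \<in> \<C>" "G_map G (orbit_times G H (disc n)) (X a) h"
          "h ` ((lcosets H) \<times> topspace (disc_boundary n)) \<subseteq> t c a ` points (X c)"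
          "bij_betw h ((lcosets H) \<times> (topspace (disc n) - topspace (disc_boundary n)))
             (points (X a) - t c a ` points (X c))"
          by (rule pushout_of_generating_cofibrationE[OF succ[OF c]])
        have stc: "s a ` t c a ` points (X c) = S c"
          using st[OF car] by (auto simp: S_def image_image)
        have tX: "t c a ` points (X c) \<subseteq> points (X a)"
          using G_map_image[OF G_maps[OF car]] by blast
        have "s a ` (points (X a) - t c a ` points (X c)) = S a - S c"
          using inj_on_image_set_diff[OF conjunct1[OF emb[OF a(1)]] Diff_subset tX] stc
          by (simp add: S_def)
        then have "bij_betw (s a) (points (X a) - t c a ` points (X c)) (S a - S c)"
          by (intro bij_betw_imageI inj_on_subset[OF conjunct1[OF emb[OF a(1)]] Diff_subset])
        then have bij: "bij_betw (s a \<circ> h) ((lcosets H) \<times> (topspace (disc n) - topspace (disc_boundary n))) (S a - S c)"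
          by (rule bij_betw_trans[OF h(4)])
        have bd: "(s a \<circ> h) ` ((lcosets H) \<times> topspace (disc_boundary n)) \<subseteq> S c"
          using image_mono[OF h(3), of "s a"] stc by (simp add: image_comp)
        show ?thesis
          unfolding F_def
          by (rule cellular_open_part_of_cell[OF B h(1) G_map_compose[OF h(2) s[OF a(1)]] U
                S_closed[OF cr(2)] S_inv[OF cr(2)] S_mono[OF car] bd bij])
      qed
      ultimately show ?thesis
        using \<open>c \<in> underS r a\<close> by blast
    next
      case False
      then have "limit_index r a"
        using a(1) z_under by (auto simp: limit_index_def)
      then have lim: "directed_colimit G r (underS r a) X t (X a) (\<lambda>b. t b a)"
        by (rule limit)
      have "(\<Union>b\<in>underS r a. t b a ` points (X b)) = points (X a)"
        using lim by (simp add: directed_colimit_def)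
      then have "S a = (\<Union>b\<in>underS r a. s a ` t b a ` points (X b))"
        unfolding S_def by (metis image_UN)
      moreover have st': "s a ` t b a ` points (X b) = S b" if "b \<in> underS r a" for b
        using st underS_Field[OF that] by (auto simp: S_def image_image)
      ultimately have SU: "S a = (\<Union>b\<in>underS r a. S b)"
        by simp
      have "coherent ?V (F ` underS r a) (F a)"
        unfolding coherent_def
      proof (intro conjI allI impI)
        show "\<Union>(F ` underS r a) = F a"
          using SU by (auto simp: F_def)
        fix T assume T: "T \<subseteq> F a" "\<forall>E\<in>F ` underS r a. closedin (gtop ?V) (T \<inter> E)"
        have "closedin (subtopology (gtop B) U) T"
        proof (rule directed_colimit_detects_closed[OF lim, where p = "s a"])
          show "continuous_map (gtop (X a)) (gtop B) (s a)" "closed_map (gtop (X a)) (gtop B) (s a)"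
            using s[OF a(1)] emb[OF a(1)] by (simp_all add: G_map_def)
          show "openin (gtop B) U"
            by (rule U(1))
          show "T \<subseteq> s a ` points (X a) \<inter> U"
            using T(1) by (simp add: F_def S_def)
          show "closedin (subtopology (gtop B) U) (T \<inter> (s a ` t b a ` points (X b) \<inter> U))"
            if "b \<in> underS r a" for b
            using T(2) that by (simp add: st' F_def)
        qed
        then show "closedin (gtop ?V) T"
          by simp
      qed
      then show ?thesis ..
    qed
  qed
  then show ?thesis
    by (simp add: Fz)
qed

end

lemma continuous_map_from_empty: "topspace X = {} \<Longrightarrow> continuous_map X Y f"
  by (simp add: continuous_map_def)

lemma G_space_empty: "G_space G empty_G_space"
proof -
  have "CGWH (discrete_topology {})"
    by (rule CGWH_compact_Hausdorff) (auto simp: compact_space_def)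
  then show ?thesis
    by (simp add: G_space_def empty_G_space_def continuous_map_from_empty)
qed

lemma G_map_from_empty:
  assumes "G_space G X" "G_space G Y" "points X = {}"
  shows "G_map G X Y f"
  using assms by (simp add: G_map_def continuous_map_from_empty)

theorem corollary2p5:
  fixes G :: "'g top_group"
    and \<C> :: "'g set set"
    and X :: "('g, 'a) gspace"
    and U :: "'a set"
  assumes "compact_Lie_group G"
    and "\<And>H. H \<in> \<C> \<Longrightarrow> subgroup H G \<and> closedin (grp_top G) H"
    and "closed_under_conjugacy G \<C>"
    and "G_space G X"
    and "C_cofibrant TYPE('u) G \<C> X"
    and "openin (gtop X) U"
    and "G_invariant G X U"
  shows "C_cofibrant TYPE('u) G \<C> (G_subspace X U)"
proof -
  have top: "topological_group G" "Hausdorff_space (grp_top G)" "compact_space (grp_top G)"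
    using assms(1) by (auto simp: compact_Lie_group_def Lie_group_def)
  interpret group G
    using top(1) by (simp add: topological_group_def)
  interpret cell_family G \<C>
    by (intro cell_family.intro cell_family_axioms.intro compact_top_group.intro compact_top_group_axioms.intro
        is_group top conjunct1[OF assms(2)] conjunct2[OF assms(2)])
  obtain A B :: "('g, 'u) gspace" and j where complex: "relative_cell_complex G \<C> A B j"
    and retract: "retract_of_map G (empty_G_space :: ('g, 'a) gspace) X id A B j"
    using assms(5) unfolding C_cofibrant_def C_cofibration_def by blast
  obtain r\<^sub>1 i r where r\<^sub>1: "G_map G A (empty_G_space :: ('g, 'a) gspace) r\<^sub>1"
    and i: "G_map G X B i" and r: "G_map G B X r" and ri: "\<And>x. x \<in> points X \<Longrightarrow> r (i x) = x"
    using retract unfolding retract_of_map_def by blast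
  have "x \<notin> points A" for x
    using G_map_image[OF r\<^sub>1, of x] by (auto simp: empty_G_space_def)
  then have A: "points A = {}"
    by blast
  have B: "G_space G B"
    using r by (simp add: G_map_def)
  define W where "W = {b \<in> points B. r b \<in> U}"
  have W: "openin (gtop B) W"
    unfolding W_def by (rule openin_continuous_map_preimage[OF _ assms(6)]) (use r in \<open>simp add: G_map_def\<close>)
  have W_inv: "G_invariant G B W"
    unfolding G_invariant_def
  proof (intro ballI)
    fix g b assume g: "g \<in> carrier G" and b: "b \<in> W"
    then have "r (gact B g b) = gact X g (r b)"
      using r by (simp add: G_map_def W_def)
    then show "gact B g b \<in> W"
      using assms(7) g b G_space_action_closed[OF B topspace_grp_top g] by (simp add: W_def G_invariant_def)
  qed
  let ?V = "G_subspace B W"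
  have V: "G_space G ?V" and XU: "G_space G (G_subspace X U)"
    using B W W_inv assms(4,6,7) by (auto intro: G_space_open_subspace)
  have pV: "points ?V = W"
    by (auto simp: W_def)
  obtain \<F> where "cell_filtration ?V {} (points ?V) \<F>"
    using cellular_open_in_cell_complex[OF complex A W W_inv] unfolding pV cellular_def by blast
  then have complex': "relative_cell_complex G \<C> (G_subspace ?V {}) ?V (\<lambda>x. x)"
    by (rule cell_filtration_imp_relative_cell_complex[OF V])
  have E: "G_space G (G_subspace ?V {})"
    by (rule G_space_of_closed[OF V]) (simp_all add: G_invariant_def)
  have iU: "G_map G (G_subspace X U) ?V i"
    using i V XU ri G_map_image[OF i] by (intro G_map_subspace) (auto simp: W_def)
  have rU: "G_map G ?V (G_subspace X U) r"
    using r V XU by (intro G_map_subspace) (auto simp: W_def)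
  have "retract_of_map G (empty_G_space :: ('g, 'a) gspace) (G_subspace X U) id (G_subspace ?V {}) ?V (\<lambda>x. x)"
    unfolding retract_of_map_def
  proof (intro conjI exI)
    show "G_map G (empty_G_space :: ('g, 'a) gspace) (G_subspace X U) id"
      by (rule G_map_from_empty[OF G_space_empty XU]) (simp add: empty_G_space_def)
    show "G_map G (G_subspace ?V {}) ?V (\<lambda>x. x)"
      by (rule G_map_from_empty[OF E V]) simp
    show "G_map G (empty_G_space :: ('g, 'a) gspace) (G_subspace ?V {}) (\<lambda>x. undefined)"
      by (rule G_map_from_empty[OF G_space_empty E]) (simp add: empty_G_space_def)
    show "G_map G (G_subspace ?V {}) (empty_G_space :: ('g, 'a) gspace) (\<lambda>x. undefined)"
      by (rule G_map_from_empty[OF E G_space_empty]) simp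
    show "G_map G (G_subspace X U) ?V i" "G_map G ?V (G_subspace X U) r"
      by (rule iU, rule rU)
  qed (use ri in \<open>auto simp: empty_G_space_def\<close>)
  then show ?thesis
    unfolding C_cofibrant_def C_cofibration_def using complex' by blast
qed

end
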